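(* Fix $t\in(0,1)$. Consider any sequence $s_n\to\infty$ (of positive integers) with $s_n/n\to0$ and any sequence $v_n\to\infty$, and assume also that $$s_n\ge(\log n)^3,\qquad v_n\ge 3(\log\log(n/s_n))^{1/2}.$$ Let $\varphi^{\mathrm{C}\ell}$ be the cumulative $\ell$-value procedure at level $t$. Then there exist constants $c,C,C'>0$ depending on $t$ such that, uniformly over $\theta_0\in\ell_0(s_n;v_n)$, for all $n$ large enough, $$c\,\frac{\log\log(n/s_n)}{\log(n/s_n)}\le \mathrm{FDR}(\varphi^{\mathrm{C}\ell};\theta_0)-t\le C\,\frac{\log\log(n/s_n)}{\log(n/s_n)},$$ $$\mathrm{FNR}(\varphi^{\mathrm{C}\ell};\theta_0)\le C'\bigl(\log(n/s_n)\bigr)^{-1}.$$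
   Context: Model: for each $n$ one observes $X=(X_1,\dots,X_n)$ with $X_i=\theta_{0,i}+\varepsilon_i$, $\varepsilon_i$ iid $\mathcal N(0,1)$, $\theta_0\in\mathbb R^n$ deterministic; $P_{\theta_0},E_{\theta_0}$ denote the law of $X$ and its expectation. Signal class: with $S_0=\{i:\theta_{0,i}\ne0\}$, $$\ell_0(s_n;v_n)=\{\theta_0\in\mathbb R^n: |S_0|=s_n,\ |\theta_{0,i}|\ge\sqrt{2\log(n/s_n)}+v_n\ \text{for all } i\in S_0\}.$$ Error rates: for a procedure $\varphi=\varphi(X)\in\{0,1\}^n$, $$\mathrm{FDP}(\varphi;\theta_0)=\frac{\sum_{i=1}^n \mathbf 1\{\theta_{0,i}=0,\varphi_i=1\}}{1\vee\sum_{i=1}^n\varphi_i},\quad \mathrm{FDR}(\varphi;\theta_0)=E_{\theta_0}[\mathrm{FDP}(\varphi;\theta_0)],$$ $$\mathrm{FNR}(\varphi;\theta_0)=E_{\theta_0}\Bigl[\frac{\sum_{i=1}^n\mathbf 1\{\theta_{0,i}\neq0,\varphi_i=0\}}{1\vee\sum_{i=1}^n\mathbf 1\{\theta_{0,i}\ne0\}}\Bigr].$$ Procedure: let $\phi$ be the standard normal density and $g(x)=(2\pi)^{-1/2}x^{-2}(1-e^{-x^2/2})$ (extended continuously at $0$). For $w\in[0,1]$ the $\ell$-values are $$\ell_{i,w}(X)=\frac{(1-w)\phi(X_i)}{(1-w)\phi(X_i)+wg(X_i)}.$$ Let $\hat w=\operatorname{argmax}_{w\in[1/n,1]}\sum_{i=1}^n\log\bigl((1-w)\phi(X_i)+wg(X_i)\bigr)$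 (which exists almost surely), and $$\hat\lambda=\sup\Bigl\{\lambda\in[0,1]:\frac{\sum_{i=1}^n\ell_{i,\hat w}(X)\mathbf 1\{\ell_{i,\hat w}(X)<\lambda\}}{1\vee\sum_{i=1}^n\mathbf 1\{\ell_{i,\hat w}(X)<\lambda\}}\le t\Bigr\}.$$ The cumulative $\ell$-value procedure at level $t$ is $\varphi^{\mathrm{C}\ell}=(\mathbf 1\{\ell_{i,\hat w}(X)<\hat\lambda\})_{1\le i\le n}$. *)

theory Defs
  imports "HOL-Probability.Probability" "HOL-Real_Asymp.Real_Asymp"
begin

text \<open>
  A vector of \<open>\<real>\<^sup>n\<close> is an extensional function on the index set \<open>{1..n}\<close>.
\<close>

definition signal_class :: "nat \<Rightarrow> nat \<Rightarrow> real \<Rightarrow> (nat \<Rightarrow> real) set" where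
  "signal_class n s v =
     {\<theta> \<in> {1..n} \<rightarrow>\<^sub>E UNIV.
        card {i \<in> {1..n}. \<theta> i \<noteq> 0} = s \<and>
        (\<forall>i \<in> {1..n}. \<theta> i \<noteq> 0 \<longrightarrow> \<bar>\<theta> i\<bar> \<ge> sqrt (2 * ln (real n / real s)) + v)}"

definition noise_law :: "nat \<Rightarrow> (nat \<Rightarrow> real) measure" where
  "noise_law n = (\<Pi>\<^sub>M i\<in>{1..n}. density lborel (\<lambda>x. ennreal (std_normal_density x)))"

definition obs_law :: "nat \<Rightarrow> (nat \<Rightarrow> real) \<Rightarrow> (nat \<Rightarrow> real) measure" where
  "obs_law n \<theta> =
     distr (noise_law n) (\<Pi>\<^sub>M i\<in>{1..n}. borel) (\<lambda>\<epsilon>. \<lambda>i\<in>{1..n}. \<theta> i + \<epsilon> i)"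

text \<open>
  A procedure maps the data to a vector in \<open>{0,1}\<^sup>n\<close>, represented by a predicate on indices
  (only its values on \<open>{1..n}\<close> matter): \<open>\<phi> x i\<close> means that \<open>i\<close> is rejected.
\<close>

definition FDP :: "nat \<Rightarrow> (nat \<Rightarrow> bool) \<Rightarrow> (nat \<Rightarrow> real) \<Rightarrow> real" where
  "FDP n \<phi> \<theta> =
     (\<Sum>i=1..n. of_bool (\<theta> i = 0 \<and> \<phi> i)) / max 1 (\<Sum>i=1..n. of_bool (\<phi> i))"

definition FNP :: "nat \<Rightarrow> (nat \<Rightarrow> bool) \<Rightarrow> (nat \<Rightarrow> real) \<Rightarrow> real" where
  "FNP n \<phi> \<theta> =
     (\<Sum>i=1..n. of_bool (\<theta> i \<noteq> 0 \<and> \<not> \<phi> i)) / max 1 (\<Sum>i=1..n. of_bool (\<theta> i \<noteq> 0))"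

definition FDR :: "nat \<Rightarrow> ((nat \<Rightarrow> real) \<Rightarrow> nat \<Rightarrow> bool) \<Rightarrow> (nat \<Rightarrow> real) \<Rightarrow> real" where
  "FDR n \<phi> \<theta> = (\<integral>x. FDP n (\<phi> x) \<theta> \<partial>obs_law n \<theta>)"

definition FNR :: "nat \<Rightarrow> ((nat \<Rightarrow> real) \<Rightarrow> nat \<Rightarrow> bool) \<Rightarrow> (nat \<Rightarrow> real) \<Rightarrow> real" where
  "FNR n \<phi> \<theta> = (\<integral>x. FNP n (\<phi> x) \<theta> \<partial>obs_law n \<theta>)"

text \<open>
  The value at \<open>0\<close> is the limit of the other branch; see \<open>isCont_slab_density\<close> below.
\<close>

definition slab_density :: "real \<Rightarrow> real" where
  "slab_density x =
     (if x = 0 then 1 / (2 * sqrt (2 * pi))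
      else 1 / sqrt (2 * pi) * (1 / x\<^sup>2) * (1 - exp (- (x\<^sup>2) / 2)))"

lemma isCont_slab_density: "isCont slab_density 0"
proof -
  have "((\<lambda>x::real. (1 / x\<^sup>2) * (1 - exp (- (x\<^sup>2) / 2))) \<longlongrightarrow> 1 / 2) (at 0)"
    by real_asymp
  then have "((\<lambda>x::real. 1 / sqrt (2 * pi) * ((1 / x\<^sup>2) * (1 - exp (- (x\<^sup>2) / 2))))
          \<longlongrightarrow> 1 / sqrt (2 * pi) * (1 / 2)) (at 0)"
    by (rule tendsto_mult_left)
  then have "((\<lambda>x::real. 1 / sqrt (2 * pi) * (1 / x\<^sup>2) * (1 - exp (- (x\<^sup>2) / 2)))
          \<longlongrightarrow> 1 / (2 * sqrt (2 * pi))) (at 0)"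
    by (simp add: mult_ac)
  then have "(slab_density \<longlongrightarrow> 1 / (2 * sqrt (2 * pi))) (at 0)"
    by (rule Lim_transform_eventually)
       (auto simp: slab_density_def eventually_at_filter)
  then show ?thesis
    by (simp add: isCont_def slab_density_def)
qed

definition mixture_density :: "real \<Rightarrow> real \<Rightarrow> real" where
  "mixture_density w x = (1 - w) * std_normal_density x + w * slab_density x"

definition ell_value :: "real \<Rightarrow> real \<Rightarrow> real" where
  "ell_value w x = (1 - w) * std_normal_density x / mixture_density w x"

text \<open>
  For \<open>n \<ge> 1\<close> a maximiser always exists (the log-likelihood is continuous on a compact interval).
  It is unique unless all \<open>\<bar>x i\<bar>\<close> equal the unique positive point where \<open>slab_density\<close> and
  \<open>std_normal_density\<close> agree; so the choice made by \<open>arg_max_on\<close> matters only on a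
  finite (hence null and Borel) set of data vectors.
\<close>

definition w_hat :: "nat \<Rightarrow> (nat \<Rightarrow> real) \<Rightarrow> real" where
  "w_hat n x = arg_max_on (\<lambda>w. \<Sum>i=1..n. ln (mixture_density w (x i))) {1 / real n..1}"

definition lambda_hat :: "real \<Rightarrow> nat \<Rightarrow> (nat \<Rightarrow> real) \<Rightarrow> real" where
  "lambda_hat t n x =
     Sup {r \<in> {0..1}.
            (\<Sum>i=1..n. ell_value (w_hat n x) (x i) * of_bool (ell_value (w_hat n x) (x i) < r))
              / max 1 (\<Sum>i=1..n. of_bool (ell_value (w_hat n x) (x i) < r)) \<le> t}"

definition cl_procedure :: "real \<Rightarrow> nat \<Rightarrow> (nat \<Rightarrow> real) \<Rightarrow> nat \<Rightarrow> bool" where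
  "cl_procedure t n x i \<longleftrightarrow> ell_value (w_hat n x) (x i) < lambda_hat t n x"

end

theory Submission
  imports Defs
begin

text \<open>
  Write \<open>L = ln (n / s)\<close> and \<open>\<rho> = g / \<phi>\<close>. On an event whose complement has probability \<open>O(1/L)\<close>, all
  by Chebyshev's inequality, the score of the likelihood is positive at \<open>w1\<close> and negative at \<open>w2\<close>,
  both of order \<open>exp (- L) * sqrt L\<close>, which traps the maximiser; and the rejection threshold for
  \<open>\<bar>X i\<bar>\<close> lies between two points at which the expected number of nulls beyond is of order \<open>s\<close>. The mean
  of the rejected \<open>\<ell>\<close>-values is at most \<open>t\<close>, and short of it by at most one summand, so, up to
  negligible terms, \<open>FDP - t\<close> is the sum of \<open>1 - \<ell>\<close> over the rejected nulls divided by the number of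
  rejections. That sum is carried by the window between the threshold, where
  \<open>x\<^sup>2 = 2 L - ln L + O(1)\<close>, and the point where \<open>w * \<rho> = 1\<close>, where \<open>x\<^sup>2 = 2 L + ln L + O(1)\<close>; the
  mass \<open>w * g\<close> of this window is of order \<open>exp (- L) * ln L / L\<close>, which gives both bounds.
\<close>

section \<open>The slab-to-spike density ratio\<close>

text \<open>The obstacle is that the fitted weight and the threshold depend on all of the data.
  Monotonicity removes it: \<open>slab_prob\<close> increases with the weight and candidate
  rejection sets are nested by absolute value, so each sum over rejected nulls lies between two sums
  of independent terms with deterministic weight and threshold, for which two moments suffice.
  Errors of order 1 / L are affordable because the main term ln L / L is larger by an unbounded
  factor: missed signals, \<ell>-values of detected signals, the summand lost at the threshold and
  the exceptional probability all cost O(1 / L). The bound v \<ge> 3 sqrt (ln L) makes the chance of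
  missing a signal at most 1 / L, and the cubic growth of s lets Chebyshev resolve the excess sum,
  whose mean is only of order s ln L / L. All estimates are phrased in L, with n = s exp L, which
  makes them uniform in the signal. Since the error rates are Bochner integrals, measurability must
  also be proved for a procedure built on the choice operator \<open>arg_max_on\<close>.\<close>

definition rho :: "real \<Rightarrow> real" where
  "rho x = slab_density x / std_normal_density x"

lemma slab_density_eq: "slab_density x = std_normal_density x * rho x"
  using normal_density_pos[of 1 0 x] by (simp add: rho_def)

lemma rho_0: "rho 0 = 1 / 2"
  by (simp add: rho_def slab_density_def normal_density_def)

lemma rho_eq: "x \<noteq> 0 \<Longrightarrow> rho x = (exp (x\<^sup>2 / 2) - 1) / x\<^sup>2"
  by (simp add: rho_def slab_density_def std_normal_density_def exp_minus field_simps)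

text \<open>The numerator of the derivative is x exp x - (exp x - 1), positive because 1 - x < exp
  (- x). At u = x^2 / 2 the quotient is twice \<open>rho x\<close>.\<close>

lemma expm1_quotient_strict_mono:
  fixes u v :: real
  assumes "0 < u" "u < v"
  shows "(exp u - 1) / u < (exp v - 1) / v"
proof (rule DERIV_pos_imp_increasing[OF assms(2)])
  fix x :: real assume x: "u \<le> x" "x \<le> v"
  have "1 - x < exp (- x)"
    using exp_ge_add_one_self[of "-x"] exp_eq_one_iff[of "-x"] assms x
    by (smt (verit) exp_minus_ge exp_ge_one_minus_x_over_n_power_n ln_exp ln_le_minus_one ln_eq_minus_one exp_gt_zero)
  then have "(1 - x) * exp x < exp (-x) * exp x"
    by (intro mult_strict_right_mono) auto
  then have pos: "x * exp x - (exp x - 1) > 0"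
    by (simp add: algebra_simps flip: exp_add)
  have "((\<lambda>x. (exp x - 1) / x) has_real_derivative (x * exp x - (exp x - 1)) / x\<^sup>2) (at x)"
    using assms x by (auto intro!: derivative_eq_intros simp: power2_eq_square field_simps)
  with pos show "\<exists>y. ((\<lambda>x. (exp x - 1) / x) has_real_derivative y) (at x) \<and> y > 0"
    using assms x by (intro exI conjI) (assumption, auto)
qed

lemma rho_ge_half: "rho x \<ge> 1 / 2"
  using exp_ge_add_one_self[of "x\<^sup>2 / 2"]
  by (cases "x = 0") (auto simp: rho_0 rho_eq field_simps)

lemma rho_strict_mono:
  assumes "\<bar>x\<bar> < \<bar>y\<bar>"
  shows "rho x < rho y"
proof (cases "x = 0")
  case True
  have "y\<^sup>2 / 2 > 0" using assms by auto
  then have "1 + y\<^sup>2 / 2 < exp (y\<^sup>2 / 2)"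
    using exp_lower_Taylor_quadratic[of "y\<^sup>2 / 2"] by (smt (verit) zero_less_power divide_pos_pos)
  with True assms show ?thesis by (simp add: rho_0 rho_eq field_simps)
next
  case False
  have "x\<^sup>2 < y\<^sup>2"
    using assms by (metis abs_ge_zero power2_abs power_strict_mono zero_less_numeral)
  then have "(exp (x\<^sup>2 / 2) - 1) / (x\<^sup>2 / 2) < (exp (y\<^sup>2 / 2) - 1) / (y\<^sup>2 / 2)"
    using False by (intro expm1_quotient_strict_mono) auto
  with False assms show ?thesis by (auto simp: rho_eq field_simps)
qed

lemma rho_abs: "\<bar>x\<bar> = \<bar>y\<bar> \<Longrightarrow> rho x = rho y"
  by (auto simp: rho_def slab_density_def normal_density_def abs_eq_iff)

lemma rho_le_iff: "rho x \<le> rho y \<longleftrightarrow> \<bar>x\<bar> \<le> \<bar>y\<bar>"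
  by (metis linorder_cases not_le order_le_less rho_abs rho_strict_mono)

lemma rho_eq_iff: "rho x = rho y \<longleftrightarrow> \<bar>x\<bar> = \<bar>y\<bar>"
  by (metis order_antisym order_refl rho_abs rho_le_iff)

lemma slab_density_measurable [measurable]: "slab_density \<in> borel_measurable borel"
  unfolding slab_density_def[abs_def] by measurable

lemma rho_measurable [measurable]: "rho \<in> borel_measurable borel"
  unfolding rho_def[abs_def] by measurable

text \<open>The derivative in \<open>w\<close> of \<open>ln (mixture_density w x)\<close>; the
  common factor \<open>std_normal_density x\<close> has cancelled.\<close>

definition score :: "real \<Rightarrow> real \<Rightarrow> real" where
  "score w x = (rho x - 1) / (1 + w * (rho x - 1))"

text \<open>The posterior probability of the slab, that is, one minus the \<ell>-value.\<close>

definition slab_prob :: "real \<Rightarrow> real \<Rightarrow> real" where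
  "slab_prob w x = w * rho x / (1 + w * (rho x - 1))"

lemma score_measurable [measurable]: "score w \<in> borel_measurable borel"
  unfolding score_def[abs_def] by measurable

lemma slab_prob_measurable [measurable]: "slab_prob w \<in> borel_measurable borel"
  unfolding slab_prob_def[abs_def] by measurable

lemma mixture_density_eq:
  "mixture_density w x = std_normal_density x * (1 + w * (rho x - 1))"
  by (simp add: mixture_density_def slab_density_eq algebra_simps)

text \<open>Since \<open>rho\<close> never falls below 1 / 2, the ratio is at least 1 - w / 2. This
  keeps every later denominator away from 0, up to and including w = 1.\<close>

lemma mixture_ratio_ge_half:
  assumes "0 \<le> w" "w \<le> 1"
  shows "1 + w * (rho x - 1) \<ge> 1 / 2"
proof -
  have "w * (rho x - 1) \<ge> w * (- 1 / 2)"
    using rho_ge_half[of x] assms by (intro mult_left_mono) auto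
  with assms show ?thesis by simp
qed

lemma mixture_density_pos: "0 \<le> w \<Longrightarrow> w \<le> 1 \<Longrightarrow> mixture_density w x > 0"
  using mixture_ratio_ge_half[of w x] by (simp add: mixture_density_eq normal_density_pos)

lemma ell_value_eq:
  "ell_value w x = (1 - w) / (1 + w * (rho x - 1))"
  using normal_density_pos[of 1 0 x] by (simp add: ell_value_def mixture_density_eq)

lemma ell_value_slab_prob:
  assumes "0 \<le> w" "w \<le> 1"
  shows "ell_value w x = 1 - slab_prob w x"
proof -
  have "1 + w * (rho x - 1) \<noteq> 0" using mixture_ratio_ge_half[OF assms, of x] by linarith
  then show ?thesis by (simp add: ell_value_eq slab_prob_def field_simps)
qed

lemma slab_prob_le_1:
  assumes "0 \<le> w" "w \<le> 1" shows "slab_prob w x \<le> 1"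
  using mixture_ratio_ge_half[OF assms, of x] assms
  by (simp add: slab_prob_def divide_le_eq algebra_simps)

lemma slab_prob_nonneg:
  assumes "0 \<le> w" "w \<le> 1" shows "slab_prob w x \<ge> 0"
  using mixture_ratio_ge_half[OF assms, of x] assms rho_ge_half[of x]
  by (auto simp: slab_prob_def intro!: divide_nonneg_nonneg mult_nonneg_nonneg)

lemma slab_prob_pos:
  assumes "0 < w" "w \<le> 1" shows "slab_prob w x > 0"
  using mixture_ratio_ge_half[of w x] assms rho_ge_half[of x]
  by (auto simp: slab_prob_def intro!: divide_pos_pos mult_pos_pos)

lemma slab_prob_le: 
  assumes "0 \<le> w" "w \<le> 1" shows "slab_prob w x \<le> 2 * w * rho x"
proof -
  have "w * rho x * 1 \<le> w * rho x * (2 * (1 + w * (rho x - 1)))"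
    using mixture_ratio_ge_half[OF assms, of x] assms rho_ge_half[of x]
    by (intro mult_left_mono mult_nonneg_nonneg) auto
  then show ?thesis using mixture_ratio_ge_half[OF assms, of x]
    by (simp add: slab_prob_def field_simps)
qed

text \<open>After cross-multiplication the terms in w * w' cancel and
  \<open>w * rho x \<le> w' * rho x\<close> remains, so no case split on the sign of
  \<open>rho x - 1\<close> arises. This is what trades the estimated weight for deterministic
  ones.\<close>

lemma slab_prob_mono:
  assumes "0 \<le> w" "w \<le> w'" "w' \<le> 1" shows "slab_prob w x \<le> slab_prob w' x"
proof -
  have d: "1 + w * (rho x - 1) > 0" "1 + w' * (rho x - 1) > 0"
    using mixture_ratio_ge_half[of w x] mixture_ratio_ge_half[of w' x] assms by linarith+
  have "w * rho x * (1 + w' * (rho x - 1)) \<le> w' * rho x * (1 + w * (rho x - 1))"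
    using mult_right_mono[OF assms(2), of "rho x"] rho_ge_half[of x] by (simp add: algebra_simps)
  then show ?thesis unfolding slab_prob_def using d by (simp add: divide_simps mult.commute)
qed

text \<open>At w = 0 and w = 1 the \<ell>-value is constant in x, hence the strict bounds. All other
  weights induce the same ordering, so the sets that can be rejected consist of the largest absolute
  values although the weight is random.\<close>

lemma ell_value_le_iff:
  assumes "0 < w" "w < 1"
  shows "ell_value w x \<le> ell_value w y \<longleftrightarrow> \<bar>y\<bar> \<le> \<bar>x\<bar>"
proof -
  have d: "1 + w * (rho x - 1) > 0" "1 + w * (rho y - 1) > 0"
    using mixture_ratio_ge_half[of w x] mixture_ratio_ge_half[of w y] assms by linarith+
  then have "ell_value w x \<le> ell_value w y \<longleftrightarrow> rho y \<le> rho x"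
    using assms by (simp add: ell_value_eq divide_simps mult.commute)
  then show ?thesis by (simp add: rho_le_iff)
qed

lemma ell_value_bounds:
  assumes "0 < w" "w \<le> 1"
  shows "ell_value w x \<ge> 0" "ell_value w x < 1"
  using slab_prob_le_1[of w x] slab_prob_pos[of w x] assms
  by (auto simp: ell_value_slab_prob)

lemma ell_value_antimono:
  assumes "0 \<le> w" "w \<le> w'" "w' \<le> 1" shows "ell_value w' x \<le> ell_value w x"
  using slab_prob_mono[OF assms] assms by (simp add: ell_value_slab_prob)

lemma ell_value_le:
  assumes "0 < w" "w \<le> 1" shows "ell_value w x \<le> 1 / (w * rho x)"
proof -
  have "(1 - w) * (w * rho x) \<le> 1 * (w * rho x)"
    using assms rho_ge_half[of x] by (intro mult_right_mono mult_nonneg_nonneg) auto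
  then have "(1 - w) * (w * rho x) \<le> 1 + w * (rho x - 1)" using assms by (simp add: algebra_simps)
  moreover have "w * rho x > 0" using assms rho_ge_half[of x] by (intro mult_pos_pos) auto
  ultimately show ?thesis using mixture_ratio_ge_half[of w x] assms
    by (simp add: ell_value_eq divide_simps)
qed

lemma score_upper:
  assumes "0 < w" "w \<le> 1" shows "score w x \<le> 1 / w"
  using mixture_ratio_ge_half[of w x] assms by (simp add: score_def divide_simps mult.commute)

lemma score_lower:
  assumes "0 \<le> w" "w \<le> 1" shows "score w x \<ge> -1"
proof -
  have "- (1 + w * (rho x - 1)) \<le> rho x - 1"
    using mixture_ratio_ge_half[OF assms, of x] rho_ge_half[of x] by linarith
  then show ?thesis using mixture_ratio_ge_half[OF assms, of x] by (simp add: score_def divide_simps)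
qed

lemma score_abs_le:
  assumes "0 < w" "w \<le> 1" shows "\<bar>score w x\<bar> \<le> 1 / w"
proof -
  have "1 \<le> 1 / w" using assms by simp
  then show ?thesis using score_upper[OF assms, of x] score_lower[of w x] assms by linarith
qed

text \<open>Half of the ceiling 1 / w from \<open>score_upper\<close>; this is how a detected signal
  pushes up the total score at the smaller trial weight.\<close>

lemma score_large:
  assumes "0 < w" "w \<le> 1" "w * rho x \<ge> 2" shows "score w x \<ge> 1 / (2 * w)"
proof -
  have "1 + w * (rho x - 1) \<le> 2 * (w * (rho x - 1))"
    using assms by (simp add: algebra_simps)
  moreover have "1 + w * (rho x - 1) > 0" using mixture_ratio_ge_half[of w x] assms by simp
  ultimately show ?thesis using assms by (simp add: score_def field_simps)
qed

section \<open>Sums over independent noise coordinates\<close>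

definition std_normal :: "real measure" where
  "std_normal = density lborel (\<lambda>x. ennreal (std_normal_density x))"

lemma sets_std_normal [measurable_cong, simp]: "sets std_normal = sets borel"
  by (simp add: std_normal_def)

lemma space_std_normal [simp]: "space std_normal = UNIV"
  by (simp add: std_normal_def)

lemma prob_space_std_normal: "prob_space std_normal"
  unfolding std_normal_def by (rule prob_space_normal_density) simp

interpretation std_normal: prob_space std_normal
  by (rule prob_space_std_normal)

lemma noise_law_eq: "noise_law n = (\<Pi>\<^sub>M i\<in>{1..n}. std_normal)"
  by (simp add: noise_law_def std_normal_def)

lemma prob_space_noise_law: "prob_space (noise_law n)"
  unfolding noise_law_eq by (intro prob_space_PiM prob_space_std_normal)

lemma sets_noise_law [measurable_cong]: "sets (noise_law n) = sets (\<Pi>\<^sub>M i\<in>{1..n}. borel)"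
  unfolding noise_law_eq by (intro sets_PiM_cong) auto

lemma noise_component_measurable: "i \<in> {1..n} \<Longrightarrow> (\<lambda>\<epsilon>. \<epsilon> i) \<in> borel_measurable (noise_law n)"
  unfolding noise_law_eq by measurable

lemma finite_product_prob_space_std_normal:
  "finite_product_prob_space (\<lambda>_. std_normal) {1..n::nat}"
  by unfold_locales auto

lemma std_normal_integrable_bounded:
  fixes h :: "real \<Rightarrow> real"
  assumes "h \<in> borel_measurable borel" "\<And>x. \<bar>h x\<bar> \<le> K"
  shows "integrable std_normal h"
  using assms by (intro std_normal.integrable_const_bound[of _ K]) auto

lemma noise_integral_component:
  fixes h :: "real \<Rightarrow> real"
  assumes [measurable]: "h \<in> borel_measurable borel" and i: "i \<in> {1..n}"
  shows "(\<integral>\<epsilon>. h (\<epsilon> i) \<partial>noise_law n) = (\<integral>x. h x \<partial>std_normal)"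
proof -
  have [measurable]: "(\<lambda>\<epsilon>. \<epsilon> i) \<in> measurable (noise_law n) std_normal"
    using i unfolding noise_law_eq by measurable
  have "(\<integral>x. h x \<partial>distr (noise_law n) std_normal (\<lambda>\<epsilon>. \<epsilon> i)) = (\<integral>\<epsilon>. h (\<epsilon> i) \<partial>noise_law n)"
    by (rule integral_distr) measurable
  then show ?thesis
    using distr_PiM_component[of "{1..n}" "\<lambda>_. std_normal" i] i prob_space_std_normal
    by (simp add: noise_law_eq)
qed

lemma noise_integral_product:
  fixes a b :: "real \<Rightarrow> real"
  assumes ij: "i \<in> {1..n}" "j \<in> {1..n}" "i \<noteq> j"
    and int: "integrable std_normal a" "integrable std_normal b"
  shows "(\<integral>\<epsilon>. a (\<epsilon> i) * b (\<epsilon> j) \<partial>noise_law n) = (\<integral>x. a x \<partial>std_normal) * (\<integral>x. b x \<partial>std_normal)"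
proof -
  interpret finite_product_prob_space "\<lambda>_. std_normal" "{1..n}"
    by (rule finite_product_prob_space_std_normal)
  \<comment> \<open>Filling the other coordinates with the constant 1 lets the product formula over
    all of \<open>{1..n}\<close> apply to two factors.\<close>
  define f where "f = (\<lambda>k. if k = i then a else if k = j then b else (\<lambda>_. 1))"
  have split: "(\<Prod>k\<in>{1..n}. F k) = F i * F j * (\<Prod>k\<in>{1..n}-{i,j}. F k)" for F :: "nat \<Rightarrow> real"
    using ij prod.subset_diff[of "{i,j}" "{1..n}" F] by (simp add: mult.commute)
  have "(\<integral>\<epsilon>. (\<Prod>k\<in>{1..n}. f k (\<epsilon> k)) \<partial>noise_law n) = (\<Prod>k\<in>{1..n}. integral\<^sup>L std_normal (f k))"
    unfolding noise_law_eq using int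
    by (intro product_integral_prod) (auto simp: f_def)
  moreover have "(\<Prod>k\<in>{1..n}-{i,j}. f k (\<epsilon> k)) = 1" for \<epsilon>
    by (intro prod.neutral) (auto simp: f_def)
  moreover have "(\<Prod>k\<in>{1..n}-{i,j}. integral\<^sup>L std_normal (f k)) = 1"
    by (intro prod.neutral) (auto simp: f_def std_normal.prob_space[simplified])
  ultimately show ?thesis
    using ij by (simp only: split mult_1_right) (simp add: f_def)
qed

text \<open>Centred terms at distinct coordinates are uncorrelated, so only the diagonal survives.
  The variance is bounded by the raw second moment, the quantity that the later estimates supply;
  \<open>K\<close> only secures integrability.\<close>

lemma noise_chebyshev:
  fixes h :: "real \<Rightarrow> real"
  assumes h [measurable]: "h \<in> borel_measurable borel" and K: "\<And>x. \<bar>h x\<bar> \<le> K"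
    and A: "A \<subseteq> {1..n}" and a: "a > 0"
  shows "measure (noise_law n)
      {\<epsilon> \<in> space (noise_law n). \<bar>(\<Sum>i\<in>A. h (\<epsilon> i)) - real (card A) * (\<integral>x. h x \<partial>std_normal)\<bar> \<ge> a}
    \<le> real (card A) * (\<integral>x. (h x)\<^sup>2 \<partial>std_normal) / a\<^sup>2"
proof -
  interpret N: prob_space "noise_law n" by (rule prob_space_noise_law)
  have fin: "finite A" using A finite_subset by auto
  have K0: "K \<ge> 0" using K[of 0] by linarith
  define m where "m = (\<integral>x. h x \<partial>std_normal)"
  define k where "k x = h x - m" for x
  have kmeas [measurable]: "k \<in> borel_measurable borel" unfolding k_def[abs_def] by measurable
  have kb: "\<bar>k x\<bar> \<le> K + \<bar>m\<bar>" for x using K[of x] unfolding k_def by linarith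
  have hint: "integrable std_normal h" by (rule std_normal_integrable_bounded[OF h K])
  have kint: "integrable std_normal k" by (rule std_normal_integrable_bounded[OF kmeas kb])
  have k2int: "integrable std_normal (\<lambda>x. (k x)\<^sup>2)"
    using kb by (intro std_normal_integrable_bounded[of _ "(K + \<bar>m\<bar>)\<^sup>2"])
      (auto simp: abs_le_square_iff[symmetric] intro: order_trans[OF kb])
  have h2int: "integrable std_normal (\<lambda>x. (h x)\<^sup>2)"
    using K K0 by (intro std_normal_integrable_bounded[of _ "K\<^sup>2"]) (auto simp: abs_le_square_iff[symmetric])
  have k0: "(\<integral>x. k x \<partial>std_normal) = 0"
    using hint by (simp add: k_def m_def std_normal.prob_space[simplified])
  have k2: "(\<integral>x. (k x)\<^sup>2 \<partial>std_normal) \<le> (\<integral>x. (h x)\<^sup>2 \<partial>std_normal)"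
    using std_normal.variance_eq[OF hint h2int] by (simp add: k_def m_def)
  have comp [measurable]: "(\<lambda>\<epsilon>. \<epsilon> i) \<in> borel_measurable (noise_law n)" if "i \<in> A" for i
    using that A by (intro noise_component_measurable) auto
  have pint: "integrable (noise_law n) (\<lambda>\<epsilon>. k (\<epsilon> i) * k (\<epsilon> j))" if "i \<in> A" "j \<in> A" for i j
  proof (rule N.integrable_const_bound[of _ "(K + \<bar>m\<bar>) * (K + \<bar>m\<bar>)"])
    show "AE \<epsilon> in noise_law n. norm (k (\<epsilon> i) * k (\<epsilon> j)) \<le> (K + \<bar>m\<bar>) * (K + \<bar>m\<bar>)"
      using kb K0 by (intro AE_I2) (auto simp: abs_mult intro!: mult_mono)
  qed (use that in measurable)
  have prod: "(\<integral>\<epsilon>. k (\<epsilon> i) * k (\<epsilon> j) \<partial>noise_law n) = (if i = j then (\<integral>x. (k x)\<^sup>2 \<partial>std_normal) else 0)"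
    if "i \<in> A" "j \<in> A" for i j
  proof (cases "i = j")
    case True
    then show ?thesis using noise_integral_component[of "\<lambda>x. (k x)\<^sup>2" i n] that A
      by (auto simp: power2_eq_square)
  next
    case False
    have "i \<in> {1..n}" "j \<in> {1..n}" using that A by auto
    from noise_integral_product[OF this False kint kint] False k0 show ?thesis by simp
  qed
  define f where "f \<epsilon> = (\<Sum>i\<in>A. h (\<epsilon> i)) - real (card A) * m" for \<epsilon> :: "nat \<Rightarrow> real"
  have f: "f \<epsilon> = (\<Sum>i\<in>A. k (\<epsilon> i))" for \<epsilon> by (simp add: f_def k_def sum_subtractf)
  have fmeas [measurable]: "f \<in> borel_measurable (noise_law n)" unfolding f[abs_def] by measurable
  have f2: "(f \<epsilon>)\<^sup>2 = (\<Sum>i\<in>A. \<Sum>j\<in>A. k (\<epsilon> i) * k (\<epsilon> j))" for \<epsilon>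
    by (simp add: f power2_eq_square sum_product)
  have f2int: "integrable (noise_law n) (\<lambda>\<epsilon>. (f \<epsilon>)\<^sup>2)"
    unfolding f2 using pint by (intro Bochner_Integration.integrable_sum) auto
  have "(\<integral>\<epsilon>. (f \<epsilon>)\<^sup>2 \<partial>noise_law n) = (\<Sum>i\<in>A. \<Sum>j\<in>A. \<integral>\<epsilon>. k (\<epsilon> i) * k (\<epsilon> j) \<partial>noise_law n)"
    unfolding f2 using pint by (subst Bochner_Integration.integral_sum; (intro sum.cong refl Bochner_Integration.integral_sum Bochner_Integration.integrable_sum)?) auto
  also have "\<dots> = (\<Sum>i\<in>A. \<Sum>j\<in>A. if i = j then (\<integral>x. (k x)\<^sup>2 \<partial>std_normal) else 0)"
    using prod by (intro sum.cong refl) auto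
  also have "\<dots> = real (card A) * (\<integral>x. (k x)\<^sup>2 \<partial>std_normal)"
    using fin by simp
  also have "\<dots> \<le> real (card A) * (\<integral>x. (h x)\<^sup>2 \<partial>std_normal)"
    using k2 by (intro mult_left_mono) auto
  finally have le: "(\<integral>\<epsilon>. (f \<epsilon>)\<^sup>2 \<partial>noise_law n) \<le> real (card A) * (\<integral>x. (h x)\<^sup>2 \<partial>std_normal)" .
  have "measure (noise_law n) {\<epsilon> \<in> space (noise_law n). \<bar>f \<epsilon>\<bar> \<ge> a} \<le> (\<integral>\<epsilon>. (f \<epsilon>)\<^sup>2 \<partial>noise_law n) / a\<^sup>2"
    by (rule N.second_moment_method[OF fmeas f2int a])
  also have "\<dots> \<le> real (card A) * (\<integral>x. (h x)\<^sup>2 \<partial>std_normal) / a\<^sup>2"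
    using le by (intro divide_right_mono) auto
  finally show ?thesis unfolding f_def m_def .
qed

section \<open>Almost sure absence of ties\<close>

lemma std_normal_null_singleton: "emeasure std_normal {c} = 0"
  unfolding std_normal_def by (subst emeasure_density) (auto simp: nn_integral_indicator_singleton')

text \<open>With the other coordinates fixed, a tie pins \<open>\<epsilon> i\<close> to one of two
  values, which is a null event; integrating out that coordinate first gives the claim. Without ties
  the \<ell>-values are distinct, which limits the shortfall of their mean at the threshold to one
  summand.\<close>

lemma noise_no_ties:
  assumes ij: "i \<in> {1..n}" "j \<in> {1..n}" "i \<noteq> j"
  shows "AE \<epsilon> in noise_law n. \<bar>\<theta> i + \<epsilon> i\<bar> \<noteq> \<bar>\<theta> j + \<epsilon> j\<bar>"
proof -
  interpret finite_product_prob_space "\<lambda>_. std_normal" "{1..n}"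
    by (rule finite_product_prob_space_std_normal)
  have ins: "insert i ({1..n} - {i}) = {1..n}" using ij by auto
  have cm: "(\<lambda>\<epsilon>. \<epsilon> i) \<in> borel_measurable (noise_law n)" "(\<lambda>\<epsilon>. \<epsilon> j) \<in> borel_measurable (noise_law n)"
    using ij by (auto intro!: noise_component_measurable)
  note [measurable] = cm
  define E where "E = {\<epsilon> \<in> space (noise_law n). \<bar>\<theta> i + \<epsilon> i\<bar> = \<bar>\<theta> j + \<epsilon> j\<bar>}"
  have E: "E \<in> sets (noise_law n)" unfolding E_def by measurable
  have E': "E \<in> sets (PiM (insert i ({1..n} - {i})) (\<lambda>_. std_normal))"
    using E unfolding ins noise_law_eq .
  have "emeasure (noise_law n) E
      = (\<integral>\<^sup>+\<epsilon>. indicator E \<epsilon> \<partial>(PiM (insert i ({1..n} - {i})) (\<lambda>_. std_normal)))"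
    using E unfolding ins noise_law_eq by simp
  also have "\<dots> = (\<integral>\<^sup>+\<epsilon>. (\<integral>\<^sup>+y. indicator E (\<epsilon>(i := y)) \<partial>std_normal) \<partial>(PiM ({1..n} - {i}) (\<lambda>_. std_normal)))"
    using E' by (intro product_nn_integral_insert) auto
  also have "\<dots> = (\<integral>\<^sup>+\<epsilon>. 0 \<partial>(PiM ({1..n} - {i}) (\<lambda>_. std_normal)))"
  proof (intro nn_integral_cong)
    fix \<epsilon> :: "nat \<Rightarrow> real"
    define c where "c = \<bar>\<theta> j + \<epsilon> j\<bar>"
    have "(\<integral>\<^sup>+y. indicator E (\<epsilon>(i := y)) \<partial>std_normal) \<le> (\<integral>\<^sup>+y. indicator {c - \<theta> i} y + indicator {- c - \<theta> i} y \<partial>std_normal)"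
      using ij by (intro nn_integral_mono) (auto simp: E_def c_def split: split_indicator)
    also have "\<dots> = 0"
      by (subst nn_integral_add) (auto simp: std_normal_null_singleton cong: measurable_cong_sets)
    finally show "(\<integral>\<^sup>+y. indicator E (\<epsilon>(i := y)) \<partial>std_normal) = 0" by simp
  qed
  finally have "emeasure (noise_law n) E = 0" by simp
  then show ?thesis
    using E by (intro AE_I[of _ _ E]) (auto simp: E_def)
qed

section \<open>Gaussian tails and the slab\<close>

lemma std_normal_integral_lborel:
  fixes h :: "real \<Rightarrow> real"
  assumes "h \<in> borel_measurable borel"
  shows "(\<integral>x. h x \<partial>std_normal) = (\<integral>x. std_normal_density x * h x \<partial>lborel)"
  using assms unfolding std_normal_def
  by (subst integral_density) auto

lemma std_normal_integrable_lborel: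
  fixes h :: "real \<Rightarrow> real"
  assumes "h \<in> borel_measurable borel"
  shows "integrable std_normal h \<longleftrightarrow> integrable lborel (\<lambda>x. std_normal_density x * h x)"
  using assms unfolding std_normal_def
  by (subst integrable_density) auto

lemma nn_integral_reflect:
  fixes f :: "real \<Rightarrow> ennreal"
  assumes [measurable]: "f \<in> borel_measurable borel"
  shows "(\<integral>\<^sup>+x. f (- x) \<partial>lborel) = (\<integral>\<^sup>+x. f x \<partial>lborel)"
proof -
  have "(\<integral>\<^sup>+x. f x \<partial>lborel) = (\<integral>\<^sup>+x. f x \<partial>distr lborel borel uminus)"
    by (simp add: lborel_distr_uminus)
  also have "\<dots> = (\<integral>\<^sup>+x. f (- x) \<partial>lborel)"
    by (subst nn_integral_distr) auto
  finally show ?thesis by simp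
qed

lemma std_normal_density_deriv:
  "(std_normal_density has_real_derivative (- x * std_normal_density x)) (at x)"
  unfolding std_normal_density_def
  by (auto intro!: derivative_eq_intros simp: field_simps power2_eq_square)

lemma std_normal_density_tendsto_0: "(std_normal_density \<longlongrightarrow> 0) at_top"
proof -
  have "((\<lambda>x::real. exp (- x\<^sup>2 / 2)) \<longlongrightarrow> 0) at_top" by real_asymp
  from tendsto_mult_right_zero[OF this, of "1 / sqrt (2 * pi)"] show ?thesis
    unfolding std_normal_density_def[abs_def] .
qed

text \<open>Mills' bound: for y \<ge> x the factor y / x is at least 1 and turns the integrand into
  an exact derivative. Reflection supplies the other tail.\<close>

lemma std_normal_tail_upper:
  assumes "x > 0"
  shows "measure std_normal {y. x \<le> \<bar>y\<bar>} \<le> 2 * std_normal_density x / x"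
proof -
  let ?\<phi> = "std_normal_density"
  have "(\<integral>\<^sup>+y. ennreal (y / x * ?\<phi> y) * indicator {x..} y \<partial>lborel) = ennreal (0 - (- ?\<phi> x / x))"
  proof (rule nn_integral_FTC_atLeast[where F = "\<lambda>y. - ?\<phi> y / x"])
    show "((\<lambda>y. - ?\<phi> y / x) has_real_derivative y / x * ?\<phi> y) (at y)" for y
      using DERIV_cdivide[OF DERIV_minus[OF std_normal_density_deriv[of y]], of x] by simp
    show "((\<lambda>y. - ?\<phi> y / x) \<longlongrightarrow> 0) at_top"
      using tendsto_divide[OF tendsto_minus[OF std_normal_density_tendsto_0] tendsto_const, of x] assms by simp
  qed (use assms in auto)
  moreover have "(\<integral>\<^sup>+y. ennreal (?\<phi> y) * indicator {x..} y \<partial>lborel)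
      \<le> (\<integral>\<^sup>+y. ennreal (y / x * ?\<phi> y) * indicator {x..} y \<partial>lborel)"
  proof (intro nn_integral_mono)
    fix y
    have "?\<phi> y \<le> y / x * ?\<phi> y" if "x \<le> y"
      using mult_right_mono[of 1 "y / x" "?\<phi> y"] that assms by simp
    then show "ennreal (?\<phi> y) * indicator {x..} y \<le> ennreal (y / x * ?\<phi> y) * indicator {x..} y"
      by (auto split: split_indicator intro: ennreal_leI)
  qed
  ultimately have one: "(\<integral>\<^sup>+y. ennreal (?\<phi> y) * indicator {x..} y \<partial>lborel) \<le> ennreal (?\<phi> x / x)"
    by simp
  have "emeasure std_normal {y. x \<le> \<bar>y\<bar>} = (\<integral>\<^sup>+y. ennreal (?\<phi> y) * indicator {y. x \<le> \<bar>y\<bar>} y \<partial>lborel)"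
    unfolding std_normal_def by (subst emeasure_density) auto
  also have "\<dots> \<le> (\<integral>\<^sup>+y. ennreal (?\<phi> y) * indicator {x..} y + ennreal (?\<phi> (- y)) * indicator {x..} (- y) \<partial>lborel)"
    by (intro nn_integral_mono) (auto simp: std_normal_density_def split: split_indicator)
  also have "\<dots> = (\<integral>\<^sup>+y. ennreal (?\<phi> y) * indicator {x..} y \<partial>lborel)
      + (\<integral>\<^sup>+y. ennreal (?\<phi> (- y)) * indicator {x..} (- y) \<partial>lborel)"
    by (subst nn_integral_add) auto
  also have "(\<integral>\<^sup>+y. ennreal (?\<phi> (- y)) * indicator {x..} (- y) \<partial>lborel)
      = (\<integral>\<^sup>+y. ennreal (?\<phi> y) * indicator {x..} y \<partial>lborel)"
    by (subst nn_integral_reflect[of "\<lambda>y. ennreal (?\<phi> y) * indicator {x..} y", symmetric]) auto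
  also have "(\<integral>\<^sup>+y. ennreal (?\<phi> y) * indicator {x..} y \<partial>lborel)
      + (\<integral>\<^sup>+y. ennreal (?\<phi> y) * indicator {x..} y \<partial>lborel) \<le> ennreal (?\<phi> x / x) + ennreal (?\<phi> x / x)"
    using one by (intro add_mono)
  also have "\<dots> = ennreal (2 * ?\<phi> x / x)"
    using assms by (subst ennreal_plus[symmetric]) (auto simp: field_simps)
  finally show ?thesis
    using assms by (simp add: std_normal.emeasure_eq_measure)
qed

text \<open>Only the interval from x to x + 1 / x on the positive side is kept. Along it the
  Gaussian exponent changes by at most 1 + 1 / (2 x^2), so for x \<ge> 1 the loss is a constant
  factor.\<close>

lemma std_normal_tail_lower:
  assumes "x > 0"
  shows "std_normal_density (x + 1 / x) / x \<le> measure std_normal {y. x < \<bar>y\<bar>}"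
proof -
  let ?\<phi> = "std_normal_density"
  have "?\<phi> (x + 1 / x) \<le> ?\<phi> y" if "x < y" "y \<le> x + 1 / x" for y
  proof -
    have "y\<^sup>2 \<le> (x + 1 / x)\<^sup>2" using that assms by (intro power_mono) auto
    then show ?thesis by (simp add: std_normal_density_def divide_right_mono)
  qed
  then have "(\<integral>\<^sup>+y. ennreal (?\<phi> (x + 1 / x)) * indicator {x<..x + 1 / x} y \<partial>lborel)
      \<le> (\<integral>\<^sup>+y. ennreal (?\<phi> y) * indicator {y. x < \<bar>y\<bar>} y \<partial>lborel)"
    by (intro nn_integral_mono) (auto split: split_indicator intro!: ennreal_leI)
  also have "\<dots> = emeasure std_normal {y. x < \<bar>y\<bar>}"
    unfolding std_normal_def by (subst emeasure_density) auto
  also have "(\<integral>\<^sup>+y. ennreal (?\<phi> (x + 1 / x)) * indicator {x<..x + 1 / x} y \<partial>lborel) = ennreal (?\<phi> (x + 1 / x) / x)"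
    using assms by (simp add: nn_integral_cmult ennreal_mult[symmetric])
  finally show ?thesis by (simp add: std_normal.emeasure_eq_measure)
qed

text \<open>The pattern of all upper moment bounds below: a Lebesgue majorant \<open>G\<close> where
  the density ratio is under control, and a constant times the Gaussian tail where only a crude
  bound on \<open>h\<close> is available.\<close>

lemma std_normal_integral_le:
  fixes h G :: "real \<Rightarrow> real"
  assumes h: "h \<in> borel_measurable borel" "\<And>y. \<bar>h y\<bar> \<le> K" and G: "integrable lborel G"
    and x: "x > 0" and c: "c \<ge> 0"
    and le: "\<And>y. std_normal_density y * h y \<le> G y + c * (std_normal_density y * indicator {y. x \<le> \<bar>y\<bar>} y)"
  shows "(\<integral>y. h y \<partial>std_normal) \<le> (\<integral>y. G y \<partial>lborel) + c * (2 * std_normal_density x / x)"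
proof -
  have tail: "integrable std_normal (indicator {y. x \<le> \<bar>y\<bar>} :: real \<Rightarrow> real)"
    by (intro std_normal_integrable_bounded[of _ 1]) (auto split: split_indicator)
  then have tail': "integrable lborel (\<lambda>y. std_normal_density y * indicator {y. x \<le> \<bar>y\<bar>} y)"
    by (subst (asm) std_normal_integrable_lborel) auto
  have "(\<integral>y. h y \<partial>std_normal) = (\<integral>y. std_normal_density y * h y \<partial>lborel)"
    by (rule std_normal_integral_lborel[OF h(1)])
  also have "\<dots> \<le> (\<integral>y. G y + c * (std_normal_density y * indicator {y. x \<le> \<bar>y\<bar>} y) \<partial>lborel)"
    using tail' G std_normal_integrable_bounded[OF h] le
    by (intro integral_mono) (auto simp: std_normal_integrable_lborel[OF h(1)])
  also have "\<dots> = (\<integral>y. G y \<partial>lborel) + c * (\<integral>y. std_normal_density y * indicator {y. x \<le> \<bar>y\<bar>} y \<partial>lborel)"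
    using tail' G by simp
  also have "(\<integral>y. std_normal_density y * indicator {y. x \<le> \<bar>y\<bar>} y \<partial>lborel) = measure std_normal {y. x \<le> \<bar>y\<bar>}"
    by (subst std_normal_integral_lborel[symmetric]) auto
  finally show ?thesis
    using mult_left_mono[OF std_normal_tail_upper[OF x] c] by linarith
qed

lemma std_normal_integral_ge:
  fixes h G :: "real \<Rightarrow> real"
  assumes h: "h \<in> borel_measurable borel" "\<And>y. \<bar>h y\<bar> \<le> K" and G: "integrable lborel G"
    and le: "\<And>y. G y \<le> std_normal_density y * h y"
  shows "(\<integral>y. G y \<partial>lborel) \<le> (\<integral>y. h y \<partial>std_normal)"
  unfolding std_normal_integral_lborel[OF h(1)]
  using G std_normal_integrable_bounded[OF h] le
  by (intro integral_mono) (auto simp: std_normal_integrable_lborel[OF h(1)])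

section \<open>Slab mass against normal mass on a symmetric interval\<close>

lemma isCont_slab_density': "isCont slab_density x"
proof (cases "x = 0")
  case True
  then show ?thesis using isCont_slab_density by simp
next
  case False
  let ?f = "\<lambda>x::real. 1 / sqrt (2 * pi) * (1 / x\<^sup>2) * (1 - exp (- (x\<^sup>2) / 2))"
  have "\<forall>\<^sub>F y in nhds x. slab_density y = ?f y"
    using t1_space_nhds[OF False] by eventually_elim (simp add: slab_density_def)
  moreover have "isCont ?f x" using False by (intro continuous_intros) auto
  ultimately show ?thesis by (subst isCont_cong)
qed

text \<open>Away from \<open>0\<close> the antiderivative of \<open>slab_density - std_normal_density\<close> is elementary, so the
  two densities can be compared on \<open>[-z, z]\<close> without computing the total mass of the slab.\<close>

lemma slab_minus_normal_integral:
  assumes z: "z > 0"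
  shows "has_bochner_integral lborel (\<lambda>x. (slab_density x - std_normal_density x) * indicator {- z..z} x)
    (- 2 * (1 - exp (- z\<^sup>2 / 2)) / (z * sqrt (2 * pi)))"
proof -
  \<comment> \<open>Extended by its limit 0 at the origin. The difference quotient there tends to -1
    / (2 sqrt (2 pi)), which is the gap between the two densities at 0, so the fundamental theorem
    applies across the origin.\<close>
  define F where "F x = (if x = 0 then 0 else - (1 - exp (- x\<^sup>2 / 2)) / (x * sqrt (2 * pi)))" for x :: real
  have "has_bochner_integral lborel (\<lambda>x. (slab_density x - std_normal_density x) * indicator {- z..z} x) (F z - F (- z))"
  proof (rule has_bochner_integral_FTC_Icc_real)
    fix x :: real
    show "DERIV F x :> slab_density x - std_normal_density x"
    proof (cases "x = 0")
      case False
      let ?f = "\<lambda>x::real. - (1 - exp (- x\<^sup>2 / 2)) / (x * sqrt (2 * pi))"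
      have "\<forall>\<^sub>F y in nhds x. F y = ?f y"
        using t1_space_nhds[OF False] by eventually_elim (simp add: F_def)
      moreover have "DERIV ?f x :> slab_density x - std_normal_density x"
        using False unfolding slab_density_def std_normal_density_def
        by (auto intro!: derivative_eq_intros simp: field_simps power2_eq_square)
      ultimately show ?thesis by (subst DERIV_cong_ev[OF refl]) auto
    next
      case True
      have "((\<lambda>h::real. - (1 - exp (- h\<^sup>2 / 2)) / h\<^sup>2) \<longlongrightarrow> - 1 / 2) (at 0)"
        by real_asymp
      from tendsto_mult_left[OF this, of "1 / sqrt (2 * pi)"]
      have "((\<lambda>h. (F (0 + h) - F 0) / h) \<longlongrightarrow> slab_density 0 - std_normal_density 0) (at 0)"
        by (rule Lim_transform_eventually[OF _ , THEN tendsto_eq_rhs])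
           (auto simp: F_def eventually_at_filter slab_density_def std_normal_density_def power2_eq_square field_simps)
      then show ?thesis using True by (simp add: DERIV_def)
    qed
    show "isCont (\<lambda>x. slab_density x - std_normal_density x) x"
      unfolding std_normal_density_def by (intro continuous_intros isCont_slab_density') auto
  qed (use z in auto)
  moreover have "- a / (z * b) - - a / (- z * b) = - 2 * a / (z * b)" for a b
    using z by (cases "b = 0") (auto simp: field_simps)
  then have "F z - F (- z) = - 2 * (1 - exp (- z\<^sup>2 / 2)) / (z * sqrt (2 * pi))"
    using z by (simp add: F_def)
  ultimately show ?thesis by simp
qed


section \<open>Growth of the density ratio\<close>

lemma std_normal_density_le_exp: "std_normal_density x \<le> exp (- x\<^sup>2 / 2)"
proof -
  have "sqrt (2 * pi) \<ge> 1" using pi_ge_two by (intro real_le_rsqrt) auto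
  then show ?thesis by (simp add: std_normal_density_def divide_le_eq)
qed

lemma rho_le_exp: "rho x \<le> exp (x\<^sup>2 / 2)"
proof (cases "x = 0")
  case False
  have "1 - x\<^sup>2 / 2 \<le> exp (- (x\<^sup>2 / 2))" using exp_ge_add_one_self[of "- (x\<^sup>2 / 2)"] by simp
  then have "(1 - x\<^sup>2 / 2) * exp (x\<^sup>2 / 2) \<le> exp (- (x\<^sup>2 / 2)) * exp (x\<^sup>2 / 2)"
    by (intro mult_right_mono) auto
  then have "exp (x\<^sup>2 / 2) - 1 \<le> x\<^sup>2 / 2 * exp (x\<^sup>2 / 2)"
    by (simp add: algebra_simps flip: exp_add)
  also have "\<dots> \<le> x\<^sup>2 * exp (x\<^sup>2 / 2)" by (intro mult_right_mono) auto
  finally show ?thesis using False by (simp add: rho_eq divide_le_eq mult.commute)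
qed (simp add: rho_0)

text \<open>The left side grows like exp (x^2 / 2) / x^4. The gain 1 / L^2 is essential: multiplied
  by a weight and integrated over a length of order sqrt L, it leaves a correction of order 1 / L,
  below the score mean of order 1 / sqrt L.\<close>

lemma rho_square_le:
  "\<forall>\<^sub>F L in at_top. \<forall>x. x\<^sup>2 \<le> 2 * L \<longrightarrow> (rho x)\<^sup>2 * std_normal_density x \<le> exp L / L\<^sup>2"
proof -
  have "\<forall>\<^sub>F L::real in at_top. exp (L / 2) \<le> exp L / L\<^sup>2" by real_asymp
  then show ?thesis using eventually_gt_at_top[of "0::real"]
  proof eventually_elim
    case (elim L)
    show ?case
    proof (intro allI impI)
      fix x assume x: "x\<^sup>2 \<le> 2 * L"
      \<comment> \<open>Below x^2 = L the factor 1 / x^2 is not small, but exp (L / 2) is already at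
        most exp L / L^2; above it 1 / x^2 is at most 1 / L.\<close>
      define B where "B = (if x\<^sup>2 \<le> L then 1 else 1 / L)"
      have rho: "rho x \<le> B * exp (x\<^sup>2 / 2)"
      proof (cases "x\<^sup>2 \<le> L")
        case False
        then have "x \<noteq> 0" using elim by auto
        then have "rho x \<le> exp (x\<^sup>2 / 2) / x\<^sup>2" by (simp add: rho_eq divide_right_mono)
        also have "\<dots> \<le> exp (x\<^sup>2 / 2) / L" using False elim \<open>x \<noteq> 0\<close> by (intro divide_left_mono mult_pos_pos) auto
        finally show ?thesis using False by (simp add: B_def)
      qed (use rho_le_exp[of x] in \<open>simp add: B_def\<close>)
      have "(rho x)\<^sup>2 \<le> (B * exp (x\<^sup>2 / 2))\<^sup>2"
        using rho rho_ge_half[of x] by (intro power_mono) auto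
      then have "(rho x)\<^sup>2 * std_normal_density x \<le> (B * exp (x\<^sup>2 / 2))\<^sup>2 * exp (- x\<^sup>2 / 2)"
        using std_normal_density_le_exp[of x] by (intro mult_mono) auto
      also have "\<dots> = B\<^sup>2 * exp (x\<^sup>2 / 2)"
        by (simp add: power2_eq_square flip: exp_add)
      also have "\<dots> \<le> exp L / L\<^sup>2"
      proof (cases "x\<^sup>2 \<le> L")
        case True
        then have "exp (x\<^sup>2 / 2) \<le> exp (L / 2)" by simp
        also note elim(1)
        finally show ?thesis using True by (simp add: B_def)
      next
        case False
        have "exp (x\<^sup>2 / 2) \<le> exp L" using x by simp
        then show ?thesis using False elim by (simp add: B_def power_divide divide_right_mono)
      qed
      finally show "(rho x)\<^sup>2 * std_normal_density x \<le> exp L / L\<^sup>2" .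
    qed
  qed
qed

text \<open>The point with \<open>exp (- x\<^sup>2 / 2) = \<kappa> * exp (- L) * sqrt L\<close>, whose Gaussian tail probability
  is of exact order \<open>\<kappa> * exp (- L)\<close>.\<close>

definition tail_point :: "real \<Rightarrow> real \<Rightarrow> real" where
  "tail_point \<kappa> L = sqrt (2 * L - ln L - 2 * ln \<kappa>)"

lemma tail_point_range:
  assumes "\<kappa> > 0"
  shows "\<forall>\<^sub>F L in at_top. (tail_point \<kappa> L)\<^sup>2 = 2 * L - ln L - 2 * ln \<kappa> \<and>
    tail_point \<kappa> L \<ge> sqrt L \<and> tail_point \<kappa> L \<le> sqrt (2 * L)"
proof -
  have "\<forall>\<^sub>F L in at_top. L \<le> 2 * L - ln L - 2 * ln \<kappa>" by real_asymp
  moreover have "\<forall>\<^sub>F L in at_top. 2 * L - ln L - 2 * ln \<kappa> \<le> 2 * L" by real_asymp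
  ultimately show ?thesis using eventually_gt_at_top[of "0::real"]
    by eventually_elim (simp add: tail_point_def)
qed

lemma std_normal_density_tail_point:
  assumes "\<kappa> > 0" "L > 0" "(tail_point \<kappa> L)\<^sup>2 = 2 * L - ln L - 2 * ln \<kappa>"
  shows "exp (- (tail_point \<kappa> L)\<^sup>2 / 2) = \<kappa> * exp (- L) * sqrt L"
proof -
  have "- (tail_point \<kappa> L)\<^sup>2 / 2 = ln \<kappa> + (- L + ln L / 2)" by (simp add: assms(3) field_simps)
  then have "exp (- (tail_point \<kappa> L)\<^sup>2 / 2) = exp (ln \<kappa>) * (exp (- L) * exp (ln L / 2))"
    by (simp only: exp_add)
  also have "exp (ln L / 2) = sqrt L" using assms
    by (simp add: powr_half_sqrt[symmetric] powr_def)
  finally show ?thesis using assms by simp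
qed

lemma sqrt_two_pi_gt_2: "sqrt (2 * pi) > 2"
  using pi_gt3 by (intro real_less_rsqrt) auto

lemma tail_point_upper:
  assumes "\<kappa> > 0"
  shows "\<forall>\<^sub>F L in at_top. measure std_normal {y. tail_point \<kappa> L \<le> \<bar>y\<bar>} \<le> \<kappa> * exp (- L)"
  using tail_point_range[OF assms] eventually_gt_at_top[of "0::real"]
proof eventually_elim
  case (elim L)
  let ?x = "tail_point \<kappa> L"
  have x: "?x > 0" using elim real_sqrt_gt_zero[of L] by linarith
  have "measure std_normal {y. ?x \<le> \<bar>y\<bar>} \<le> 2 * std_normal_density ?x / ?x"
    by (rule std_normal_tail_upper[OF x])
  also have "\<dots> = (2 / sqrt (2 * pi)) * (\<kappa> * exp (- L)) * (sqrt L / ?x)"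
    using std_normal_density_tail_point[of \<kappa> L] elim assms by (simp add: std_normal_density_def)
  also have "\<dots> \<le> 1 * (\<kappa> * exp (- L)) * 1"
    using elim assms x sqrt_two_pi_gt_2 by (intro mult_mono) (auto simp: divide_le_eq)
  finally show ?case by simp
qed

text \<open>Origin of the constant: exp (- 3 / 2) is the loss between x and x + 1 / x for x \<ge> 1,
  and 2 sqrt pi is sqrt (2 pi) times the sqrt 2 from x \<le> sqrt (2 L).\<close>

lemma tail_point_lower:
  assumes "\<kappa> > 0"
  shows "\<forall>\<^sub>F L in at_top. exp (- 3 / 2) / (2 * sqrt pi) * \<kappa> * exp (- L) \<le> measure std_normal {y. tail_point \<kappa> L < \<bar>y\<bar>}"
  using tail_point_range[OF assms] eventually_ge_at_top[of "1::real"]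
proof eventually_elim
  case (elim L)
  let ?x = "tail_point \<kappa> L"
  have x: "?x \<ge> 1" using elim real_sqrt_ge_one[of L] by linarith
  have "1 / ?x \<le> 1" using x by simp
  then have "(1 / ?x)\<^sup>2 \<le> 1" using x by (intro power_le_one) auto
  then have sq: "(?x + 1 / ?x)\<^sup>2 / 2 \<le> ?x\<^sup>2 / 2 + 3 / 2"
    using x by (simp add: power2_sum)
  have e: "exp (- ?x\<^sup>2 / 2) = \<kappa> * exp (- L) * sqrt L"
    using std_normal_density_tail_point[of \<kappa> L] elim assms by auto
  have "exp (- 3 / 2) / (2 * sqrt pi) * \<kappa> * exp (- L)
      = (exp (- ?x\<^sup>2 / 2) * exp (- 3 / 2)) / sqrt (2 * pi) / sqrt (2 * L)"
    unfolding e using elim by (simp add: real_sqrt_mult field_simps)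
  also have "\<dots> \<le> (exp (- ?x\<^sup>2 / 2) * exp (- 3 / 2)) / sqrt (2 * pi) / ?x"
    using elim x by (intro divide_left_mono) auto
  also have "exp (- ?x\<^sup>2 / 2) * exp (- 3 / 2) = exp (- (?x\<^sup>2 / 2 + 3 / 2))"
    by (simp flip: exp_add)
  also have "exp (- (?x\<^sup>2 / 2 + 3 / 2)) / sqrt (2 * pi) / ?x \<le> exp (- ((?x + 1 / ?x)\<^sup>2 / 2)) / sqrt (2 * pi) / ?x"
    using sq x by (intro divide_right_mono) auto
  also have "\<dots> = std_normal_density (?x + 1 / ?x) / ?x"
    by (simp add: std_normal_density_def)
  also have "\<dots> \<le> measure std_normal {y. ?x < \<bar>y\<bar>}"
    using x by (intro std_normal_tail_lower) auto
  finally show ?case .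
qed

section \<open>Moments of the score\<close>

text \<open>The order at which the total score changes sign. With n = s exp L and
  \<open>w = weight a L\<close>, the s signals add at most s / w = n / (a sqrt L), while the nulls
  add a drift of order - n / sqrt L.\<close>

definition weight :: "real \<Rightarrow> real \<Rightarrow> real" where
  "weight a L = a * exp (- L) * sqrt L"

lemma weight_range:
  assumes "a > 0"
  shows "\<forall>\<^sub>F L in at_top. 0 < weight a L \<and> weight a L \<le> 1 / 2"
proof -
  have "((\<lambda>L. a * (exp (- L) * sqrt L)) \<longlongrightarrow> 0) at_top"
    by (rule tendsto_mult_right_zero) real_asymp
  then have "\<forall>\<^sub>F L in at_top. a * (exp (- L) * sqrt L) < 1 / 2"
    by (rule order_tendstoD) simp
  then show ?thesis using eventually_gt_at_top[of "0::real"]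
    by eventually_elim (use assms in \<open>simp add: weight_def mult.assoc\<close>)
qed

lemma score_le_beta:
  assumes "0 \<le> w" "w \<le> 1"
  shows "score w x \<le> rho x - 1"
proof -
  define b where "b = rho x - 1"
  have d: "1 + w * b > 0" using mixture_ratio_ge_half[OF assms, of x] unfolding b_def by linarith
  have "b \<le> b * (1 + w * b)"
    using mult_nonneg_nonneg[OF assms(1) zero_le_power2[of b]] by (simp add: algebra_simps power2_eq_square)
  then show ?thesis using d by (simp add: score_def divide_le_eq b_def[symmetric])
qed

text \<open>With b = \<open>rho x - 1\<close>, the exact remainder of the linear approximation b is
  w b^2 / (1 + w b), whose denominator is at least 1 / 2. The linear term is the one whose truncated
  normal integral is explicit.\<close>

lemma score_ge_beta:
  assumes "0 \<le> w" "w \<le> 1"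
  shows "score w x \<ge> (rho x - 1) - 2 * w * (rho x)\<^sup>2"
proof -
  define b where "b = rho x - 1"
  have d: "1 + w * b \<ge> 1 / 2" unfolding b_def by (rule mixture_ratio_ge_half[OF assms])
  then have "score w x = b - w * b\<^sup>2 / (1 + w * b)"
    by (simp add: score_def b_def[symmetric] field_simps power2_eq_square)
  moreover have "w * b\<^sup>2 / (1 + w * b) \<le> w * b\<^sup>2 / (1 / 2)"
    using d assms by (intro divide_left_mono) auto
  then have "w * b\<^sup>2 / (1 + w * b) \<le> 2 * (w * b\<^sup>2)" by simp
  moreover have "b\<^sup>2 \<le> (rho x)\<^sup>2" using rho_ge_half[of x]
    by (simp add: b_def power2_eq_square algebra_simps)
  then have "w * b\<^sup>2 \<le> w * (rho x)\<^sup>2" using assms by (intro mult_left_mono)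
  ultimately have "score w x \<ge> b - 2 * (w * (rho x)\<^sup>2)" by linarith
  then show ?thesis by (simp add: b_def mult.assoc)
qed

lemma score_square_le:
  assumes "0 \<le> w" "w \<le> 1"
  shows "(score w x)\<^sup>2 \<le> 4 * (rho x)\<^sup>2"
proof -
  define b where "b = rho x - 1"
  have d: "1 + w * b \<ge> 1 / 2" unfolding b_def by (rule mixture_ratio_ge_half[OF assms])
  have "\<bar>b\<bar> \<le> rho x" using rho_ge_half[of x] by (simp add: b_def abs_le_iff)
  then have "\<bar>b\<bar> / (1 + w * b) \<le> rho x / (1 / 2)"
    using d rho_ge_half[of x] by (intro frac_le) auto
  then have "\<bar>score w x\<bar> \<le> 2 * rho x" using d by (simp add: score_def b_def abs_divide)
  then have "\<bar>score w x\<bar>\<^sup>2 \<le> (2 * rho x)\<^sup>2" by (intro power_mono) auto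
  then show ?thesis by (simp add: power_mult_distrib)
qed

lemma rho_ge_1: "x\<^sup>2 \<ge> 4 \<Longrightarrow> rho x \<ge> 1"
proof -
  assume x: "x\<^sup>2 \<ge> 4"
  then have "x \<noteq> 0" by auto
  have "1 + x\<^sup>2 / 2 + (x\<^sup>2 / 2)\<^sup>2 / 2 \<le> exp (x\<^sup>2 / 2)"
    by (rule exp_lower_Taylor_quadratic) simp
  moreover have "4 * x\<^sup>2 \<le> x\<^sup>2 * x\<^sup>2" using x by (intro mult_right_mono) auto
  ultimately have "x\<^sup>2 \<le> exp (x\<^sup>2 / 2) - 1" by (simp add: power2_eq_square)
  then show "rho x \<ge> 1" using \<open>x \<noteq> 0\<close> by (simp add: rho_eq)
qed

lemma inverse_sqrt_pi: "1 / 2 < 1 / sqrt pi" "1 / sqrt pi < 1"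
proof -
  have "sqrt pi < 2" using pi_less_4 by (intro real_less_lsqrt) auto
  moreover have "1 < sqrt pi" using pi_gt3 by simp
  ultimately show "1 / 2 < 1 / sqrt pi" "1 / sqrt pi < 1"  by (auto simp: field_simps)
qed

lemma tail_density_sqrt:
  assumes "L > 0"
  shows "2 * std_normal_density (sqrt (2 * L)) / sqrt (2 * L) = 1 / sqrt pi * exp (- L) / sqrt L"
proof -
  have "std_normal_density (sqrt (2 * L)) = exp (- L) / sqrt (2 * pi)"
    using assms by (simp add: std_normal_density_def)
  then have "2 * std_normal_density (sqrt (2 * L)) / sqrt (2 * L) = 2 * (exp (- L) / sqrt (2 * pi)) / sqrt (2 * L)"
    by simp
  also have "\<dots> = 1 / sqrt pi * exp (- L) / sqrt L" using assms by (simp add: real_sqrt_mult field_simps)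
  finally show ?thesis .
qed

lemma integrable_slab_minus_normal:
  assumes "L > 0"
  shows "integrable lborel (\<lambda>x. (slab_density x - std_normal_density x) * indicator {- sqrt (2 * L)..sqrt (2 * L)} x)"
    and "(\<integral>x. (slab_density x - std_normal_density x) * indicator {- sqrt (2 * L)..sqrt (2 * L)} x \<partial>lborel)
      = - (1 / sqrt pi) * (1 - exp (- L)) / sqrt L"
proof -
  have "- 2 * (1 - exp (- (sqrt (2 * L))\<^sup>2 / 2)) / (sqrt (2 * L) * sqrt (2 * pi)) = - (1 / sqrt pi) * (1 - exp (- L)) / sqrt L"
    using assms by (simp add: real_sqrt_mult field_simps)
  then show "integrable lborel (\<lambda>x. (slab_density x - std_normal_density x) * indicator {- sqrt (2 * L)..sqrt (2 * L)} x)"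
    and "(\<integral>x. (slab_density x - std_normal_density x) * indicator {- sqrt (2 * L)..sqrt (2 * L)} x \<partial>lborel)
      = - (1 / sqrt pi) * (1 - exp (- L)) / sqrt L"
    using slab_minus_normal_integral[of "sqrt (2 * L)"] assms
    by (auto simp: has_bochner_integral_iff)
qed

lemma abs_le_sqrt_iff: "L > 0 \<Longrightarrow> x \<in> {- sqrt (2 * L)..sqrt (2 * L)} \<longleftrightarrow> x\<^sup>2 \<le> 2 * L"
  by (metis abs_le_iff atLeastAtMost_iff minus_le_iff real_sqrt_abs real_sqrt_le_iff)

text \<open>On \<bar>x\<bar> \<le> sqrt (2 L) the score is at most \<open>rho x - 1\<close>, whose
  truncated normal integral is about -1 / sqrt (pi L), because the heavy tail of the slab lies
  outside. The remaining tail costs at most 1 / w times a Gaussian tail, which is O(1 / L).\<close>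

lemma score_mean_upper:
  assumes "a > 0"
  shows "\<forall>\<^sub>F L in at_top. (\<integral>x. score (weight a L) x \<partial>std_normal) \<le> - 1 / (2 * sqrt L)"
proof -
  have "((\<lambda>L. exp (- L) + 1 / a * (1 / sqrt L)) \<longlongrightarrow> 0 + 1 / a * 0) at_top"
    by (intro tendsto_add tendsto_mult tendsto_const; real_asymp)
  \<comment> \<open>The room between 1 / sqrt pi and 1 / 2 absorbs both error terms.\<close>
  moreover have "1 - sqrt pi / 2 > 0" using inverse_sqrt_pi by (simp add: field_simps)
  ultimately have "\<forall>\<^sub>F L in at_top. exp (- L) + 1 / a * (1 / sqrt L) < 1 - sqrt pi / 2"
    by (intro order_tendstoD) auto
  then show ?thesis using weight_range[OF assms] eventually_gt_at_top[of "0::real"]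
  proof eventually_elim
    case (elim L)
    let ?w = "weight a L" and ?z = "sqrt (2 * L)"
    have "(\<integral>x. score ?w x \<partial>std_normal)
      \<le> (\<integral>x. (slab_density x - std_normal_density x) * indicator {- ?z..?z} x \<partial>lborel)
        + 1 / ?w * (2 * std_normal_density ?z / ?z)"
    proof (rule std_normal_integral_le[OF score_measurable score_abs_le])
      fix x
      show "std_normal_density x * score ?w x
        \<le> (slab_density x - std_normal_density x) * indicator {- ?z..?z} x
          + 1 / ?w * (std_normal_density x * indicator {y. ?z \<le> \<bar>y\<bar>} x)"
      proof (cases "x \<in> {- ?z..?z}")
        case True
        have "std_normal_density x * score ?w x \<le> std_normal_density x * (rho x - 1)"
          using elim by (intro mult_left_mono score_le_beta) auto
        also have "\<dots> = slab_density x - std_normal_density x" by (simp add: slab_density_eq algebra_simps)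
        finally show ?thesis using True elim by (auto intro: add_increasing2)
      next
        case False
        then have "?z \<le> \<bar>x\<bar>" by auto
        moreover have "std_normal_density x * score ?w x \<le> std_normal_density x * (1 / ?w)"
          using elim by (intro mult_left_mono score_upper) auto
        ultimately show ?thesis using False by (simp add: mult.commute)
      qed
    qed (use elim integrable_slab_minus_normal in auto)
    also have "\<dots> = - (1 / sqrt pi) * (1 - exp (- L)) / sqrt L + 1 / ?w * (1 / sqrt pi * exp (- L) / sqrt L)"
      using elim by (simp only: integrable_slab_minus_normal tail_density_sqrt)
    also have "\<dots> = (1 / sqrt pi) / sqrt L * (exp (- L) + 1 / a * (1 / sqrt L) - 1)"
      using elim assms by (simp add: weight_def field_simps)
    also have "\<dots> \<le> (1 / sqrt pi) / sqrt L * (- sqrt pi / 2)"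
      using elim by (intro mult_left_mono) auto
    also have "\<dots> = - 1 / (2 * sqrt L)" by simp
    finally show ?case .
  qed
qed

lemma score_mean_lower:
  assumes "a > 0"
  shows "\<forall>\<^sub>F L in at_top. (\<integral>x. score (weight a L) x \<partial>std_normal) \<ge> - 1 / sqrt L"
proof -
  have "((\<lambda>L. (4 * sqrt 2 * a) * (1 / sqrt L)) \<longlongrightarrow> (4 * sqrt 2 * a) * 0) at_top"
    by (intro tendsto_mult tendsto_const; real_asymp)
  moreover have "1 - 1 / sqrt pi > 0" using inverse_sqrt_pi by simp
  ultimately have "\<forall>\<^sub>F L in at_top. (4 * sqrt 2 * a) * (1 / sqrt L) < 1 - 1 / sqrt pi"
    by (intro order_tendstoD) auto
  then show ?thesis using weight_range[OF assms] eventually_gt_at_top[of "2::real"] rho_square_le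
  proof eventually_elim
    case (elim L)
    let ?w = "weight a L" and ?z = "sqrt (2 * L)"
    let ?G = "\<lambda>x. (slab_density x - std_normal_density x) * indicator {- ?z..?z} x
        - 2 * ?w * (exp L / L\<^sup>2) * indicator {- ?z..?z} x"
    have "- 1 / sqrt L \<le> (- 1 / sqrt L) * (1 / sqrt pi + (4 * sqrt 2 * a) * (1 / sqrt L))"
      using elim mult_left_mono_neg[of "1 / sqrt pi + (4 * sqrt 2 * a) * (1 / sqrt L)" 1 "- 1 / sqrt L"] by simp
    also have "\<dots> \<le> (1 / sqrt pi) / sqrt L * exp (- L) + (- 1 / sqrt L) * (1 / sqrt pi + (4 * sqrt 2 * a) * (1 / sqrt L))"
      using elim by simp
    also have "\<dots> = - (1 / sqrt pi) * (1 - exp (- L)) / sqrt L - 2 * ?w * (exp L / L\<^sup>2) * (2 * ?z)"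
    proof -
      have we: "?w * exp L = a * sqrt L" by (simp add: weight_def exp_minus)
      have "2 * ?w * (exp L / L\<^sup>2) * (2 * ?z) = 4 * (?w * exp L) * (sqrt 2 * sqrt L) / L\<^sup>2"
        by (simp add: real_sqrt_mult)
      also have "\<dots> = (4 * sqrt 2 * a) * (1 / sqrt L) * (1 / sqrt L)"
        using elim unfolding we by (simp add: power2_eq_square field_simps)
      finally have X: "2 * ?w * (exp L / L\<^sup>2) * (2 * ?z) = (4 * sqrt 2 * a) * (1 / sqrt L) * (1 / sqrt L)" .
      show ?thesis unfolding X using elim by (simp add: field_simps)
    qed
    also have "\<dots> = (\<integral>x. ?G x \<partial>lborel)"
      using elim integrable_slab_minus_normal[of L]
      by (subst Bochner_Integration.integral_diff) (auto simp: algebra_simps)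
    also have "\<dots> \<le> (\<integral>x. score ?w x \<partial>std_normal)"
    proof (rule std_normal_integral_ge[OF score_measurable score_abs_le])
      show "integrable lborel ?G"
        using elim integrable_slab_minus_normal[of L] by (intro Bochner_Integration.integrable_diff) auto
      fix x
      show "?G x \<le> std_normal_density x * score ?w x"
      proof (cases "x \<in> {- ?z..?z}")
        case True
        then have "(rho x)\<^sup>2 * std_normal_density x \<le> exp L / L\<^sup>2"
          using elim abs_le_sqrt_iff[of L x] by auto
        then have "2 * ?w * ((rho x)\<^sup>2 * std_normal_density x) \<le> 2 * ?w * (exp L / L\<^sup>2)"
          using elim by (intro mult_left_mono) auto
        moreover have "std_normal_density x * ((rho x - 1) - 2 * ?w * (rho x)\<^sup>2) \<le> std_normal_density x * score ?w x"
          using elim by (intro mult_left_mono score_ge_beta) auto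
        ultimately show ?thesis using True by (simp add: slab_density_eq algebra_simps)
      next
        case False
        then have "\<not> x\<^sup>2 \<le> 2 * L" using elim abs_le_sqrt_iff[of L x] by auto
        then have "rho x \<ge> 1" using elim by (intro rho_ge_1) auto
        then have "score ?w x \<ge> 0" using elim by (auto simp: score_def intro!: divide_nonneg_nonneg)
        then show ?thesis using False by simp
      qed
    qed (use elim in auto)
    finally show ?case .
  qed
qed

text \<open>Bulk and tail have the same order: 4 exp L / L^2 over the length 2 sqrt (2 L), and 1 /
  w^2 times a tail of order exp (- L) / sqrt L. The constants come from 8 sqrt 2 \<le> 16 and 1 /
  sqrt pi \<le> 1.\<close>

lemma score_second_moment:
  assumes "a > 0"
  shows "\<forall>\<^sub>F L in at_top. (\<integral>x. (score (weight a L) x)\<^sup>2 \<partial>std_normal) \<le> (16 + 1 / a\<^sup>2) * exp L / (L * sqrt L)"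
  using weight_range[OF assms] eventually_gt_at_top[of "2::real"] rho_square_le
proof eventually_elim
  case (elim L)
  let ?w = "weight a L" and ?z = "sqrt (2 * L)"
  have w1: "?w > 0" "?w \<le> 1" using elim by auto
  have "(\<integral>x. (score ?w x)\<^sup>2 \<partial>std_normal)
    \<le> (\<integral>x. 4 * (exp L / L\<^sup>2) * indicator {- ?z..?z} x \<partial>lborel)
      + (1 / ?w)\<^sup>2 * (2 * std_normal_density ?z / ?z)"
  proof (rule std_normal_integral_le[where K = "(1 / ?w)\<^sup>2"])
    show "(\<lambda>x. (score ?w x)\<^sup>2) \<in> borel_measurable borel" by measurable
    fix x
    have s2: "(score ?w x)\<^sup>2 \<le> (1 / ?w)\<^sup>2"
      using score_abs_le[OF w1, of x] by (metis abs_ge_zero power2_abs power_mono)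
    then show "\<bar>(score ?w x)\<^sup>2\<bar> \<le> (1 / ?w)\<^sup>2" by simp
    show "std_normal_density x * (score ?w x)\<^sup>2
      \<le> 4 * (exp L / L\<^sup>2) * indicator {- ?z..?z} x
        + (1 / ?w)\<^sup>2 * (std_normal_density x * indicator {y. ?z \<le> \<bar>y\<bar>} x)"
    proof (cases "x \<in> {- ?z..?z}")
      case True
      then have "(rho x)\<^sup>2 * std_normal_density x \<le> exp L / L\<^sup>2"
        using elim abs_le_sqrt_iff[of L x] by auto
      moreover have "std_normal_density x * (score ?w x)\<^sup>2 \<le> std_normal_density x * (4 * (rho x)\<^sup>2)"
        using w1 by (intro mult_left_mono score_square_le) auto
      moreover have "std_normal_density x * (4 * (rho x)\<^sup>2) = 4 * ((rho x)\<^sup>2 * std_normal_density x)"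
        by simp
      ultimately have "std_normal_density x * (score ?w x)\<^sup>2 \<le> 4 * (exp L / L\<^sup>2)"
        by linarith
      then show ?thesis using True by (auto intro: add_increasing2)
    next
      case False
      then have "?z \<le> \<bar>x\<bar>" by auto
      then show ?thesis using False mult_left_mono[OF s2, of "std_normal_density x"] by (simp add: mult.commute)
    qed
  qed (use elim in auto)
  also have "\<dots> = (8 * sqrt 2 + 1 / sqrt pi * (1 / a\<^sup>2)) * (exp L / (L * sqrt L))"
  proof -
    have "L > 0" using elim by simp
    define r where "r = sqrt L"
    have r: "r > 0" "L = r * r" using \<open>L > 0\<close> by (auto simp: r_def)
    show ?thesis
      unfolding tail_density_sqrt[OF \<open>L > 0\<close>] using assms r
      by (simp add: weight_def exp_minus real_sqrt_mult power2_eq_square field_simps)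
  qed
  also have "\<dots> \<le> (16 + 1 * (1 / a\<^sup>2)) * (exp L / (L * sqrt L))"
  proof -
    have "sqrt 2 \<le> 2" by (simp add: real_le_lsqrt)
    then show ?thesis using inverse_sqrt_pi elim
      by (intro mult_right_mono add_mono) (auto intro!: divide_right_mono)
  qed
  finally show ?case by simp
qed

section \<open>The excess of the posterior slab probability in the tail\<close>

lemma slab_density_le:
  assumes "x \<noteq> 0" shows "slab_density x \<le> 1 / x\<^sup>2"
proof -
  have "1 / sqrt (2 * pi) \<le> 1" using pi_gt3 by simp
  then have "1 / sqrt (2 * pi) * (1 / x\<^sup>2) * (1 - exp (- (x\<^sup>2) / 2)) \<le> 1 * (1 / x\<^sup>2) * 1"
    by (intro mult_mono) auto
  then show ?thesis using assms by (simp add: slab_density_def)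
qed

lemma sqrt_two_pi_lt_4: "sqrt (2 * pi) < 4"
  using pi_less_4 by (intro real_less_lsqrt) auto

lemma slab_density_ge:
  assumes "x\<^sup>2 \<ge> 2" shows "slab_density x \<ge> 1 / (8 * x\<^sup>2)"
proof -
  have "x \<noteq> 0" using assms by auto
  have "2 \<le> exp (x\<^sup>2 / 2)" using exp_ge_add_one_self[of "x\<^sup>2 / 2"] assms by linarith
  then have "exp (- (x\<^sup>2) / 2) \<le> 1 / 2"
    using le_imp_inverse_le[of 2 "exp (x\<^sup>2 / 2)"] by (simp add: exp_minus)
  moreover have "1 / sqrt (2 * pi) \<ge> 1 / 4"
    using sqrt_two_pi_lt_4 by (intro divide_left_mono) auto
  ultimately have "1 / 4 * (1 / x\<^sup>2) * (1 / 2) \<le> 1 / sqrt (2 * pi) * (1 / x\<^sup>2) * (1 - exp (- (x\<^sup>2) / 2))"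
    by (intro mult_mono) auto
  then show ?thesis using \<open>x \<noteq> 0\<close> by (simp add: slab_density_def)
qed

text \<open>On the window the integrand is at most 2 w g, hence at most 2 w / L, and each of the two
  sides has length at most 3 ln L / sqrt L; this gives 12 a. Beyond the window
  \<open>slab_prob\<close> is bounded by 1 and the Gaussian tail accounts for the added 1.\<close>

lemma slab_tail_mean_upper:
  assumes \<kappa>: "\<kappa> > 0" and a: "a > 0"
  shows "\<forall>\<^sub>F L in at_top.
    (\<integral>x. indicator {x. tail_point \<kappa> L < \<bar>x\<bar>} x * slab_prob (weight a L) x \<partial>std_normal)
      \<le> (12 * a + 1) * (exp (- L) * ln L / L)"
proof -
  have "\<forall>\<^sub>F L in at_top. 2 * ln \<kappa> \<le> ln L" by real_asymp
  moreover have "\<forall>\<^sub>F L::real in at_top. 1 \<le> ln L" by real_asymp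
  ultimately show ?thesis using tail_point_range[OF \<kappa>] weight_range[OF a] eventually_ge_at_top[of "1::real"]
  proof eventually_elim
    case (elim L)
    define w where "w = weight a L"
    have w: "0 < w" "w \<le> 1" using elim by (auto simp: w_def)
    define x where "x = tail_point \<kappa> L"
    \<comment> \<open>With parameter 1 / L the tail point satisfies z^2 = 2 L + ln L, which is where
      w * \<open>rho\<close> becomes of order 1, and the normal mass beyond it is O(exp (- L) / L),
      free of the factor ln L.\<close>
    define z where "z = tail_point (1 / L) L"
    have x2: "x\<^sup>2 = 2 * L - ln L - 2 * ln \<kappa>" and x: "sqrt L \<le> x" "x \<le> sqrt (2 * L)"
      using elim by (auto simp: x_def)
    have z2: "z\<^sup>2 = 2 * L + ln L" and zs: "sqrt (2 * L) \<le> z"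
      using elim by (auto simp: z_def tail_point_def ln_div)
    have L1: "1 \<le> sqrt L" "sqrt L \<le> sqrt (2 * L)" using elim by auto
    have z: "sqrt L \<le> z" "x \<le> z" "0 < z" using zs x L1 by linarith+
    have "(tail_point (1 / L) L)\<^sup>2 = 2 * L - ln L - 2 * ln (1 / L)"
      using elim z2 by (simp add: z_def ln_div)
    then have "exp (- z\<^sup>2 / 2) = 1 / L * exp (- L) * sqrt L"
      unfolding z_def using elim by (intro std_normal_density_tail_point) auto
    also have "\<dots> = exp (- L) * (sqrt L / L)" by simp
    finally have "exp (- z\<^sup>2 / 2) = exp (- L) * (sqrt L / L)" .
    then have ez: "exp (- z\<^sup>2 / 2) = exp (- L) / sqrt L"
    proof -
      have "sqrt L / L = sqrt L / (sqrt L * sqrt L)" using elim by simp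
      also have "\<dots> = 1 / sqrt L" using L1 by (simp del: real_sqrt_mult_self)
      finally show ?thesis using \<open>exp (- z\<^sup>2 / 2) = exp (- L) * (sqrt L / L)\<close> by simp
    qed
    have "(z - x) * sqrt L \<le> (z - x) * (z + x)"
      using z x L1 by (intro mult_left_mono) linarith+
    also have "\<dots> = z\<^sup>2 - x\<^sup>2" by (simp add: power2_eq_square algebra_simps)
    also have "\<dots> \<le> 3 * ln L" using z2 x2 elim by linarith
    finally have gap: "z - x \<le> 3 * ln L / sqrt L" using L1 by (simp add: le_divide_eq)
    let ?G = "\<lambda>y. 2 * w / L * (indicator {x..z} y + indicator {- z..- x} y)"
    have "(\<integral>y. indicator {y. x < \<bar>y\<bar>} y * slab_prob w y \<partial>std_normal)
      \<le> (\<integral>y. ?G y \<partial>lborel) + 1 * (2 * std_normal_density z / z)"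
    proof (rule std_normal_integral_le[where K = 1])
      fix y :: real
      show "\<bar>indicator {y. x < \<bar>y\<bar>} y * slab_prob w y\<bar> \<le> 1"
        using slab_prob_le_1[of w y] slab_prob_nonneg[of w y] w by (auto split: split_indicator)
      have G0: "?G y \<ge> 0" using w elim by (auto split: split_indicator)
      consider "\<not> x < \<bar>y\<bar>" | "x < \<bar>y\<bar>" "\<bar>y\<bar> < z" | "z \<le> \<bar>y\<bar>" by linarith
      then show "std_normal_density y * (indicator {y. x < \<bar>y\<bar>} y * slab_prob w y)
        \<le> ?G y + 1 * (std_normal_density y * indicator {y. z \<le> \<bar>y\<bar>} y)"
      proof cases
        case 1
        then show ?thesis using G0 by simp
      next
        case 2
        have "x > 0" using x L1 by linarith
        then have y: "y \<noteq> 0" "?G y = 2 * w / L" using 2 by (auto simp: indicator_def)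
        have "sqrt L \<le> \<bar>y\<bar>" using 2 x by linarith
        then have "(sqrt L)\<^sup>2 \<le> \<bar>y\<bar>\<^sup>2" using L1 by (intro power_mono) auto
        then have "L \<le> y\<^sup>2" using elim by simp
        have "std_normal_density y * slab_prob w y \<le> std_normal_density y * (2 * w * rho y)"
          using w by (intro mult_left_mono slab_prob_le) auto
        also have "\<dots> = 2 * w * slab_density y" by (simp add: slab_density_eq)
        also have "\<dots> \<le> 2 * w * (1 / y\<^sup>2)"
          using w slab_density_le[OF y(1)] by (intro mult_left_mono) auto
        also have "\<dots> \<le> 2 * w * (1 / L)"
          using w \<open>L \<le> y\<^sup>2\<close> elim y(1) by (intro mult_left_mono divide_left_mono mult_pos_pos) auto
        finally show ?thesis using 2 unfolding y(2) by simp
      next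
        case 3
        have "std_normal_density y * (indicator {y. x < \<bar>y\<bar>} y * slab_prob w y) \<le> std_normal_density y * 1"
          using slab_prob_le_1[of w y] slab_prob_nonneg[of w y] w
          by (intro mult_left_mono) (auto split: split_indicator)
        then show ?thesis using 3 G0 by simp
      qed
    qed (use z in auto)
    also have "(\<integral>y. ?G y \<partial>lborel) = 2 * w / L * (2 * (z - x))"
      using z by simp
    also have "2 * w / L * (2 * (z - x)) \<le> 2 * w / L * (2 * (3 * ln L / sqrt L))"
      using gap w elim by (intro mult_left_mono) auto
    also have "\<dots> = 12 * a * (exp (- L) * ln L / L)"
      using L1 by (simp add: w_def weight_def field_simps)
    also have "1 * (2 * std_normal_density z / z) \<le> 1 * (exp (- L) * ln L / L)"
    proof -
      have "2 * std_normal_density z / z = (2 / sqrt (2 * pi)) * (exp (- L) / sqrt L) * (1 / z)"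
        unfolding std_normal_density_def ez by simp
      also have "\<dots> \<le> 1 * (exp (- L) / sqrt L) * (1 / sqrt L)"
      proof (intro mult_mono)
        show "1 / z \<le> 1 / sqrt L" using z(1) L1 by (intro frac_le) linarith+
        show "0 \<le> 1 / z" using z(3) by simp
      qed (use sqrt_two_pi_gt_2 elim in auto)
      also have "\<dots> = exp (- L) * 1 / L" using elim by simp
      also have "\<dots> \<le> exp (- L) * ln L / L" using elim by (intro divide_right_mono mult_left_mono) auto
      finally show ?thesis by simp
    qed
    finally show ?case by (simp add: w_def x_def algebra_simps)
  qed
qed

text \<open>Only the positive side up to sqrt (2 L) is kept. There w * \<open>rho\<close> is at most
  1, so \<open>slab_prob\<close> is at least half of it, and the window still has length at least ln
  L / (8 sqrt L). The constant is 256 = 8 * 32, with 32 from that half, from g \<ge> 1 / (8 y^2) and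
  from y^2 \<le> 2 L.\<close>

lemma slab_tail_mean_lower:
  assumes \<kappa>: "\<kappa> > 0" and a: "a > 0"
  shows "\<forall>\<^sub>F L in at_top. a / 256 * (exp (- L) * ln L / L) \<le>
    (\<integral>x. indicator {x. tail_point \<kappa> L \<le> \<bar>x\<bar>} x * slab_prob (weight a L) x \<partial>std_normal)"
proof -
  have "\<forall>\<^sub>F L in at_top. - 2 * ln \<kappa> \<le> ln L / 2" by real_asymp
  moreover have "\<forall>\<^sub>F L::real in at_top. a \<le> 2 * sqrt L" by real_asymp
  ultimately show ?thesis using tail_point_range[OF \<kappa>] weight_range[OF a] eventually_ge_at_top[of "2::real"]
  proof eventually_elim
    case (elim L)
    define w where "w = weight a L"
    have w: "0 < w" "w \<le> 1" using elim by (auto simp: w_def)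
    define x where "x = tail_point \<kappa> L"
    define z where "z = sqrt (2 * L)"
    have x2: "x\<^sup>2 = 2 * L - ln L - 2 * ln \<kappa>" and x: "sqrt L \<le> x" "x \<le> z"
      using elim by (auto simp: x_def z_def)
    have z2: "z\<^sup>2 = 2 * L" using elim by (simp add: z_def)
    have z3: "z \<le> 2 * sqrt L" using elim real_sqrt_le_mono[of 2 4] by (auto simp: z_def real_sqrt_mult)
    have L1: "1 \<le> sqrt L" using elim by auto
    have "ln L / 2 \<le> z\<^sup>2 - x\<^sup>2" using elim z2 x2 by linarith
    also have "\<dots> = (z - x) * (z + x)" by (simp add: power2_eq_square algebra_simps)
    also have "\<dots> \<le> (z - x) * (4 * sqrt L)" using x z3 by (intro mult_left_mono) linarith+
    finally have gap: "ln L / (8 * sqrt L) \<le> z - x" using L1 by (simp add: divide_le_eq)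
    let ?G = "\<lambda>y. w / (32 * L) * indicator {x..z} y"
    have "a / 256 * (exp (- L) * ln L / L) = w / (32 * L) * (ln L / (8 * sqrt L))"
      using L1 by (simp add: w_def weight_def field_simps)
    also have "\<dots> \<le> w / (32 * L) * (z - x)" using gap w elim by (intro mult_left_mono) auto
    also have "\<dots> = (\<integral>y. ?G y \<partial>lborel)" using x by simp
    also have "\<dots> \<le> (\<integral>y. indicator {y. x \<le> \<bar>y\<bar>} y * slab_prob w y \<partial>std_normal)"
    proof (rule std_normal_integral_ge[where K = 1])
      fix y :: real
      show "\<bar>indicator {y. x \<le> \<bar>y\<bar>} y * slab_prob w y\<bar> \<le> 1"
        using slab_prob_le_1[of w y] slab_prob_nonneg[of w y] w by (auto split: split_indicator)
      show "?G y \<le> std_normal_density y * (indicator {y. x \<le> \<bar>y\<bar>} y * slab_prob w y)"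
      proof (cases "y \<in> {x..z}")
        case True
        then have "x \<le> y" "y \<le> z" by auto
        then have y: "x \<le> \<bar>y\<bar>" "\<bar>y\<bar> \<le> \<bar>z\<bar>" using x L1 by linarith+
        have "sqrt L \<le> \<bar>y\<bar>" using y x by linarith
        then have "(sqrt L)\<^sup>2 \<le> \<bar>y\<bar>\<^sup>2" using L1 by (intro power_mono) auto
        then have Ly: "L \<le> y\<^sup>2" using elim by simp
        have y2: "y\<^sup>2 \<le> 2 * L" using power_mono[OF y(2) abs_ge_zero, of 2] z2 by simp
        have "z \<noteq> 0" using x L1 by linarith
        have "rho y \<le> rho z" using y rho_le_iff by blast
        also have "\<dots> \<le> exp L / (2 * L)" using \<open>z \<noteq> 0\<close> elim by (simp add: rho_eq z2 divide_right_mono)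
        finally have "w * rho y \<le> w * (exp L / (2 * L))" using w by (intro mult_left_mono) auto
        also have "\<dots> = a / (2 * sqrt L)"
          using elim by (simp add: w_def weight_def exp_minus field_simps)
        also have "\<dots> \<le> 1" using elim L1 by (simp add: divide_le_eq)
        finally have "1 + w * (rho y - 1) \<le> 2" using w by (simp add: algebra_simps)
        then have "w * rho y / 2 \<le> slab_prob w y"
          using mixture_ratio_ge_half[of w y] w rho_ge_half[of y] unfolding slab_prob_def
          by (intro divide_left_mono mult_nonneg_nonneg mult_pos_pos) auto
        then have "std_normal_density y * (w * rho y / 2) \<le> std_normal_density y * slab_prob w y"
          by (intro mult_left_mono) auto
        moreover have "std_normal_density y * (w * rho y / 2) = w / 2 * slab_density y"
          by (simp add: slab_density_eq)
        moreover have "w / 2 * (1 / (8 * y\<^sup>2)) \<le> w / 2 * slab_density y"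
          using w Ly elim by (intro mult_left_mono slab_density_ge) auto
        moreover have "w / 2 * (1 / (8 * (2 * L))) \<le> w / 2 * (1 / (8 * y\<^sup>2))"
          using w Ly y2 elim by (intro mult_left_mono divide_left_mono mult_pos_pos) auto
        ultimately have "w / 2 * (1 / (8 * (2 * L))) \<le> std_normal_density y * slab_prob w y"
          by linarith
        then show ?thesis using True y by simp
      next
        case False
        then show ?thesis using slab_prob_nonneg[of w y] w by (auto split: split_indicator)
      qed
      show "integrable lborel ?G" using x by (intro integrable_mult_right integrable_real_indicator) auto
    qed auto
    finally show ?case by (simp add: w_def x_def)
  qed
qed

text \<open>As (sqrt (2 L) + 1)^2 / 2 = L + sqrt (2 L) + 1 / 2, one unit beyond sqrt (2 L) gains a
  factor exp (sqrt (2 L)), more than any power of L. Signals observed there have \<ell>-value at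
  most 1 / L.\<close>

lemma weight_rho_large:
  assumes "a > 0"
  shows "\<forall>\<^sub>F L in at_top. \<forall>x. sqrt (2 * L) + 1 \<le> \<bar>x\<bar> \<longrightarrow> L \<le> weight a L * rho x"
proof -
  have "\<forall>\<^sub>F L in at_top. L \<le> a * sqrt L * ((exp (sqrt (2 * L) + 1 / 2) - exp (- L)) / (sqrt (2 * L) + 1)\<^sup>2)"
    using assms by real_asymp
  then show ?thesis using weight_range[OF assms] eventually_gt_at_top[of "0::real"]
  proof eventually_elim
    case (elim L)
    have pos: "sqrt (2 * L) + 1 > 0" using elim real_sqrt_ge_zero[of "2 * L"] by linarith
    have "exp (- L) * (exp ((sqrt (2 * L) + 1)\<^sup>2 / 2) - 1) = exp (sqrt (2 * L) + 1 / 2) - exp (- L)"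
    proof -
      have "(sqrt (2 * L) + 1)\<^sup>2 / 2 = L + (sqrt (2 * L) + 1 / 2)"
        using elim by (simp add: power2_sum)
      then show ?thesis by (simp only: right_diff_distrib mult_1_right exp_add[symmetric]) simp
    qed
    then have *: "L \<le> weight a L * rho (sqrt (2 * L) + 1)"
      using elim pos by (simp add: rho_eq weight_def mult.assoc mult.left_commute)
    show ?case
    proof (intro allI impI)
      fix x assume "sqrt (2 * L) + 1 \<le> \<bar>x\<bar>"
      then have "rho (sqrt (2 * L) + 1) \<le> rho x" using pos by (subst rho_le_iff) auto
      then have "weight a L * rho (sqrt (2 * L) + 1) \<le> weight a L * rho x"
        using elim by (intro mult_left_mono) auto
      with * show "L \<le> weight a L * rho x" by linarith
    qed
  qed
qed

text \<open>The factor 3 gives (v / 2)^2 / 2 \<ge> (9 / 8) ln L, more than the required ln L. With v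
  \<ge> 2, noise below v / 2 leaves a signal at absolute value at least sqrt (2 L) + 1.\<close>

lemma signal_noise_tail:
  "\<forall>\<^sub>F L in at_top. \<forall>v. v \<ge> 3 * sqrt (ln L) \<longrightarrow> v \<ge> 2 \<and> measure std_normal {y. v / 2 \<le> \<bar>y\<bar>} \<le> 1 / L"
proof -
  have "\<forall>\<^sub>F L::real in at_top. 1 \<le> ln L" by real_asymp
  then show ?thesis using eventually_ge_at_top[of "1::real"]
  proof eventually_elim
    case (elim L)
    show ?case
    proof (intro allI impI)
      fix v assume v: "v \<ge> 3 * sqrt (ln L)"
      have "sqrt (ln L) \<ge> 1" using elim by simp
      then have v2: "v \<ge> 2" using v by linarith
      have "(3 * sqrt (ln L))\<^sup>2 \<le> v\<^sup>2" using v elim by (intro power_mono) auto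
      then have "9 * ln L \<le> v\<^sup>2" using elim by (simp add: power_mult_distrib)
      then have e: "- (v / 2)\<^sup>2 / 2 \<le> - ln L" using elim by (simp add: power_divide)
      have "measure std_normal {y. v / 2 \<le> \<bar>y\<bar>} \<le> 2 * std_normal_density (v / 2) / (v / 2)"
        using v2 by (intro std_normal_tail_upper) auto
      also have "\<dots> = (2 / sqrt (2 * pi)) * exp (- (v / 2)\<^sup>2 / 2) * (1 / (v / 2))"
        by (simp add: std_normal_density_def)
      also have "\<dots> \<le> 1 * exp (- ln L) * 1"
        using sqrt_two_pi_gt_2 v2 e by (intro mult_mono) auto
      also have "\<dots> = 1 / L" using elim by (simp add: exp_minus inverse_eq_divide)
      finally show "v \<ge> 2 \<and> measure std_normal {y. v / 2 \<le> \<bar>y\<bar>} \<le> 1 / L" using v2 by simp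
    qed
  qed
qed

section \<open>The estimated weight and the rejection set\<close>

definition loglik :: "nat \<Rightarrow> (nat \<Rightarrow> real) \<Rightarrow> real \<Rightarrow> real" where
  "loglik n x w = (\<Sum>i=1..n. ln (mixture_density w (x i)))"

definition total_score :: "nat \<Rightarrow> (nat \<Rightarrow> real) \<Rightarrow> real \<Rightarrow> real" where
  "total_score n x w = (\<Sum>i=1..n. score w (x i))"

text \<open>\<open>arg_max_on\<close> is a choice operator and says nothing until some maximiser is
  known to exist; continuity on a compact interval provides one.\<close>

lemma w_hat_maximizer:
  assumes "n \<ge> 1"
  shows "w_hat n x \<in> {1 / real n..1}"
    and "w \<in> {1 / real n..1} \<Longrightarrow> loglik n x w \<le> loglik n x (w_hat n x)"
proof -
  have "continuous_on {1 / real n..1} (loglik n x)"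
  proof -
    have "mixture_density w (x i) \<noteq> 0" if "w \<in> {1 / real n..1}" for w i
    proof -
      have "0 \<le> w" using that order_trans[of 0 "1 / real n" w] by simp
      then show ?thesis using mixture_density_pos[of w "x i"] that by auto
    qed
    then show ?thesis unfolding loglik_def[abs_def] mixture_density_def
      by (intro continuous_intros) auto
  qed
  then obtain m where m: "m \<in> {1 / real n..1}" "\<And>w. w \<in> {1 / real n..1} \<Longrightarrow> loglik n x w \<le> loglik n x m"
    using continuous_attains_sup[of "{1 / real n..1}" "loglik n x"] assms by auto
  have eq: "w_hat n x = arg_max (loglik n x) (\<lambda>w. w \<in> {1 / real n..1})"
    by (simp add: w_hat_def loglik_def[abs_def] arg_max_on_def)
  have "w_hat n x \<in> {1 / real n..1} \<and> (\<forall>w\<in>{1 / real n..1}. loglik n x w \<le> loglik n x (w_hat n x))"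
    unfolding eq by (rule arg_maxI[of _ m]) (use m in \<open>auto simp: not_less\<close>)
  then show "w_hat n x \<in> {1 / real n..1}"
    and "w \<in> {1 / real n..1} \<Longrightarrow> loglik n x w \<le> loglik n x (w_hat n x)" by auto
qed

text \<open>The tangent inequality of a concave function of the weight: the ratio of two mixture
  densities is the affine expression 1 + (w - a) * \<open>score a x\<close>, and ln y \<le> y - 1
  with equality only at y = 1. If \<open>rho x = 1\<close> the density does not depend on the
  weight, hence the exception in the strict form.\<close>

lemma ln_mixture_diff:
  assumes "0 \<le> w" "w \<le> 1" "0 \<le> a" "a \<le> 1"
  shows "ln (mixture_density w x) \<le> ln (mixture_density a x) + (w - a) * score a x"
    and "w \<noteq> a \<Longrightarrow> rho x \<noteq> 1 \<Longrightarrow> ln (mixture_density w x) \<noteq> ln (mixture_density a x) + (w - a) * score a x"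
proof -
  define y where "y = mixture_density w x / mixture_density a x"
  have pos: "mixture_density w x > 0" "mixture_density a x > 0"
    using assms by (auto intro: mixture_density_pos)
  have d: "1 + a * (rho x - 1) > 0" using mixture_ratio_ge_half[of a x] assms by linarith
  have y: "y > 0" "ln y = ln (mixture_density w x) - ln (mixture_density a x)"
    using pos by (auto simp: y_def ln_div)
  have "y = (1 + w * (rho x - 1)) / (1 + a * (rho x - 1))"
    using normal_density_pos[of 1 0 x] by (simp add: y_def mixture_density_eq)
  also have "\<dots> = 1 + (w - a) * score a x" using d by (simp add: score_def field_simps)
  finally have y1: "y = 1 + (w - a) * score a x" .
  show "ln (mixture_density w x) \<le> ln (mixture_density a x) + (w - a) * score a x"
    using ln_le_minus_one[OF y(1)] y y1 by linarith
  show "ln (mixture_density w x) \<noteq> ln (mixture_density a x) + (w - a) * score a x" if "w \<noteq> a" "rho x \<noteq> 1"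
  proof
    assume "ln (mixture_density w x) = ln (mixture_density a x) + (w - a) * score a x"
    then have "ln y = y - 1" using y y1 by linarith
    then have "y = 1" using ln_eq_minus_one y(1) by blast
    then show False using y1 that d by (auto simp: score_def)
  qed
qed

lemma loglik_diff:
  assumes "0 \<le> w" "w \<le> 1" "0 \<le> a" "a \<le> 1"
  shows "loglik n x w \<le> loglik n x a + (w - a) * total_score n x a"
  unfolding loglik_def total_score_def sum_distrib_left sum.distrib[symmetric]
  using ln_mixture_diff(1)[OF assms] by (intro sum_mono) auto

lemma loglik_diff_strict:
  assumes "0 \<le> w" "w \<le> 1" "0 \<le> a" "a \<le> 1" "w \<noteq> a" "j \<in> {1..n}" "rho (x j) \<noteq> 1"
  shows "loglik n x w < loglik n x a + (w - a) * total_score n x a"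
  unfolding loglik_def total_score_def sum_distrib_left sum.distrib[symmetric]
proof (intro sum_strict_mono_ex1)
  show "\<exists>i\<in>{1..n}. ln (mixture_density w (x i)) < ln (mixture_density a (x i)) + (w - a) * score a (x i)"
    using ln_mixture_diff[OF assms(1-4), of "x j"] assms by (intro bexI[of _ j]) auto
qed (use ln_mixture_diff(1)[OF assms(1-4)] in auto)

lemma w_hat_bounds:
  assumes "n \<ge> 1" shows "0 < w_hat n x" "w_hat n x \<le> 1"
proof -
  have "0 < 1 / real n" using assms by simp
  then show "0 < w_hat n x" "w_hat n x \<le> 1"
    using w_hat_maximizer(1)[OF assms, of x] by (auto simp del: zero_less_divide_1_iff)
qed

text \<open>A tangent of positive slope at \<open>a\<close> puts every smaller weight strictly below
  the likelihood at \<open>a\<close>.\<close>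

lemma w_hat_ge:
  assumes n: "n \<ge> 1" and a: "a \<in> {1 / real n..1}" and S: "total_score n x a > 0"
  shows "a \<le> w_hat n x"
proof (rule ccontr)
  assume "\<not> a \<le> w_hat n x"
  then have "(w_hat n x - a) * total_score n x a < 0" using S by (intro mult_neg_pos) auto
  moreover have "0 < 1 / real n" using n by simp
  then have "0 \<le> a" using a by (auto simp del: zero_less_divide_1_iff)
  then have "loglik n x (w_hat n x) \<le> loglik n x a + (w_hat n x - a) * total_score n x a"
    using w_hat_bounds[OF n, of x] a by (intro loglik_diff) auto
  ultimately show False using w_hat_maximizer(2)[OF n a, of x] by linarith
qed

lemma w_hat_le:
  assumes n: "n \<ge> 1" and a: "a \<in> {1 / real n..1}" and S: "total_score n x a < 0"
  shows "w_hat n x \<le> a"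
proof (rule ccontr)
  assume "\<not> w_hat n x \<le> a"
  then have "(w_hat n x - a) * total_score n x a < 0" using S by (intro mult_pos_neg) auto
  moreover have "0 < 1 / real n" using n by simp
  then have "0 \<le> a" using a by (auto simp del: zero_less_divide_1_iff)
  then have "loglik n x (w_hat n x) \<le> loglik n x a + (w_hat n x - a) * total_score n x a"
    using w_hat_bounds[OF n, of x] a by (intro loglik_diff) auto
  ultimately show False using w_hat_maximizer(2)[OF n a, of x] by linarith
qed

text \<open>Strict concavity extends \<open>w_hat_le\<close> to a vanishing score, the boundary case
  in the exact description of the sublevel sets of \<open>w_hat\<close>.\<close>

lemma w_hat_le_nondegenerate:
  assumes n: "n \<ge> 1" and a: "a \<in> {1 / real n..1}" and S: "total_score n x a \<le> 0"
    and j: "j \<in> {1..n}" "rho (x j) \<noteq> 1"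
  shows "w_hat n x \<le> a"
proof (rule ccontr)
  assume *: "\<not> w_hat n x \<le> a"
  then have "(w_hat n x - a) * total_score n x a \<le> 0" using S by (intro mult_nonneg_nonpos) auto
  moreover have "0 < 1 / real n" using n by simp
  then have "0 \<le> a" using a by (auto simp del: zero_less_divide_1_iff)
  then have "loglik n x (w_hat n x) < loglik n x a + (w_hat n x - a) * total_score n x a"
    using w_hat_bounds[OF n, of x] a * by (intro loglik_diff_strict[where j = j] j) auto
  ultimately show False using w_hat_maximizer(2)[OF n a, of x] by linarith
qed

text \<open>Expresses a sublevel set of \<open>w_hat\<close> by countably many conditions on the
  score, for measurability. Testing strictly above \<open>a\<close> matters: a positive score at
  \<open>a\<close> itself would only yield \<open>a \<le> w_hat n x\<close>, which is no
  contradiction.\<close>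

lemma w_hat_le_iff:
  assumes n: "n \<ge> 1" and a: "1 / real n \<le> a" "a < 1" and j: "j \<in> {1..n}" "rho (x j) \<noteq> 1"
  shows "w_hat n x \<le> a \<longleftrightarrow> (\<forall>q\<in>\<rat>. a < q \<and> q < 1 \<longrightarrow> total_score n x q \<le> 0)"
proof
  assume le: "w_hat n x \<le> a"
  show "\<forall>q\<in>\<rat>. a < q \<and> q < 1 \<longrightarrow> total_score n x q \<le> 0"
  proof (intro ballI impI, rule ccontr)
    fix q assume q: "q \<in> \<rat>" "a < q \<and> q < 1" "\<not> total_score n x q \<le> 0"
    then have "q \<le> w_hat n x" using n a by (intro w_hat_ge) auto
    with le q show False by linarith
  qed
next
  assume all: "\<forall>q\<in>\<rat>. a < q \<and> q < 1 \<longrightarrow> total_score n x q \<le> 0"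
  show "w_hat n x \<le> a"
  proof (rule ccontr)
    assume "\<not> w_hat n x \<le> a"
    then obtain q where q: "q \<in> \<rat>" "a < q" "q < w_hat n x" using Rats_dense_in_real[of a "w_hat n x"] by auto
    have "q < 1" using q w_hat_bounds[OF n, of x] by linarith
    then have "w_hat n x \<le> q" using q a all n by (intro w_hat_le_nondegenerate[where j = j] j) auto
    then show False using q by linarith
  qed
qed

section \<open>Order-theoretic form of the cumulative threshold\<close>

definition reject_set :: "real \<Rightarrow> 'a set \<Rightarrow> ('a \<Rightarrow> real) \<Rightarrow> 'a set" where
  "reject_set t I l = {i \<in> I. \<exists>k\<in>I. l i \<le> l k \<and>
     sum l {j \<in> I. l j \<le> l k} \<le> t * real (card {j \<in> I. l j \<le> l k})}"

definition lower_closed :: "'a set \<Rightarrow> ('a \<Rightarrow> real) \<Rightarrow> 'a set \<Rightarrow> bool" where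
  "lower_closed I l D \<longleftrightarrow> D \<subseteq> I \<and> (\<forall>i\<in>D. \<forall>j\<in>I. l j \<le> l i \<longrightarrow> j \<in> D)"

lemma obtain_maximum:
  assumes "finite D" "D \<noteq> {}"
  obtains k where "k \<in> D" "\<And>j. j \<in> D \<Longrightarrow> (l j :: real) \<le> l k"
proof -
  have "Max (l ` D) \<in> l ` D" using assms by (intro Max_in) auto
  then obtain k where "k \<in> D" "l k = Max (l ` D)" by auto
  then show ?thesis using assms by (intro that[of k]) auto
qed

lemma lower_closed_maximum:
  assumes "lower_closed I l D" "k \<in> D" "\<And>j. j \<in> D \<Longrightarrow> l j \<le> l k"
  shows "D = {j \<in> I. l j \<le> l k}"
  using assms by (auto simp: lower_closed_def)

text \<open>Replaces the supremum by finitely many cutoffs at the data values: a nonempty strict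
  sublevel set is the weak sublevel set of its largest member. This form suits both the comparison
  with deterministic sets and the proof of measurability.\<close>

lemma sup_threshold_iff_reject:
  fixes l :: "'a \<Rightarrow> real"
  assumes I: "finite I" and l: "\<And>i. i \<in> I \<Longrightarrow> 0 \<le> l i" "\<And>i. i \<in> I \<Longrightarrow> l i < 1" and t: "t \<ge> 0"
    and i: "i \<in> I"
  shows "l i < Sup {r \<in> {0..1}. (\<Sum>j\<in>I. l j * of_bool (l j < r)) / max 1 (\<Sum>j\<in>I. of_bool (l j < r)) \<le> t}
    \<longleftrightarrow> i \<in> reject_set t I l"
proof -
  define D where "D r = {j \<in> I. l j < r}" for r
  have fin: "finite (D r)" for r using I by (simp add: D_def)
  have num: "(\<Sum>j\<in>I. l j * of_bool (l j < r)) = sum l (D r)" for r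
  proof -
    have "(\<Sum>j\<in>I. l j * of_bool (l j < r)) = (\<Sum>j\<in>I. if l j < r then l j else 0)"
      by (intro sum.cong) auto
    then show ?thesis using I by (simp add: D_def sum.inter_filter)
  qed
  have den: "(\<Sum>j\<in>I. of_bool (l j < r)) = real (card (D r))" for r
  proof -
    have "(\<Sum>j\<in>I. of_bool (l j < r)) = (\<Sum>j\<in>I. if l j < r then 1 else 0 :: real)"
      by (intro sum.cong) auto
    then show ?thesis using I by (simp add: D_def sum.inter_filter[symmetric])
  qed
  have cond: "sum l (D r) / max 1 (real (card (D r))) \<le> t \<longleftrightarrow> sum l (D r) \<le> t * real (card (D r))" for r
  proof (cases "D r = {}")
    case False
    then have "card (D r) \<ge> 1" using fin[of r] by (simp add: Suc_le_eq card_gt_0_iff)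
    then show ?thesis by (simp add: max_def divide_le_eq)
  qed (use t in simp)
  define S where "S = {r \<in> {0..1}. sum l (D r) \<le> t * real (card (D r))}"
  have "D 0 = {}" using l by (force simp: D_def)
  then have "0 \<in> S" by (simp add: S_def)
  then have "S \<noteq> {}" by blast
  moreover have "bdd_above S" by (auto simp: S_def intro!: bdd_aboveI[of _ 1])
  \<comment> \<open>The strict inequality makes it irrelevant whether the supremum is
    attained.\<close>
  ultimately have "l i < Sup S \<longleftrightarrow> (\<exists>r\<in>S. l i < r)" by (rule less_cSup_iff)
  also have "\<dots> \<longleftrightarrow> i \<in> reject_set t I l"
  proof
    assume "\<exists>r\<in>S. l i < r"
    then obtain r where r: "r \<in> S" "l i < r" by auto
    then have "i \<in> D r" using i by (simp add: D_def)
    then obtain k where k: "k \<in> D r" "\<And>j. j \<in> D r \<Longrightarrow> l j \<le> l k"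
      using obtain_maximum[OF fin[of r], of l] by blast
    have "lower_closed I l (D r)" by (auto simp: lower_closed_def D_def)
    from lower_closed_maximum[OF this k] have D: "D r = {j \<in> I. l j \<le> l k}" .
    show "i \<in> reject_set t I l"
      unfolding reject_set_def mem_Collect_eq
    proof (intro conjI bexI[of _ k])
      show "sum l {j \<in> I. l j \<le> l k} \<le> t * real (card {j \<in> I. l j \<le> l k})"
        using r(1) D by (simp add: S_def)
      show "k \<in> I" using k(1) by (simp add: D_def)
    qed (use i k(2) \<open>i \<in> D r\<close> in auto)
  next
    assume "i \<in> reject_set t I l"
    then obtain k where k: "k \<in> I" "l i \<le> l k" "sum l {j \<in> I. l j \<le> l k} \<le> t * real (card {j \<in> I. l j \<le> l k})"
      by (auto simp: reject_set_def)
    \<comment> \<open>The next larger value, or 1 if there is none. All values lie below 1, so the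
      strict sublevel set at \<open>r\<close> is the weak one at \<open>l k\<close>.\<close>
    define r where "r = Min (insert 1 (l ` {j \<in> I. l k < l j}))"
    have finI: "finite (insert 1 (l ` {j \<in> I. l k < l j}))" using I by auto
    have r: "l k < r" using finI k l by (auto simp: r_def)
    have r1: "r \<le> 1" using finI by (auto simp: r_def)
    have above: "r \<le> l j" if "j \<in> I" "l k < l j" for j
      unfolding r_def using finI that by (intro Min_le) auto
    have "l j < r \<longleftrightarrow> l j \<le> l k" if "j \<in> I" for j
      using r above[OF that] by linarith
    then have "D r = {j \<in> I. l j \<le> l k}" by (auto simp: D_def)
    then have "r \<in> S" using r r1 l(1)[OF k(1)] k by (auto simp: S_def)
    then show "\<exists>r\<in>S. l i < r" using r k by (intro bexI[of _ r]) auto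
  qed
  finally have iff: "l i < Sup S \<longleftrightarrow> i \<in> reject_set t I l" .
  have "{r \<in> {0..1}. (\<Sum>j\<in>I. l j * of_bool (l j < r)) / max 1 (\<Sum>j\<in>I. of_bool (l j < r)) \<le> t} = S"
    by (simp only: S_def num den cond)
  then show ?thesis using iff by (simp only:)
qed

context
  fixes I :: "'a set" and l :: "'a \<Rightarrow> real" and t :: real
  assumes I: "finite I"
begin

lemma lower_closed_subset_reject:
  assumes "lower_closed I l D" "sum l D \<le> t * real (card D)"
  shows "D \<subseteq> reject_set t I l"
proof
  fix i assume "i \<in> D"
  have "finite D" using assms I by (auto simp: lower_closed_def intro: finite_subset)
  then obtain k where k: "k \<in> D" "\<And>j. j \<in> D \<Longrightarrow> l j \<le> l k"
    using obtain_maximum[of D l] \<open>i \<in> D\<close> by blast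
  have D: "D = {j \<in> I. l j \<le> l k}" by (rule lower_closed_maximum[OF assms(1) k])
  have sub: "D \<subseteq> I" using assms(1) by (simp add: lower_closed_def)
  have "sum l {j \<in> I. l j \<le> l k} \<le> t * real (card {j \<in> I. l j \<le> l k})"
    using assms(2) unfolding D[symmetric] .
  then show "i \<in> reject_set t I l"
    unfolding reject_set_def using \<open>i \<in> D\<close> k(2)[OF \<open>i \<in> D\<close>] k(1) sub by blast
qed

lemma reject_set_lower_closed: "lower_closed I l (reject_set t I l)"
  by (auto simp: lower_closed_def reject_set_def intro: order_trans)

text \<open>The certifying sublevel sets are nested, so the one that certifies the largest rejected
  value is the whole rejection set.\<close>

lemma reject_set_mean: "sum l (reject_set t I l) \<le> t * real (card (reject_set t I l))"
proof (cases "reject_set t I l = {}")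
  case False
  have "finite (reject_set t I l)" using I by (simp add: reject_set_def)
  then obtain m where m: "m \<in> reject_set t I l" "\<And>j. j \<in> reject_set t I l \<Longrightarrow> l j \<le> l m"
    using obtain_maximum[of _ l] False by blast
  then obtain k where k: "k \<in> I" "l m \<le> l k" "sum l {j \<in> I. l j \<le> l k} \<le> t * real (card {j \<in> I. l j \<le> l k})"
    by (auto simp: reject_set_def)
  have "reject_set t I l = {j \<in> I. l j \<le> l k}"
  proof
    show "{j \<in> I. l j \<le> l k} \<subseteq> reject_set t I l" using k by (auto simp: reject_set_def)
    show "reject_set t I l \<subseteq> {j \<in> I. l j \<le> l k}" using m k by (force simp: reject_set_def)
  qed
  then show ?thesis using k by simp
qed simp

text \<open>Lower closed sets are nested, so otherwise \<open>D\<close> would lie inside the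
  rejection set. Some value in \<open>D\<close> exceeds t, hence the values added to
  \<open>D\<close> are at least t and the mean would stay above t, against
  \<open>reject_set_mean\<close>.\<close>

lemma reject_subset_lower_closed:
  assumes D: "lower_closed I l D" and gt: "sum l D > t * real (card D)"
  shows "reject_set t I l \<subset> D"
proof -
  let ?R = "reject_set t I l"
  have R: "lower_closed I l ?R" by (rule reject_set_lower_closed)
  have fin: "finite D" "finite ?R" using D R I by (auto simp: lower_closed_def intro: finite_subset)
  have "\<not> D \<subseteq> ?R"
  proof
    assume sub: "D \<subseteq> ?R"
    have "\<exists>i\<in>D. l i > t"
    proof (rule ccontr)
      assume "\<not> (\<exists>i\<in>D. l i > t)"
      then have "sum l D \<le> real (card D) * t" by (intro sum_bounded_above) auto
      with gt show False by (simp add: mult.commute)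
    qed
    then obtain i where i: "i \<in> D" "l i > t" by auto
    have "l j \<ge> t" if "j \<in> ?R - D" for j
    proof -
      have "j \<in> I" using that R by (auto simp: lower_closed_def)
      then have "\<not> l j \<le> l i" using that i D by (auto simp: lower_closed_def)
      then show ?thesis using i by linarith
    qed
    then have "real (card (?R - D)) * t \<le> sum l (?R - D)" by (intro sum_bounded_below) auto
    moreover have "sum l ?R = sum l D + sum l (?R - D)"
      using sum.subset_diff[OF sub fin(2), of l] by simp
    moreover have "real (card ?R) = real (card D) + real (card (?R - D))"
      using card_Diff_subset[OF fin(1) sub] card_mono[OF fin(2) sub] by simp
    ultimately have "sum l ?R > t * real (card ?R)" using gt by (simp add: algebra_simps)
    then show False using reject_set_mean by simp
  qed
  then obtain i where i: "i \<in> D" "i \<notin> ?R" by auto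
  have "?R \<subseteq> D"
  proof
    fix j assume j: "j \<in> ?R"
    then have "j \<in> I" "i \<in> I" using i R D by (auto simp: lower_closed_def)
    then have "\<not> l i \<le> l j" using i j R by (auto simp: lower_closed_def)
    then show "j \<in> D" using i D \<open>j \<in> I\<close> by (auto simp: lower_closed_def)
  qed
  with i show ?thesis by auto
qed

text \<open>Adding the smallest unrejected value must violate the level, and it adds at most 1 to
  the sum. Injectivity keeps the enlarged set lower closed; with ties a whole block would have to be
  added at once.\<close>

lemma reject_set_mean_lower:
  assumes inj: "inj_on l I" and ne: "reject_set t I l \<noteq> I" and l1: "\<And>i. i \<in> I \<Longrightarrow> l i \<le> 1" and t: "t \<ge> 0"
  shows "t * real (card (reject_set t I l)) - 1 \<le> sum l (reject_set t I l)"
proof -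
  let ?R = "reject_set t I l"
  have R: "lower_closed I l ?R" by (rule reject_set_lower_closed)
  have finR: "finite ?R" using R I by (auto simp: lower_closed_def intro: finite_subset)
  have "I - ?R \<noteq> {}" using ne R by (auto simp: lower_closed_def)
  then obtain k where k: "k \<in> I - ?R" "\<And>j. j \<in> I - ?R \<Longrightarrow> - l j \<le> - l k"
    using obtain_maximum[of "I - ?R" "\<lambda>j. - l j"] I by blast
  have "lower_closed I l (insert k ?R)"
    unfolding lower_closed_def
  proof (intro conjI ballI impI)
    show "insert k ?R \<subseteq> I" using k R by (auto simp: lower_closed_def)
    fix i j assume ij: "i \<in> insert k ?R" "j \<in> I" "l j \<le> l i"
    show "j \<in> insert k ?R"
    proof (cases "i = k")
      case True
      then have "l j = l k" if "j \<notin> ?R" using k(2)[of j] that ij by auto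
      then show ?thesis using inj ij k True by (auto dest: inj_onD)
    qed (use ij R in \<open>auto simp: lower_closed_def\<close>)
  qed
  then have "\<not> sum l (insert k ?R) \<le> t * real (card (insert k ?R))"
    using lower_closed_subset_reject k by blast
  then have "l k + sum l ?R > t * (real (card ?R) + 1)"
    using k finR by (simp add: algebra_simps)
  moreover have "l k \<le> 1" using l1 k by auto
  ultimately show ?thesis using t by (simp add: algebra_simps)
qed

end

lemma cl_procedure_iff:
  assumes n: "n \<ge> 1" and t: "t \<ge> 0" and i: "i \<in> {1..n}"
  shows "cl_procedure t n x i \<longleftrightarrow> i \<in> reject_set t {1..n} (\<lambda>j. ell_value (w_hat n x) (x j))"
  unfolding cl_procedure_def lambda_hat_def
  using sup_threshold_iff_reject[of "{1..n}" "\<lambda>j. ell_value (w_hat n x) (x j)" t i]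
    ell_value_bounds[OF w_hat_bounds[OF n]] t i by simp

section \<open>Measurability and the analysis of one data vector\<close>

text \<open>For these data the likelihood is constant in the weight and the choice of
  \<open>w_hat\<close> is arbitrary. Since \<open>rho\<close> determines the absolute value, at most
  two values per coordinate remain.\<close>

lemma finite_degenerate:
  fixes n :: nat
  shows
  "finite {x \<in> space (\<Pi>\<^sub>M i\<in>{1..n}. borel :: real measure). \<forall>j\<in>{1..n}. rho (x j) = 1}"
proof -
  have "finite {y. rho y = 1}"
  proof (cases "\<exists>c. rho c = 1")
    case True
    then obtain c where "rho c = 1" by auto
    then have "{y. rho y = 1} \<subseteq> {c, - c}" using rho_eq_iff[of _ c] by (auto simp: abs_eq_iff)
    then show ?thesis by (rule finite_subset) auto
  qed auto
  then have "finite (PiE {1..n} (\<lambda>_. {y. rho y = 1}))" by (intro finite_PiE) auto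
  then show ?thesis by (rule finite_subset[rotated]) (auto simp: space_PiM PiE_def)
qed

lemma finite_subset_PiM_borel:
  fixes F :: "(nat \<Rightarrow> real) set"
  assumes "finite F" "F \<subseteq> space (\<Pi>\<^sub>M i\<in>{1..n}. borel)"
  shows "F \<in> sets (\<Pi>\<^sub>M i\<in>{1..n}. borel)"
proof -
  have "{x} \<in> sets (\<Pi>\<^sub>M i\<in>{1..n}. borel)" if "x \<in> F" for x
  proof -
    have "x \<in> extensional {1..n}" using that assms by (auto simp: space_PiM PiE_def)
    then have "{x} = PiE {1..n} (\<lambda>i. {x i})" by (simp add: PiE_singleton)
    then show ?thesis by (simp add: sets_PiM_I_finite)
  qed
  then have "(\<Union>x\<in>F. {x}) \<in> sets (\<Pi>\<^sub>M i\<in>{1..n}. borel)"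
    using assms by (intro sets.finite_UN) auto
  then show ?thesis by simp
qed

lemma mem_reject_set_iff:
  assumes "finite I" "i \<in> I"
  shows "i \<in> reject_set t I l \<longleftrightarrow> (\<exists>k\<in>I. l i \<le> l k \<and>
    (\<Sum>j\<in>I. if l j \<le> l k then l j else 0) \<le> t * (\<Sum>j\<in>I. if l j \<le> l k then 1 else 0))"
  using assms by (simp add: reject_set_def sum.inter_filter[symmetric])

text \<open>Off the finite degenerate set the estimated weight is measurable; inside it every subset
  is Borel, so any choice of maximiser is harmless.\<close>

lemma cl_procedure_measurable:
  assumes n: "n \<ge> 1" and t: "t \<ge> 0" and i: "i \<in> {1..n}"
  shows "{x \<in> space (\<Pi>\<^sub>M i\<in>{1..n}. borel). cl_procedure t n x i} \<in> sets (\<Pi>\<^sub>M i\<in>{1..n}. borel)"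
proof -
  let ?M = "\<Pi>\<^sub>M i\<in>{1..n}. borel :: real measure"
  define N where "N = {x \<in> space ?M. \<forall>j\<in>{1..n}. rho (x j) = 1}"
  have finN: "finite N" unfolding N_def by (rule finite_degenerate)
  have N [measurable]: "N \<in> sets ?M"
    using finN by (rule finite_subset_PiM_borel) (auto simp: N_def)
  have comp [measurable]: "(\<lambda>x. x j) \<in> borel_measurable ?M" if "j \<in> {1..n}" for j
    using that by measurable
  \<comment> \<open>The value 1 keeps \<open>N\<close> out of every sublevel set with a < 1, and
    those are the ones described through the score.\<close>
  define w where "w x = (if x \<in> N then 1 else w_hat n x)" for x
  have [measurable]: "w \<in> borel_measurable ?M"
  proof (rule borel_measurableI_le)
    fix a :: real
    have inv: "1 / real n \<le> 1" using n by simp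
    consider "a < 1 / real n" | "1 \<le> a" | "1 / real n \<le> a" "a < 1" by linarith
    then show "{x \<in> space ?M. w x \<le> a} \<in> sets ?M"
    proof cases
      case 1
      have "w x \<ge> 1 / real n" for x using w_hat_maximizer(1)[OF n, of x] inv by (auto simp: w_def)
      then have "{x \<in> space ?M. w x \<le> a} = {}" using 1 by (auto simp: not_le intro: less_le_trans)
      then show ?thesis by (simp only: sets.empty_sets)
    next
      case 2
      have "w x \<le> 1" for x using w_hat_bounds(2)[OF n, of x] by (simp add: w_def)
      then have "{x \<in> space ?M. w x \<le> a} = space ?M" using 2 by (auto intro: order_trans)
      then show ?thesis by simp
    next
      case 3
      have "{x \<in> space ?M. w x \<le> a} =
        {x \<in> space ?M. x \<notin> N \<and> (\<forall>q\<in>\<rat>. a < q \<and> q < 1 \<longrightarrow> total_score n x q \<le> 0)}"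
      proof (intro Collect_cong conj_cong refl)
        fix x assume x: "x \<in> space ?M"
        show "w x \<le> a \<longleftrightarrow> x \<notin> N \<and> (\<forall>q\<in>\<rat>. a < q \<and> q < 1 \<longrightarrow> total_score n x q \<le> 0)"
        proof (cases "x \<in> N")
          case False
          then obtain j where j: "j \<in> {1..n}" "rho (x j) \<noteq> 1" using x by (auto simp: N_def)
          from w_hat_le_iff[where x = x, OF n 3 j] show ?thesis using False by (simp add: w_def)
        qed (use 3 in \<open>simp add: w_def\<close>)
      qed
      moreover have "(\<lambda>x. total_score n x q) \<in> borel_measurable ?M" for q
        unfolding total_score_def by measurable
      note [measurable] = this
      have "{x \<in> space ?M. x \<notin> N \<and> (\<forall>q\<in>\<rat>. a < q \<and> q < 1 \<longrightarrow> total_score n x q \<le> 0)} \<in> sets ?M"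
        using countable_rat by measurable
      ultimately show ?thesis by simp
    qed
  qed
  define f where "f j x = ell_value (w x) (x j)" for j x
  have f: "f j \<in> borel_measurable ?M" if "j \<in> {1..n}" for j
    using that unfolding f_def[abs_def] ell_value_def mixture_density_def by measurable
  define P where "P x \<longleftrightarrow> i \<in> reject_set t {1..n} (\<lambda>j. ell_value (w x) (x j))" for x
  have P: "{x \<in> space ?M. P x} \<in> sets ?M"
  proof -
    have Pk: "{x \<in> space ?M. f i x \<le> f k x \<and>
        (\<Sum>j\<in>{1..n}. if f j x \<le> f k x then f j x else 0)
          \<le> t * (\<Sum>j\<in>{1..n}. if f j x \<le> f k x then 1 else 0)} \<in> sets ?M" if k: "k \<in> {1..n}" for k
    proof -
      note f[OF i, measurable] f[OF k, measurable]
      have g: "(\<lambda>x. if f j x \<le> f k x then f j x else 0) \<in> borel_measurable ?M"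
        "(\<lambda>x. if f j x \<le> f k x then 1 else 0 :: real) \<in> borel_measurable ?M" if "j \<in> {1..n}" for j
      proof -
        note f[OF that, measurable]
        show "(\<lambda>x. if f j x \<le> f k x then f j x else 0) \<in> borel_measurable ?M"
          "(\<lambda>x. if f j x \<le> f k x then 1 else 0 :: real) \<in> borel_measurable ?M" by measurable
      qed
      have s1: "(\<lambda>x. \<Sum>j\<in>{1..n}. if f j x \<le> f k x then f j x else 0) \<in> borel_measurable ?M"
        by (rule borel_measurable_sum) (rule g(1))
      have s2: "(\<lambda>x. \<Sum>j\<in>{1..n}. if f j x \<le> f k x then 1 else 0 :: real) \<in> borel_measurable ?M"
        by (rule borel_measurable_sum) (rule g(2))
      show ?thesis
        by (intro sets.sets_Collect_conj borel_measurable_le borel_measurable_times borel_measurable_const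
            f[OF i] f[OF k] s1 s2)
    qed
    have "{x \<in> space ?M. P x} = (\<Union>k\<in>{1..n}. {x \<in> space ?M. f i x \<le> f k x \<and>
        (\<Sum>j\<in>{1..n}. if f j x \<le> f k x then f j x else 0)
          \<le> t * (\<Sum>j\<in>{1..n}. if f j x \<le> f k x then 1 else 0)})"
      unfolding P_def mem_reject_set_iff[OF finite_atLeastAtMost i] f_def by blast
    then show ?thesis using Pk by auto
  qed
  have eq: "{x \<in> space ?M. cl_procedure t n x i} = ({x \<in> space ?M. P x} - N) \<union> ({x \<in> space ?M. cl_procedure t n x i} \<inter> N)"
    using cl_procedure_iff[OF n t i] by (auto simp: P_def w_def)
  have "{x \<in> space ?M. cl_procedure t n x i} \<inter> N \<in> sets ?M"
    using finN by (intro finite_subset_PiM_borel) auto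
  then show ?thesis by (subst eq) (intro sets.Un sets.Diff P N)
qed

section \<open>Error rates as integrals over the noise\<close>

definition observation :: "nat \<Rightarrow> (nat \<Rightarrow> real) \<Rightarrow> (nat \<Rightarrow> real) \<Rightarrow> nat \<Rightarrow> real" where
  "observation n \<theta> \<epsilon> = (\<lambda>i\<in>{1..n}. \<theta> i + \<epsilon> i)"

lemma observation_measurable [measurable]:
  "observation n \<theta> \<in> measurable (noise_law n) (\<Pi>\<^sub>M i\<in>{1..n}. borel)"
  unfolding observation_def by (intro measurable_restrict borel_measurable_add noise_component_measurable) auto

lemma FDP_measurable:
  assumes n: "n \<ge> 1" and t: "t \<ge> 0"
  shows "(\<lambda>x. FDP n (cl_procedure t n x) \<theta>) \<in> borel_measurable (\<Pi>\<^sub>M i\<in>{1..n}. borel)"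
proof -
  have [measurable]: "Measurable.pred (\<Pi>\<^sub>M i\<in>{1..n}. borel) (\<lambda>x. cl_procedure t n x i)" if "i \<in> {1..n}" for i
    using cl_procedure_measurable[OF n t that] by (simp add: pred_def)
  show ?thesis unfolding FDP_def of_bool_def by measurable
qed

lemma FNP_measurable:
  assumes n: "n \<ge> 1" and t: "t \<ge> 0"
  shows "(\<lambda>x. FNP n (cl_procedure t n x) \<theta>) \<in> borel_measurable (\<Pi>\<^sub>M i\<in>{1..n}. borel)"
proof -
  have [measurable]: "Measurable.pred (\<Pi>\<^sub>M i\<in>{1..n}. borel) (\<lambda>x. cl_procedure t n x i)" if "i \<in> {1..n}" for i
    using cl_procedure_measurable[OF n t that] by (simp add: pred_def)
  show ?thesis unfolding FNP_def of_bool_def by measurable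
qed

lemma obs_law_eq: "obs_law n \<theta> = distr (noise_law n) (\<Pi>\<^sub>M i\<in>{1..n}. borel) (observation n \<theta>)"
  by (simp add: obs_law_def observation_def[abs_def])

lemma FDR_eq:
  assumes "n \<ge> 1" "t \<ge> 0"
  shows "FDR n (cl_procedure t n) \<theta> = (\<integral>\<epsilon>. FDP n (cl_procedure t n (observation n \<theta> \<epsilon>)) \<theta> \<partial>noise_law n)"
  unfolding FDR_def obs_law_eq
  by (rule integral_distr[OF observation_measurable FDP_measurable[OF assms]])

lemma FNR_eq:
  assumes "n \<ge> 1" "t \<ge> 0"
  shows "FNR n (cl_procedure t n) \<theta> = (\<integral>\<epsilon>. FNP n (cl_procedure t n (observation n \<theta> \<epsilon>)) \<theta> \<partial>noise_law n)"
  unfolding FNR_def obs_law_eq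
  by (rule integral_distr[OF observation_measurable FNP_measurable[OF assms]])

lemma FDP_bounds: "0 \<le> FDP n \<phi> \<theta>" "FDP n \<phi> \<theta> \<le> 1"
proof -
  have "(\<Sum>i=1..n. of_bool (\<theta> i = 0 \<and> \<phi> i)) \<le> (\<Sum>i=1..n. of_bool (\<phi> i) :: real)"
    by (intro sum_mono) auto
  then have "(\<Sum>i=1..n. of_bool (\<theta> i = 0 \<and> \<phi> i)) \<le> max 1 (\<Sum>i=1..n. of_bool (\<phi> i) :: real)"
    by linarith
  then show "FDP n \<phi> \<theta> \<le> 1" by (simp add: FDP_def divide_le_eq)
  show "0 \<le> FDP n \<phi> \<theta>" unfolding FDP_def by (intro divide_nonneg_nonneg sum_nonneg) auto
qed

lemma FNP_bounds: "0 \<le> FNP n \<phi> \<theta>" "FNP n \<phi> \<theta> \<le> 1"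
proof -
  have "(\<Sum>i=1..n. of_bool (\<theta> i \<noteq> 0 \<and> \<not> \<phi> i)) \<le> (\<Sum>i=1..n. of_bool (\<theta> i \<noteq> 0) :: real)"
    by (intro sum_mono) auto
  then have "(\<Sum>i=1..n. of_bool (\<theta> i \<noteq> 0 \<and> \<not> \<phi> i)) \<le> max 1 (\<Sum>i=1..n. of_bool (\<theta> i \<noteq> 0) :: real)"
    by linarith
  then show "FNP n \<phi> \<theta> \<le> 1" by (simp add: FNP_def divide_le_eq)
  show "0 \<le> FNP n \<phi> \<theta>" unfolding FNP_def by (intro divide_nonneg_nonneg sum_nonneg) auto
qed

lemma sum_of_bool_card: "finite A \<Longrightarrow> (\<Sum>i\<in>A. of_bool (P i) :: real) = real (card {i \<in> A. P i})"
  by (simp add: of_bool_def sum.inter_filter[symmetric])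

lemma quotient_lower:
  fixes a b c r t :: real
  assumes "r > 0" "c \<ge> a + t * r - b"
  shows "(a - b) * (1 / r) \<le> c / r - t"
proof -
  have "(a - b) / r \<le> (c - t * r) / r" using assms by (intro divide_right_mono) auto
  then show ?thesis using assms by (simp add: diff_divide_distrib)
qed

lemma quotient_upper:
  fixes a c r t :: real
  assumes "r > 0" "c \<le> a + t * r"
  shows "c / r - t \<le> a * (1 / r)"
proof -
  have "(c - t * r) / r \<le> a / r" using assms by (intro divide_right_mono) auto
  then show ?thesis using assms by (simp add: diff_divide_distrib)
qed

text \<open>The sum of \<open>slab_prob\<close> over the null rejections is what
  separates the false discovery proportion from \<open>t\<close>: the rejected \<open>\<ell>\<close>-values average to \<open>t\<close> up to one
  summand, and those of the signals are negligible.\<close>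

locale good_data =
  fixes n :: nat and t :: real and x \<theta> :: "nat \<Rightarrow> real" and s :: nat
    and w1 w2 x1 x2 y0 \<delta> M K :: real
  assumes n: "n \<ge> 1" and t: "0 < t" "t < 1" and s: "s \<ge> 1"
    and card_signals: "card {i \<in> {1..n}. \<theta> i \<noteq> 0} = s"
    and w: "1 / real n \<le> w1" "w1 \<le> w2" "w2 < 1" and xy: "x2 \<le> y0"
    and score1: "total_score n x w1 > 0" and score2: "total_score n x w2 < 0"
    and signals: "real (card {i \<in> {1..n}. \<theta> i \<noteq> 0 \<and> \<bar>x i\<bar> < y0}) \<le> M" "M \<le> t * real s / 4"
    and \<delta>: "\<And>y. y0 \<le> \<bar>y\<bar> \<Longrightarrow> ell_value w1 y \<le> \<delta>" "\<delta> \<ge> 0" "\<delta> \<le> t / 4"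
    and V1: "3 * real s / (1 - t) \<le> real (card {i \<in> {1..n}. \<theta> i = 0 \<and> x1 < \<bar>x i\<bar>})"
      "real (card {i \<in> {1..n}. \<theta> i = 0 \<and> x1 < \<bar>x i\<bar>}) \<le> K * real s"
    and V2: "real (card {i \<in> {1..n}. \<theta> i = 0 \<and> x2 \<le> \<bar>x i\<bar>}) \<le> t * real s / 4"
    and A1: "(\<Sum>i | i \<in> {1..n} \<and> \<theta> i = 0 \<and> x1 < \<bar>x i\<bar>. slab_prob w2 (x i)) \<le> real s"
    and inj: "inj_on (\<lambda>i. \<bar>x i\<bar>) {1..n}"
begin

abbreviation "W \<equiv> w_hat n x"
abbreviation "l j \<equiv> ell_value W (x j)"
abbreviation "R \<equiv> reject_set t {1..n} (\<lambda>j. ell_value W (x j))"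
abbreviation "Nulls \<equiv> {i \<in> {1..n}. \<theta> i = 0}"
abbreviation "Signals \<equiv> {i \<in> {1..n}. \<theta> i \<noteq> 0}"
abbreviation "D1 \<equiv> {i \<in> {1..n}. x1 < \<bar>x i\<bar>}"
abbreviation "D2 \<equiv> {i \<in> {1..n}. x2 \<le> \<bar>x i\<bar>}"

lemma W: "w1 \<le> W" "W \<le> w2" "0 < w1" "0 < W" "W < 1"
proof -
  have "0 < 1 / real n" using n by simp
  then show w1: "0 < w1" using w by linarith
  show "w1 \<le> W" using n w score1 by (intro w_hat_ge) auto
  then show "0 < W" using w1 by linarith
  show "W \<le> w2" using n w score2 by (intro w_hat_le) auto
  then show "W < 1" using w by linarith
qed

lemma l_bounds: "0 \<le> l j" "l j \<le> 1" "l j = 1 - slab_prob W (x j)"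
  using ell_value_bounds[of W "x j"] ell_value_slab_prob[of W "x j"] W by auto

lemma lower_closed_D: "lower_closed {1..n} l D1" "lower_closed {1..n} l D2"
  using ell_value_le_iff[OF W(4,5)] by (auto simp: lower_closed_def)

text \<open>A signal observed below \<open>y0\<close> is charged 1 and any other at most
  \<open>\<delta>\<close>, because its \<ell>-value at the fitted weight is below the one at the
  smaller weight \<open>w1\<close>.\<close>

lemma signal_sum:
  assumes "D \<subseteq> {1..n}"
  shows "(\<Sum>j\<in>D \<inter> Signals. l j) \<le> M + \<delta> * real s"
proof -
  have "(\<Sum>j\<in>D \<inter> Signals. l j) \<le> (\<Sum>j\<in>Signals. l j)"
    using l_bounds by (intro sum_mono2) auto
  also have "\<dots> \<le> (\<Sum>j\<in>Signals. of_bool (\<bar>x j\<bar> < y0) + \<delta>)"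
  proof (intro sum_mono)
    fix j
    show "l j \<le> of_bool (\<bar>x j\<bar> < y0) + \<delta>"
    proof (cases "\<bar>x j\<bar> < y0")
      case False
      then have "l j \<le> ell_value w1 (x j)" "ell_value w1 (x j) \<le> \<delta>"
        using W \<delta>(1)[of "x j"] by (auto intro!: ell_value_antimono)
      then show ?thesis by simp
    qed (use l_bounds(2)[of j] \<delta> in simp)
  qed
  also have "\<dots> = real (card {i \<in> {1..n}. \<theta> i \<noteq> 0 \<and> \<bar>x i\<bar> < y0}) + \<delta> * real s"
  proof -
    have "{i \<in> Signals. \<bar>x i\<bar> < y0} = {i \<in> {1..n}. \<theta> i \<noteq> 0 \<and> \<bar>x i\<bar> < y0}" by auto
    moreover have "(\<Sum>i\<in>Signals. of_bool (\<bar>x i\<bar> < y0) :: real) = real (card {i \<in> Signals. \<bar>x i\<bar> < y0})"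
      by (rule sum_of_bool_card) simp
    ultimately show ?thesis using card_signals by (simp only: sum.distrib) simp
  qed
  finally show ?thesis using signals by linarith
qed

lemma split_sum:
  fixes f :: "nat \<Rightarrow> real"
  assumes "D \<subseteq> {1..n}" shows "sum f D = sum f (D \<inter> Nulls) + sum f (D \<inter> Signals)"
proof -
  have "finite D" using assms finite_subset by auto
  moreover have "D = (D \<inter> Nulls) \<union> (D \<inter> Signals)" using assms by auto
  ultimately show ?thesis using sum.union_disjoint[of "D \<inter> Nulls" "D \<inter> Signals" f] by auto
qed

lemma split_card:
  assumes "D \<subseteq> {1..n}" shows "real (card D) = real (card (D \<inter> Nulls)) + real (card (D \<inter> Signals))"
  using split_sum[OF assms, of "\<lambda>_. 1"] by simp

lemma missed_signals: "real (card (Signals - D2)) \<le> M"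
proof -
  have "card (Signals - D2) \<le> card {i \<in> {1..n}. \<theta> i \<noteq> 0 \<and> \<bar>x i\<bar> < y0}"
    using xy by (intro card_mono) auto
  then show ?thesis using signals by linarith
qed

lemma card_D2: "real (card D2) \<ge> real s - M"
proof -
  have "real s = real (card (D2 \<inter> Signals)) + real (card (Signals - D2))"
    using card_signals card_Int_Diff[of Signals D2] by (simp add: Int_commute)
  moreover have "card (D2 \<inter> Signals) \<le> card D2" by (intro card_mono) auto
  ultimately show ?thesis using missed_signals by linarith
qed

text \<open>Nulls, weakly observed signals and the remaining signals each use at most t s / 4 of the
  sum, while \<open>D2\<close> has at least s - M \<ge> 3 s / 4 elements, so its mean is at most
  t.\<close>

lemma D2_subset: "D2 \<subseteq> R"
proof (rule lower_closed_subset_reject[OF _ lower_closed_D(2)])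
  have "(\<Sum>j\<in>D2 \<inter> Nulls. l j) \<le> (\<Sum>j\<in>D2 \<inter> Nulls. 1)" using l_bounds by (intro sum_mono) auto
  also have "\<dots> = real (card {i \<in> {1..n}. \<theta> i = 0 \<and> x2 \<le> \<bar>x i\<bar>})"
    by simp (intro arg_cong[where f = card], auto)
  finally have "(\<Sum>j\<in>D2. l j) \<le> t * real s / 4 + (M + \<delta> * real s)"
  proof -
    assume "(\<Sum>j\<in>D2 \<inter> Nulls. l j) \<le> real (card {i \<in> {1..n}. \<theta> i = 0 \<and> x2 \<le> \<bar>x i\<bar>})"
    moreover have "(\<Sum>j\<in>D2. l j) = (\<Sum>j\<in>D2 \<inter> Nulls. l j) + (\<Sum>j\<in>D2 \<inter> Signals. l j)"
      by (rule split_sum) auto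
    moreover have "(\<Sum>j\<in>D2 \<inter> Signals. l j) \<le> M + \<delta> * real s" by (rule signal_sum) auto
    ultimately show ?thesis using V2 by linarith
  qed
  also have "\<dots> \<le> t * real s / 4 + (t * real s / 4 + t / 4 * real s)"
    using signals \<delta> by (intro add_mono mult_right_mono) auto
  also have "\<dots> = t * (real s - real s / 4)" by (simp add: algebra_simps)
  also have "\<dots> \<le> t * (real s - M)"
  proof -
    have "t * real s \<le> 1 * real s" using t by (intro mult_right_mono) auto
    then show ?thesis using signals t by (intro mult_left_mono) auto
  qed
  also have "\<dots> \<le> t * real (card D2)" using card_D2 t by (intro mult_left_mono) auto
  finally show "(\<Sum>j\<in>D2. l j) \<le> t * real (card D2)" .
qed simp

text \<open>If V nulls lie beyond \<open>x1\<close>, their \<ell>-values sum to at least V - s,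
  while \<open>D1\<close> has at most V + s elements. The constant 3 in 3 s / (1 - t) makes (1 - t)
  V exceed (1 + t) s, which puts the mean above t.\<close>

lemma R_subset_D1: "R \<subset> D1"
proof (rule reject_subset_lower_closed[OF _ lower_closed_D(1)])
  let ?V = "real (card {i \<in> {1..n}. \<theta> i = 0 \<and> x1 < \<bar>x i\<bar>})"
  have eq: "D1 \<inter> Nulls = {i \<in> {1..n}. \<theta> i = 0 \<and> x1 < \<bar>x i\<bar>}" by auto
  have "(\<Sum>j\<in>D1 \<inter> Nulls. slab_prob W (x j)) \<le> (\<Sum>j\<in>D1 \<inter> Nulls. slab_prob w2 (x j))"
    using W w by (intro sum_mono slab_prob_mono) auto
  also have "\<dots> \<le> real s" using A1 unfolding eq by simp
  finally have "(\<Sum>j\<in>D1 \<inter> Nulls. l j) \<ge> ?V - real s"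
    unfolding eq by (simp add: l_bounds(3) sum_subtractf)
  moreover have "(\<Sum>j\<in>D1 \<inter> Signals. l j) \<ge> 0" using l_bounds by (intro sum_nonneg) auto
  moreover have "(\<Sum>j\<in>D1. l j) = (\<Sum>j\<in>D1 \<inter> Nulls. l j) + (\<Sum>j\<in>D1 \<inter> Signals. l j)"
    by (rule split_sum) auto
  ultimately have "(\<Sum>j\<in>D1. l j) \<ge> ?V - real s" by linarith
  moreover have "real (card D1) \<le> ?V + real s"
  proof -
    have "card (D1 \<inter> Signals) \<le> card Signals" by (intro card_mono) auto
    moreover have "real (card D1) = real (card (D1 \<inter> Nulls)) + real (card (D1 \<inter> Signals))"
      by (rule split_card) auto
    ultimately show ?thesis using card_signals unfolding eq by linarith
  qed
  then have "t * real (card D1) \<le> t * (?V + real s)" using t by (intro mult_left_mono) auto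
  moreover have "3 * real s \<le> (1 - t) * ?V" using V1 t by (simp add: divide_le_eq mult.commute)
  then have "t * (?V + real s) < ?V - real s"
  proof -
    have "t * real s \<le> 1 * real s" using t by (intro mult_right_mono) auto
    moreover have "(1 - t) * ?V = ?V - t * ?V" "t * (?V + real s) = t * ?V + t * real s"
      by (simp_all only: left_diff_distrib distrib_left mult_1_left)
    moreover have "real s \<ge> 1" using s by simp
    ultimately show ?thesis using \<open>3 * real s \<le> (1 - t) * ?V\<close> by linarith
  qed
  ultimately show "t * real (card D1) < (\<Sum>j\<in>D1. l j)" by linarith
qed simp

lemma card_R: "real (card R) \<ge> 3 / 4 * real s" "real (card R) \<le> (K + 1) * real s"
proof -
  have sub: "R \<subseteq> {1..n}" by (auto simp: reject_set_def)
  then have fin: "finite R" using finite_subset by auto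
  have "real (card D2) \<le> real (card R)" using D2_subset fin by (simp add: card_mono)
  moreover have "t * real s \<le> 1 * real s" using t by (intro mult_right_mono) auto
  ultimately show "real (card R) \<ge> 3 / 4 * real s" using card_D2 signals by linarith
  have "card (R \<inter> Nulls) \<le> card {i \<in> {1..n}. \<theta> i = 0 \<and> x1 < \<bar>x i\<bar>}"
    using R_subset_D1 by (intro card_mono) auto
  moreover have "card (R \<inter> Signals) \<le> s"
    unfolding card_signals[symmetric] by (intro card_mono) auto
  ultimately show "real (card R) \<le> (K + 1) * real s"
    using split_card[OF sub] V1 by (simp add: algebra_simps)
qed

text \<open>Each rejected null counts as \<open>slab_prob\<close> plus \<ell>-value. The
  \<ell>-values over all of \<open>R\<close> sum to nearly t times its size, so the
  \<open>slab_prob\<close> part is the excess over t.\<close>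

lemma false_rejections:
  "real (card (R \<inter> Nulls)) = (\<Sum>j\<in>R \<inter> Nulls. slab_prob W (x j)) + sum l R - (\<Sum>j\<in>R \<inter> Signals. l j)"
proof -
  have "R \<subseteq> {1..n}" by (auto simp: reject_set_def)
  then have "sum l R - (\<Sum>j\<in>R \<inter> Signals. l j) = (\<Sum>j\<in>R \<inter> Nulls. l j)" using split_sum[of R l] by simp
  moreover have "(\<Sum>j\<in>R \<inter> Nulls. l j) = real (card (R \<inter> Nulls)) - (\<Sum>j\<in>R \<inter> Nulls. slab_prob W (x j))"
    by (simp add: l_bounds(3) sum_subtractf)
  ultimately show ?thesis by linarith
qed

lemma FDP_eq: "FDP n (cl_procedure t n x) \<theta> = real (card (R \<inter> Nulls)) / real (card R)"
proof -
  have iff: "cl_procedure t n x i \<longleftrightarrow> i \<in> R" if "i \<in> {1..n}" for i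
    using cl_procedure_iff[OF n _ that] t by simp
  have sub: "R \<subseteq> {1..n}" by (auto simp: reject_set_def)
  have "{i \<in> {1..n}. \<theta> i = 0 \<and> cl_procedure t n x i} = R \<inter> Nulls"
    "{i \<in> {1..n}. cl_procedure t n x i} = R"
    using iff sub by auto
  then have "(\<Sum>i=1..n. of_bool (\<theta> i = 0 \<and> cl_procedure t n x i)) = real (card (R \<inter> Nulls))"
    "(\<Sum>i=1..n. of_bool (cl_procedure t n x i)) = real (card R)"
    by (simp_all only: sum_of_bool_card[OF finite_atLeastAtMost])
  moreover have "real (card R) \<ge> 1" using card_R(1) s by (cases "card R") auto
  ultimately show ?thesis by (simp add: FDP_def max_def)
qed

lemma FDP_upper:
  "FDP n (cl_procedure t n x) \<theta> - t
    \<le> 2 * (\<Sum>i | i \<in> {1..n} \<and> \<theta> i = 0 \<and> x1 < \<bar>x i\<bar>. slab_prob w2 (x i)) / real s"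
proof -
  let ?A = "\<Sum>i | i \<in> {1..n} \<and> \<theta> i = 0 \<and> x1 < \<bar>x i\<bar>. slab_prob w2 (x i)"
  have nonneg: "slab_prob w2 (x i) \<ge> 0" for i using W w by (intro slab_prob_nonneg) auto
  have r: "real (card R) > 0" "1 / real (card R) \<le> 2 / real s" using card_R(1) s by (auto simp: field_simps)
  have "(\<Sum>j\<in>R \<inter> Nulls. slab_prob W (x j)) \<le> (\<Sum>j\<in>R \<inter> Nulls. slab_prob w2 (x j))"
    using W w by (intro sum_mono slab_prob_mono) auto
  also have "\<dots> \<le> ?A" using R_subset_D1 nonneg by (intro sum_mono2) auto
  finally have "real (card (R \<inter> Nulls)) \<le> ?A + t * real (card R)"
    using false_rejections reject_set_mean[where I = "{1..n}" and t = t and l = l] l_bounds(1)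
      sum_nonneg[of "R \<inter> Signals" l] by auto
  then have "FDP n (cl_procedure t n x) \<theta> - t \<le> ?A * (1 / real (card R))"
    unfolding FDP_eq by (intro quotient_upper r)
  also have "\<dots> \<le> ?A * (2 / real s)" using r nonneg by (intro mult_left_mono sum_nonneg) auto
  also have "a * (2 / b) = 2 * a / b" for a b :: real by simp
  finally show ?thesis .
qed

text \<open>Here they are reduced to \<open>w1\<close> and \<open>D2\<close>. The gain is divided by
  the upper bound for the number of rejections and the loss by the lower one; the 1 in the loss is
  the summand from \<open>reject_set_mean_lower\<close>.\<close>

lemma FDP_lower:
  "(\<Sum>i | i \<in> {1..n} \<and> \<theta> i = 0 \<and> x2 \<le> \<bar>x i\<bar>. slab_prob w1 (x i)) / ((K + 1) * real s)
      - 2 * (M + \<delta> * real s + 1) / real s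
    \<le> FDP n (cl_procedure t n x) \<theta> - t"
proof -
  let ?A = "\<Sum>i | i \<in> {1..n} \<and> \<theta> i = 0 \<and> x2 \<le> \<bar>x i\<bar>. slab_prob w1 (x i)"
  let ?B = "M + \<delta> * real s + 1"
  have nonneg: "slab_prob w1 (x i) \<ge> 0" "slab_prob W (x i) \<ge> 0" for i
    using W w by (auto intro!: slab_prob_nonneg)
  have sub: "R \<subseteq> {1..n}" by (auto simp: reject_set_def)
  have r: "real (card R) > 0" "1 / real (card R) \<le> 2 / real s" using card_R(1) s by (auto simp: field_simps)
  have B: "?B \<ge> 0" using signals(1) \<delta> by auto
  have A: "?A \<ge> 0" using nonneg by (intro sum_nonneg) auto
  have "?A \<le> (\<Sum>j | j \<in> {1..n} \<and> \<theta> j = 0 \<and> x2 \<le> \<bar>x j\<bar>. slab_prob W (x j))"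
    using W w by (intro sum_mono slab_prob_mono) auto
  also have "\<dots> \<le> (\<Sum>j\<in>R \<inter> Nulls. slab_prob W (x j))" using D2_subset nonneg by (intro sum_mono2) auto
  finally have "?A \<le> (\<Sum>j\<in>R \<inter> Nulls. slab_prob W (x j))" .
  moreover have "t * real (card R) - 1 \<le> sum l R"
  proof (rule reject_set_mean_lower)
    show "inj_on l {1..n}"
    proof (rule inj_onI)
      fix i j assume ij: "i \<in> {1..n}" "j \<in> {1..n}" "l i = l j"
      then have "\<bar>x i\<bar> = \<bar>x j\<bar>"
        using ell_value_le_iff[OF W(4,5), of "x i" "x j"] ell_value_le_iff[OF W(4,5), of "x j" "x i"] by simp
      then show "i = j" using inj ij by (auto dest: inj_onD)
    qed
    show "R \<noteq> {1..n}" using R_subset_D1 by auto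
  qed (use l_bounds t in auto)
  ultimately have "real (card (R \<inter> Nulls)) \<ge> ?A + t * real (card R) - ?B"
    using false_rejections signal_sum[OF sub] by linarith
  then have "(?A - ?B) * (1 / real (card R)) \<le> FDP n (cl_procedure t n x) \<theta> - t"
    unfolding FDP_eq by (intro quotient_lower r)
  moreover have "?A * (1 / ((K + 1) * real s)) \<le> ?A * (1 / real (card R))"
    using A r card_R(2) by (intro mult_left_mono frac_le) auto
  moreover have "?B * (1 / real (card R)) \<le> ?B * (2 / real s)" using r B by (intro mult_left_mono) auto
  moreover have "a * (1 / c) - b * (2 / d) \<le> f"
    if "(a - b) * (1 / r) \<le> f" "a * (1 / c) \<le> a * (1 / r)" "b * (1 / r) \<le> b * (2 / d)" for a b c d r f :: real
    using that by (simp only: left_diff_distrib)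
  ultimately have "?A * (1 / ((K + 1) * real s)) - ?B * (2 / real s) \<le> FDP n (cl_procedure t n x) \<theta> - t"
    by blast
  moreover have "a * (1 / b) = a / b" "a * (2 / b) = 2 * a / b" for a b :: real by simp_all
  ultimately show ?thesis by (simp only:)
qed

lemma FNP_le: "FNP n (cl_procedure t n x) \<theta> \<le> M / real s"
proof -
  have iff: "cl_procedure t n x i \<longleftrightarrow> i \<in> R" if "i \<in> {1..n}" for i
    using cl_procedure_iff[OF n _ that] t by simp
  have "{i \<in> {1..n}. \<theta> i \<noteq> 0 \<and> \<not> cl_procedure t n x i} = Signals - R" using iff by auto
  then have "(\<Sum>i=1..n. of_bool (\<theta> i \<noteq> 0 \<and> \<not> cl_procedure t n x i)) = real (card (Signals - R))"
    by (simp only: sum_of_bool_card[OF finite_atLeastAtMost])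
  moreover have "card (Signals - R) \<le> card (Signals - D2)" using D2_subset by (intro card_mono) auto
  moreover have "(\<Sum>i=1..n. of_bool (\<theta> i \<noteq> 0)) = real s"
    by (simp only: sum_of_bool_card[OF finite_atLeastAtMost] card_signals)
  ultimately show ?thesis using missed_signals s
    by (simp add: FNP_def max_def divide_right_mono)
qed

end

section \<open>The exceptional event and the error rates\<close>

definition deviation :: "nat \<Rightarrow> (real \<Rightarrow> real) \<Rightarrow> nat set \<Rightarrow> real \<Rightarrow> (nat \<Rightarrow> real) set" where
  "deviation n h A a = {\<epsilon> \<in> space (noise_law n).
     \<bar>(\<Sum>i\<in>A. h (\<epsilon> i)) - real (card A) * (\<integral>x. h x \<partial>std_normal)\<bar> \<ge> a}"

lemma noise_sum_measurable:
  assumes [measurable]: "h \<in> borel_measurable borel" and A: "A \<subseteq> {1..n}"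
  shows "(\<lambda>\<epsilon>. \<Sum>i\<in>A. h (\<epsilon> i) :: real) \<in> borel_measurable (noise_law n)"
proof (rule borel_measurable_sum)
  fix i assume "i \<in> A"
  then have "(\<lambda>\<epsilon>. \<epsilon> i) \<in> borel_measurable (noise_law n)" using A by (intro noise_component_measurable) auto
  then show "(\<lambda>\<epsilon>. h (\<epsilon> i)) \<in> borel_measurable (noise_law n)" by measurable
qed

lemma deviation_sets:
  assumes "h \<in> borel_measurable borel" "A \<subseteq> {1..n}"
  shows "deviation n h A a \<in> sets (noise_law n)"
proof -
  note noise_sum_measurable[OF assms, measurable]
  show ?thesis unfolding deviation_def by measurable
qed

lemma deviation_prob:
  assumes "h \<in> borel_measurable borel" "\<And>x. \<bar>h x\<bar> \<le> K" "A \<subseteq> {1..n}" "a > 0"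
    and "real (card A) * (\<integral>x. (h x)\<^sup>2 \<partial>std_normal) \<le> q * a\<^sup>2"
  shows "measure (noise_law n) (deviation n h A a) \<le> q"
proof -
  have "measure (noise_law n) (deviation n h A a) \<le> real (card A) * (\<integral>x. (h x)\<^sup>2 \<partial>std_normal) / a\<^sup>2"
    unfolding deviation_def by (rule noise_chebyshev[OF assms(1-4)])
  also have "\<dots> \<le> q" using assms(4,5) by (simp add: divide_le_eq)
  finally show ?thesis .
qed

lemma noise_sum_integral:
  assumes h: "h \<in> borel_measurable borel" "\<And>x. \<bar>h x\<bar> \<le> K" and A: "A \<subseteq> {1..n}"
  shows "integrable (noise_law n) (\<lambda>\<epsilon>. \<Sum>i\<in>A. h (\<epsilon> i))"
    and "(\<integral>\<epsilon>. (\<Sum>i\<in>A. h (\<epsilon> i)) \<partial>noise_law n) = real (card A) * (\<integral>x. h x \<partial>std_normal)"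
proof -
  interpret N: prob_space "noise_law n" by (rule prob_space_noise_law)
  note [measurable] = h(1)
  have int: "integrable (noise_law n) (\<lambda>\<epsilon>. h (\<epsilon> i))" if "i \<in> A" for i
  proof (rule N.integrable_const_bound[of _ K])
    have "(\<lambda>\<epsilon>. \<epsilon> i) \<in> borel_measurable (noise_law n)" using A that by (intro noise_component_measurable) auto
    then show "(\<lambda>\<epsilon>. h (\<epsilon> i)) \<in> borel_measurable (noise_law n)" by measurable
  qed (use h(2) in auto)
  then show "integrable (noise_law n) (\<lambda>\<epsilon>. \<Sum>i\<in>A. h (\<epsilon> i))" by (intro Bochner_Integration.integrable_sum)
  have "(\<integral>\<epsilon>. (\<Sum>i\<in>A. h (\<epsilon> i)) \<partial>noise_law n) = (\<Sum>i\<in>A. \<integral>\<epsilon>. h (\<epsilon> i) \<partial>noise_law n)"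
    using int by (intro Bochner_Integration.integral_sum)
  also have "\<dots> = (\<Sum>i\<in>A. \<integral>x. h x \<partial>std_normal)"
    using A by (intro sum.cong refl noise_integral_component h) auto
  finally show "(\<integral>\<epsilon>. (\<Sum>i\<in>A. h (\<epsilon> i)) \<partial>noise_law n) = real (card A) * (\<integral>x. h x \<partial>std_normal)" by simp
qed

text \<open>\<open>C\<close> adds up the constants of seven Chebyshev bounds, while \<open>193 = 12 * 16 + 1\<close>, \<open>80 = 16 + 8\<^sup>2\<close>
  and \<open>2048 = 8 * 256\<close> come from the prefactors \<open>16\<close> and \<open>1 / 8\<close> of the two weights.\<close>

locale regime =
  fixes t L \<kappa> v :: real and n s :: nat and \<theta> :: "nat \<Rightarrow> real" and w1 w2 x1 x2 C :: real
  assumes t: "0 < t" "t < 1" and L: "L \<ge> 8 / t" "ln L \<ge> 1" "ln L \<ge> 8192 * (\<kappa> + 2) * (4 * C + 12)"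
    and L': "193 * (ln L / L) \<le> 1 / 2" and \<kappa>: "\<kappa> > 0"
    and C: "C = 64 / t\<^sup>2 + 80 + 1088 + \<kappa> + 8 / t + 2 + 8192\<^sup>2"
    and s: "s \<ge> 1" "real s \<ge> L ^ 3" and n: "real n = real s * exp L"
    and \<theta>: "\<theta> \<in> signal_class n s v"
    and w_def: "w1 = weight (1 / 8) L" "w2 = weight 16 L"
    and w: "0 < w1" "w1 \<le> 1 / 2" "0 < w2" "w2 \<le> 1 / 2"
    and mean: "(\<integral>x. score w1 x \<partial>std_normal) \<ge> - 1 / sqrt L" "(\<integral>x. score w2 x \<partial>std_normal) \<le> - 1 / (2 * sqrt L)"
    and second: "(\<integral>x. (score w1 x)\<^sup>2 \<partial>std_normal) \<le> 80 * exp L / (L * sqrt L)"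
      "(\<integral>x. (score w2 x)\<^sup>2 \<partial>std_normal) \<le> 17 * exp L / (L * sqrt L)"
    and p1: "8 / (1 - t) * exp (- L) \<le> measure std_normal {y. x1 < \<bar>y\<bar>}"
      "measure std_normal {y. x1 < \<bar>y\<bar>} \<le> \<kappa> * exp (- L)"
    and p2: "measure std_normal {y. x2 \<le> \<bar>y\<bar>} \<le> t / 8 * exp (- L)"
    and a1: "(\<integral>y. indicator {y. x1 < \<bar>y\<bar>} y * slab_prob w2 y \<partial>std_normal) \<le> 193 * (exp (- L) * ln L / L)"
    and a2: "1 / 2048 * (exp (- L) * ln L / L) \<le> (\<integral>y. indicator {y. x2 \<le> \<bar>y\<bar>} y * slab_prob w1 y \<partial>std_normal)"
    and rho_large: "\<And>y. sqrt (2 * L) + 1 \<le> \<bar>y\<bar> \<Longrightarrow> L \<le> w1 * rho y"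
    and x2: "x2 \<le> sqrt (2 * L)"
    and v: "v \<ge> 2" "measure std_normal {y. v / 2 \<le> \<bar>y\<bar>} \<le> 1 / L"
begin

abbreviation "Nulls \<equiv> {i \<in> {1..n}. \<theta> i = 0}"
abbreviation "Signals \<equiv> {i \<in> {1..n}. \<theta> i \<noteq> 0}"

definition missed :: "(nat \<Rightarrow> real) \<Rightarrow> real" where
  "missed \<epsilon> = (\<Sum>i\<in>Signals. indicator {y. v / 2 \<le> \<bar>y\<bar>} (\<epsilon> i))"

definition excess1 :: "(nat \<Rightarrow> real) \<Rightarrow> real" where
  "excess1 \<epsilon> = (\<Sum>i\<in>Nulls. indicator {y. x1 < \<bar>y\<bar>} (\<epsilon> i) * slab_prob w2 (\<epsilon> i))"

definition excess2 :: "(nat \<Rightarrow> real) \<Rightarrow> real" where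
  "excess2 \<epsilon> = (\<Sum>i\<in>Nulls. indicator {y. x2 \<le> \<bar>y\<bar>} (\<epsilon> i) * slab_prob w1 (\<epsilon> i))"

definition "bad1 = deviation n (indicator {y. v / 2 \<le> \<bar>y\<bar>}) Signals (t * real s / 8)"
definition "bad2 = deviation n (score w1) Nulls (real n / sqrt L)"
definition "bad3 = deviation n (score w2) Nulls (real n / (8 * sqrt L))"
definition "bad4 = deviation n (indicator {y. x1 < \<bar>y\<bar>}) Nulls (real s)"
definition "bad5 = deviation n (indicator {y. x2 \<le> \<bar>y\<bar>}) Nulls (t * real s / 8)"
definition "bad6 = deviation n (\<lambda>y. indicator {y. x1 < \<bar>y\<bar>} y * slab_prob w2 y) Nulls (real s / 2)"
definition "bad7 = deviation n (\<lambda>y. indicator {y. x2 \<le> \<bar>y\<bar>} y * slab_prob w1 y) Nulls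
  (real s * (ln L / L) / 8192)"

definition "bad = bad1 \<union> bad2 \<union> bad3 \<union> bad4 \<union> bad5 \<union> bad6 \<union> bad7"

lemma L8: "L \<ge> 8" "L > 0" "sqrt L \<ge> 1" "t * L \<ge> 8"
proof -
  show "t * L \<ge> 8" using L t by (simp add: divide_le_eq mult.commute)
  have "8 / 1 \<le> 8 / t" using t by (intro divide_left_mono) auto
  then show "L \<ge> 8" using L by linarith
  then show "L > 0" "sqrt L \<ge> 1" by auto
qed

lemma s_ge: "real s \<ge> L" "real s > 0" "1 / real s \<le> 1 / L"
proof -
  have "L ^ 1 \<le> L ^ 3" using L8 by (intro power_increasing) auto
  then show "real s \<ge> L" using s by simp
  then show "real s > 0" "1 / real s \<le> 1 / L" using L8 by (auto intro!: divide_left_mono)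
qed

lemma n_exp: "real n * exp (- L) = real s" "n \<ge> 1"
proof -
  show "real n * exp (- L) = real s" by (simp add: n exp_minus)
  then show "n \<ge> 1" using s by (cases n) auto
qed

lemma exp_L_ge: "exp L \<ge> L" "exp L \<ge> 2"
  using exp_ge_add_one_self[of L] L8 by linarith+

lemma card_signals: "card Signals = s"
  using \<theta> by (simp add: signal_class_def)

lemma signal_size: "i \<in> Signals \<Longrightarrow> \<bar>\<theta> i\<bar> \<ge> sqrt (2 * L) + v"
proof -
  have "real n / real s = exp L" using n s by simp
  then have "ln (real n / real s) = L" by simp
  then show "i \<in> Signals \<Longrightarrow> \<bar>\<theta> i\<bar> \<ge> sqrt (2 * L) + v" using \<theta> by (auto simp: signal_class_def)
qed

lemma card_nulls: "real (card Nulls) \<le> real n" "real (card Nulls) \<ge> real n / 2"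
proof -
  have "card Nulls \<le> card {1..n}" by (intro card_mono) auto
  then show "real (card Nulls) \<le> real n" by simp
  have "{1..n} = Nulls \<union> Signals" by auto
  then have "card {1..n} = card (Nulls \<union> Signals)" by (rule arg_cong)
  also have "\<dots> = card Nulls + card Signals" by (rule card_Un_disjoint) auto
  finally have "real n = real (card Nulls) + real s" using card_signals by simp
  moreover have "real s * 2 \<le> real n" unfolding n using exp_L_ge by (intro mult_left_mono) auto
  ultimately show "real (card Nulls) \<ge> real n / 2" by linarith
qed

lemma subsets: "Nulls \<subseteq> {1..n}" "Signals \<subseteq> {1..n}"
  by auto

lemma w_le_1: "0 \<le> w1" "w1 \<le> 1" "0 \<le> w2" "w2 \<le> 1" using w by auto

lemma slab_bounded:
  "\<bar>indicator A y * slab_prob w1 y\<bar> \<le> 1" "\<bar>indicator A y * slab_prob w2 y\<bar> \<le> 1"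
  using slab_prob_le_1[OF w_le_1(1,2), of y] slab_prob_nonneg[OF w_le_1(1,2), of y]
    slab_prob_le_1[OF w_le_1(3,4), of y] slab_prob_nonneg[OF w_le_1(3,4), of y]
  by (auto split: split_indicator)

lemma indicator_bounded: "\<bar>indicator A y :: real\<bar> \<le> 1"
  by (auto split: split_indicator)

lemma indicator_measurable:
  "(indicator {y. c \<le> \<bar>y\<bar>} :: real \<Rightarrow> real) \<in> borel_measurable borel"
  "(indicator {y. c < \<bar>y\<bar>} :: real \<Rightarrow> real) \<in> borel_measurable borel"
  "(\<lambda>y. indicator {y. c \<le> \<bar>y\<bar>} y * slab_prob u y) \<in> borel_measurable borel"
  "(\<lambda>y. indicator {y. c < \<bar>y\<bar>} y * slab_prob u y) \<in> borel_measurable borel"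
  by measurable

lemma indicator_integral:
  "(\<integral>y. indicator {y. c \<le> \<bar>y\<bar>} y \<partial>std_normal) = measure std_normal {y. c \<le> \<bar>y\<bar>}"
  "(\<integral>y. indicator {y. c < \<bar>y\<bar>} y \<partial>std_normal) = measure std_normal {y. c < \<bar>y\<bar>}"
  "(\<integral>y. (indicator {y. c \<le> \<bar>y\<bar>} y)\<^sup>2 \<partial>std_normal) = measure std_normal {y. c \<le> \<bar>y\<bar>}"
  "(\<integral>y. (indicator {y. c < \<bar>y\<bar>} y)\<^sup>2 \<partial>std_normal) = measure std_normal {y. c < \<bar>y\<bar>}"
proof -
  have sq: "(indicator A y :: real)\<^sup>2 = indicator A y" for A and y :: real
    by (auto split: split_indicator)
  show "(\<integral>y. indicator {y. c \<le> \<bar>y\<bar>} y \<partial>std_normal) = measure std_normal {y. c \<le> \<bar>y\<bar>}"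
    "(\<integral>y. indicator {y. c < \<bar>y\<bar>} y \<partial>std_normal) = measure std_normal {y. c < \<bar>y\<bar>}"
    "(\<integral>y. (indicator {y. c \<le> \<bar>y\<bar>} y)\<^sup>2 \<partial>std_normal) = measure std_normal {y. c \<le> \<bar>y\<bar>}"
    "(\<integral>y. (indicator {y. c < \<bar>y\<bar>} y)\<^sup>2 \<partial>std_normal) = measure std_normal {y. c < \<bar>y\<bar>}"
    by (simp_all add: sq)
qed

lemma excess_mean:
  "real (card Nulls) * (\<integral>y. indicator {y. x1 < \<bar>y\<bar>} y * slab_prob w2 y \<partial>std_normal) \<le> 193 * (real s * (ln L / L))"
  "real s * (ln L / L) / 4096 \<le> real (card Nulls) * (\<integral>y. indicator {y. x2 \<le> \<bar>y\<bar>} y * slab_prob w1 y \<partial>std_normal)"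
proof -
  have "real (card Nulls) * (\<integral>y. indicator {y. x1 < \<bar>y\<bar>} y * slab_prob w2 y \<partial>std_normal)
    \<le> real (card Nulls) * (193 * (exp (- L) * ln L / L))"
    by (intro mult_left_mono a1) auto
  also have "\<dots> \<le> real n * (193 * (exp (- L) * ln L / L))"
    using card_nulls L L8 by (intro mult_right_mono) auto
  also have "\<dots> = 193 * ((real n * exp (- L)) * (ln L / L))" by simp
  finally show "real (card Nulls) * (\<integral>y. indicator {y. x1 < \<bar>y\<bar>} y * slab_prob w2 y \<partial>std_normal) \<le> 193 * (real s * (ln L / L))"
    unfolding n_exp .
  have "real s * (ln L / L) / 4096 = real n * exp (- L) * (ln L / L) / 4096" unfolding n_exp ..
  also have "\<dots> = real n / 2 * (1 / 2048 * (exp (- L) * ln L / L))" by simp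
  also have "\<dots> \<le> real (card Nulls) * (1 / 2048 * (exp (- L) * ln L / L))"
    using card_nulls L L8 by (intro mult_right_mono) auto
  also have "\<dots> \<le> real (card Nulls) * (\<integral>y. indicator {y. x2 \<le> \<bar>y\<bar>} y * slab_prob w1 y \<partial>std_normal)"
    by (intro mult_left_mono a2) auto
  finally show "real s * (ln L / L) / 4096 \<le> real (card Nulls) * (\<integral>y. indicator {y. x2 \<le> \<bar>y\<bar>} y * slab_prob w1 y \<partial>std_normal)" .
qed

text \<open>Nulls make up at least half of the n coordinates and n exp (- L) = s; this is how 8 / (1
  - t) becomes 4 / (1 - t).\<close>

lemma null_count:
  "4 * real s / (1 - t) \<le> real (card Nulls) * measure std_normal {y. x1 < \<bar>y\<bar>}"
  "real (card Nulls) * measure std_normal {y. x1 < \<bar>y\<bar>} \<le> \<kappa> * real s"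
  "real (card Nulls) * measure std_normal {y. x2 \<le> \<bar>y\<bar>} \<le> t * real s / 8"
proof -
  have "4 * real s / (1 - t) = real n * exp (- L) * (4 / (1 - t))" unfolding n_exp by simp
  also have "\<dots> = real n / 2 * (8 / (1 - t) * exp (- L))" by simp
  also have "\<dots> \<le> real (card Nulls) * measure std_normal {y. x1 < \<bar>y\<bar>}"
    using card_nulls p1 t by (intro mult_mono) auto
  finally show "4 * real s / (1 - t) \<le> real (card Nulls) * measure std_normal {y. x1 < \<bar>y\<bar>}" .
  have "real (card Nulls) * measure std_normal {y. x1 < \<bar>y\<bar>} \<le> real n * (\<kappa> * exp (- L))"
    using card_nulls p1 by (intro mult_mono) auto
  also have "\<dots> = \<kappa> * (real n * exp (- L))" by simp
  finally show "real (card Nulls) * measure std_normal {y. x1 < \<bar>y\<bar>} \<le> \<kappa> * real s" unfolding n_exp .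
  have "real (card Nulls) * measure std_normal {y. x2 \<le> \<bar>y\<bar>} \<le> real n * (t / 8 * exp (- L))"
    using card_nulls p2 by (intro mult_mono) auto
  also have "\<dots> = t * (real n * exp (- L)) / 8" by simp
  finally show "real (card Nulls) * measure std_normal {y. x2 \<le> \<bar>y\<bar>} \<le> t * real s / 8" unfolding n_exp .
qed

lemma bad_sets: "bad \<in> sets (noise_law n)"
  unfolding bad_def bad1_def bad2_def bad3_def bad4_def bad5_def bad6_def bad7_def
  by (intro sets.Un deviation_sets indicator_measurable score_measurable subsets)

text \<open>Since s \<ge> L, exp L is at most n / L. Deviations of order n / sqrt L, the size of the
  null drift, therefore have probability O(1 / L).\<close>

lemma score_deviation_bound:
  assumes "w = w1 \<or> w = w2" "(\<integral>x. (score w x)\<^sup>2 \<partial>std_normal) \<le> q * exp L / (L * sqrt L)" "q \<ge> 0" "b > 0"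
  shows "real (card Nulls) * (\<integral>x. (score w x)\<^sup>2 \<partial>std_normal) \<le> q * b\<^sup>2 / L * (real n / (b * sqrt L))\<^sup>2"
proof -
  have "real (card Nulls) * (\<integral>x. (score w x)\<^sup>2 \<partial>std_normal) \<le> real n * (q * exp L / (L * sqrt L))"
    using card_nulls assms by (intro mult_mono) auto
  also have "\<dots> = q / (L * sqrt L) * (real n * exp L)" by simp
  also have "\<dots> \<le> q / (L * 1) * (real n * (real n / L))"
  proof (intro mult_mono)
    show "q / (L * sqrt L) \<le> q / (L * 1)"
      using assms L8 by (intro divide_left_mono mult_left_mono mult_pos_pos) auto
    have "exp L * L \<le> real n" unfolding n using s_ge(1) by (subst mult.commute) (intro mult_right_mono, auto)
    then show "exp L \<le> real n / L" using L8 by (simp add: le_divide_eq)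
  qed (use assms L8 in auto)
  also have "\<dots> = q * b\<^sup>2 / L * (real n / (b * sqrt L))\<^sup>2"
    using assms L8 by (simp add: power_divide power_mult_distrib power2_eq_square)
  finally show ?thesis .
qed

lemma prob_bad: "measure (noise_law n) bad \<le> C / L"
proof -
  interpret N: prob_space "noise_law n" by (rule prob_space_noise_law)
  let ?P = "measure (noise_law n)"
  have P1: "?P bad1 \<le> 64 / t\<^sup>2 / L" unfolding bad1_def
  proof (rule deviation_prob[OF indicator_measurable(1) indicator_bounded subsets(2)])
    show "0 < t * real s / 8" using t s_ge by simp
    have "real (card Signals) * measure std_normal {y. v / 2 \<le> \<bar>y\<bar>} \<le> real s * 1"
      unfolding card_signals by (intro mult_left_mono std_normal.prob_le_1) auto
    also have "\<dots> \<le> real s * (real s / L)" using s_ge L8 by (intro mult_left_mono) auto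
    also have "\<dots> = 64 / t\<^sup>2 / L * (t * real s / 8)\<^sup>2"
      using t L8 by (simp add: power2_eq_square)
    finally show "real (card Signals) * (\<integral>x. (indicator {y. v / 2 \<le> \<bar>y\<bar>} x)\<^sup>2 \<partial>std_normal) \<le> 64 / t\<^sup>2 / L * (t * real s / 8)\<^sup>2"
      by (simp only: indicator_integral)
  qed
  have npos: "real n > 0" using n_exp(2) by simp
  have P2: "?P bad2 \<le> 80 / L" unfolding bad2_def
    using score_deviation_bound[of w1 80 1] second npos L8 w
    by (intro deviation_prob[OF score_measurable score_abs_le subsets(1)]) auto
  have P3: "?P bad3 \<le> 1088 / L" unfolding bad3_def
    using score_deviation_bound[of w2 17 8] second npos L8 w
    by (intro deviation_prob[OF score_measurable score_abs_le subsets(1)]) auto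
  have P4: "?P bad4 \<le> \<kappa> / L" unfolding bad4_def
  proof (rule deviation_prob[OF indicator_measurable(2) indicator_bounded subsets(1) s_ge(2)])
    have "\<kappa> * real s \<le> \<kappa> * (real s * (real s / L))" using s_ge L8 \<kappa>
      by (intro mult_left_mono) (auto simp: le_divide_eq)
    then show "real (card Nulls) * (\<integral>x. (indicator {y. x1 < \<bar>y\<bar>} x)\<^sup>2 \<partial>std_normal) \<le> \<kappa> / L * (real s)\<^sup>2"
      using null_count(2) unfolding indicator_integral by (simp add: power2_eq_square)
  qed
  have P5: "?P bad5 \<le> 8 / t / L" unfolding bad5_def
  proof (rule deviation_prob[OF indicator_measurable(1) indicator_bounded subsets(1)])
    show "0 < t * real s / 8" using t s_ge by simp
    have "t * real s / 8 \<le> t * (real s * (real s / L)) / 8" using s_ge L8 t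
      by (intro divide_right_mono mult_left_mono) (auto simp: le_divide_eq)
    also have "\<dots> = 8 / t / L * (t * real s / 8)\<^sup>2" using t L8 by (simp add: power2_eq_square)
    finally show "real (card Nulls) * (\<integral>x. (indicator {y. x2 \<le> \<bar>y\<bar>} x)\<^sup>2 \<partial>std_normal) \<le> 8 / t / L * (t * real s / 8)\<^sup>2"
      using null_count(3) unfolding indicator_integral by linarith
  qed
  have sq_le: "(\<integral>y. (h y)\<^sup>2 \<partial>std_normal) \<le> (\<integral>y. g y \<partial>std_normal)"
    if "h \<in> borel_measurable borel" "g \<in> borel_measurable borel" "\<And>y. \<bar>h y\<bar> \<le> 1" "\<And>y. \<bar>g y\<bar> \<le> 1" "\<And>y. (h y)\<^sup>2 \<le> g y" for h g :: "real \<Rightarrow> real"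
  proof (rule integral_mono)
    show "integrable std_normal g" using that by (intro std_normal_integrable_bounded[of _ 1])
    show "integrable std_normal (\<lambda>y. (h y)\<^sup>2)"
    proof (rule std_normal_integrable_bounded[of _ 1])
      show "(\<lambda>y. (h y)\<^sup>2) \<in> borel_measurable borel" using that(1) by measurable
      show "\<bar>(h y)\<^sup>2\<bar> \<le> 1" for y using that(3)[of y] by (simp add: abs_square_le_1)
    qed
  qed (use that in auto)
  \<comment> \<open>Terms in [0, 1] have squares below themselves, so second moments reduce to means
    or to tail probabilities.\<close>
  have slab01: "(indicator A y * slab_prob u y)\<^sup>2 \<le> indicator A y * slab_prob u y"
    "(indicator A y * slab_prob u y)\<^sup>2 \<le> indicator A y"
    if "u = w1 \<or> u = w2" for A u and y :: real
  proof -
    have "0 \<le> slab_prob u y" "slab_prob u y \<le> 1"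
      using that w_le_1 slab_prob_le_1 slab_prob_nonneg by auto
    then have "slab_prob u y * slab_prob u y \<le> slab_prob u y" "slab_prob u y \<le> 1"
      using mult_left_mono[of "slab_prob u y" 1 "slab_prob u y"] by auto
    then show "(indicator A y * slab_prob u y)\<^sup>2 \<le> indicator A y * slab_prob u y"
      "(indicator A y * slab_prob u y)\<^sup>2 \<le> indicator A y"
      by (auto simp: power2_eq_square split: split_indicator)
  qed
  have P6: "?P bad6 \<le> 2 / L" unfolding bad6_def
  proof (rule deviation_prob[OF indicator_measurable(4) slab_bounded(2) subsets(1)])
    show "0 < real s / 2" using s_ge by simp
    have "real (card Nulls) * (\<integral>x. (indicator {y. x1 < \<bar>y\<bar>} x * slab_prob w2 x)\<^sup>2 \<partial>std_normal)
      \<le> real (card Nulls) * (\<integral>x. indicator {y. x1 < \<bar>y\<bar>} x * slab_prob w2 x \<partial>std_normal)"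
      by (intro mult_left_mono sq_le indicator_measurable slab_bounded slab01) auto
    also have "\<dots> \<le> 193 * (real s * (ln L / L))" by (rule excess_mean)
    also have "\<dots> = real s * (193 * (ln L / L))" by simp
    also have "\<dots> \<le> real s * (1 / 2)" by (intro mult_left_mono L') auto
    also have "\<dots> \<le> real s * (real s / L / 2)" using s_ge L8
      by (intro mult_left_mono) (auto simp: le_divide_eq)
    also have "\<dots> = 2 / L * (real s / 2)\<^sup>2" by (simp add: power2_eq_square)
    finally show "real (card Nulls) * (\<integral>x. (indicator {y. x1 < \<bar>y\<bar>} x * slab_prob w2 x)\<^sup>2 \<partial>std_normal) \<le> 2 / L * (real s / 2)\<^sup>2" .
  qed
  have P7: "?P bad7 \<le> 8192\<^sup>2 / L" unfolding bad7_def
  proof (rule deviation_prob[OF indicator_measurable(3) slab_bounded(1) subsets(1)])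
    show "0 < real s * (ln L / L) / 8192" using s_ge L L8 by simp
    have "real (card Nulls) * (\<integral>x. (indicator {y. x2 \<le> \<bar>y\<bar>} x * slab_prob w1 x)\<^sup>2 \<partial>std_normal)
      \<le> real (card Nulls) * (\<integral>x. indicator {y. x2 \<le> \<bar>y\<bar>} x \<partial>std_normal)"
      by (intro mult_left_mono sq_le indicator_measurable slab_bounded indicator_bounded slab01) auto
    also have "\<dots> \<le> t * real s / 8" unfolding indicator_integral by (rule null_count)
    also have "\<dots> \<le> 1 * real s / 1" using t s_ge by (intro frac_le mult_right_mono) auto
    \<comment> \<open>The cubic growth of s enters here: resolving a sum to within a multiple of s
      ln L / L with failure probability O(1 / L), when its variance is only bounded by a multiple of
      s, calls for s of order L^3 up to logarithms.\<close>
    also have "\<dots> \<le> real s * (real s / L ^ 3) * (ln L * ln L)"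
    proof -
      have "1 * 1 \<le> ln L * ln L" using L by (intro mult_mono) auto
      moreover have "1 \<le> real s / L ^ 3" using s L8 by simp
      ultimately have "1 * 1 \<le> real s / L ^ 3 * (ln L * ln L)" by (intro mult_mono) auto
      then have "real s * (1 * 1) \<le> real s * (real s / L ^ 3 * (ln L * ln L))" by (intro mult_left_mono) auto
      then show ?thesis by simp
    qed
    also have "\<dots> = 8192\<^sup>2 / L * (real s * (ln L / L) / 8192)\<^sup>2"
      by (simp add: power2_eq_square power3_eq_cube mult_ac)
    finally show "real (card Nulls) * (\<integral>x. (indicator {y. x2 \<le> \<bar>y\<bar>} x * slab_prob w1 x)\<^sup>2 \<partial>std_normal)
      \<le> 8192\<^sup>2 / L * (real s * (ln L / L) / 8192)\<^sup>2" .
  qed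
  have sets: "bad1 \<in> sets (noise_law n)" "bad2 \<in> sets (noise_law n)" "bad3 \<in> sets (noise_law n)"
    "bad4 \<in> sets (noise_law n)" "bad5 \<in> sets (noise_law n)" "bad6 \<in> sets (noise_law n)" "bad7 \<in> sets (noise_law n)"
    unfolding bad1_def bad2_def bad3_def bad4_def bad5_def bad6_def bad7_def
    by (intro deviation_sets indicator_measurable score_measurable subsets)+
  have "?P bad \<le> ?P bad1 + ?P bad2 + ?P bad3 + ?P bad4 + ?P bad5 + ?P bad6 + ?P bad7"
    unfolding bad_def
    by (intro order_trans[OF measure_Un_le] add_mono sets.Un sets order_refl)
  also have "\<dots> \<le> 64 / t\<^sup>2 / L + 80 / L + 1088 / L + \<kappa> / L + 8 / t / L + 2 / L + 8192\<^sup>2 / L"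
    by (intro add_mono P1 P2 P3 P4 P5 P6 P7)
  also have "\<dots> = C / L" unfolding C by (simp only: add_divide_distrib)
  finally show ?thesis .
qed


section \<open>Consequences outside the exceptional event\<close>

lemma null_sets:
  "{i \<in> {1..n}. \<theta> i = 0 \<and> P (observation n \<theta> \<epsilon> i)} = {i \<in> Nulls. P (\<epsilon> i)}"
  by (auto simp: observation_def)

lemma null_counts:
  "(\<Sum>i\<in>Nulls. indicator {y. P y} (\<epsilon> i)) = real (card {i \<in> {1..n}. \<theta> i = 0 \<and> P (observation n \<theta> \<epsilon> i)})"
proof -
  have "(\<Sum>i\<in>Nulls. indicator {y. P y} (\<epsilon> i)) = (\<Sum>i\<in>Nulls. of_bool (P (\<epsilon> i)) :: real)"
    by (intro sum.cong) (auto simp: indicator_def)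
  also have "\<dots> = real (card {i \<in> Nulls. P (\<epsilon> i)})" by (rule sum_of_bool_card) simp
  finally show ?thesis by (simp only: null_sets)
qed

lemma null_excess:
  "(\<Sum>i\<in>Nulls. indicator {y. P y} (\<epsilon> i) * f (\<epsilon> i)) =
    (\<Sum>i | i \<in> {1..n} \<and> \<theta> i = 0 \<and> P (observation n \<theta> \<epsilon> i). f (observation n \<theta> \<epsilon> i) :: real)"
proof -
  have "(\<Sum>i\<in>Nulls. indicator {y. P y} (\<epsilon> i) * f (\<epsilon> i)) = (\<Sum>i\<in>Nulls. if P (\<epsilon> i) then f (\<epsilon> i) else 0)"
    by (intro sum.cong) (auto simp: indicator_def)
  also have "\<dots> = (\<Sum>i | i \<in> Nulls \<and> P (\<epsilon> i). f (\<epsilon> i))"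
    by (rule sum.inter_filter[symmetric]) simp
  also have "\<dots> = (\<Sum>i | i \<in> {1..n} \<and> \<theta> i = 0 \<and> P (observation n \<theta> \<epsilon> i). f (observation n \<theta> \<epsilon> i))"
    by (intro sum.cong) (auto simp: observation_def)
  finally show ?thesis .
qed

text \<open>A signal of size at least sqrt (2 L) + v that is observed below sqrt (2 L) + 1 needs
  noise above v - 1, and v - 1 \<ge> v / 2. The bound \<open>missed\<close> is a sum of independent
  terms.\<close>

lemma signal_missed:
  "real (card {i \<in> {1..n}. \<theta> i \<noteq> 0 \<and> \<bar>observation n \<theta> \<epsilon> i\<bar> < sqrt (2 * L) + 1}) \<le> missed \<epsilon>"
proof -
  have "real (card {i \<in> {1..n}. \<theta> i \<noteq> 0 \<and> \<bar>observation n \<theta> \<epsilon> i\<bar> < sqrt (2 * L) + 1})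
    \<le> real (card {i \<in> Signals. v / 2 \<le> \<bar>\<epsilon> i\<bar>})"
  proof (intro of_nat_mono card_mono subsetI)
    fix i assume i: "i \<in> {i \<in> {1..n}. \<theta> i \<noteq> 0 \<and> \<bar>observation n \<theta> \<epsilon> i\<bar> < sqrt (2 * L) + 1}"
    then have "\<bar>\<theta> i\<bar> \<ge> sqrt (2 * L) + v" by (intro signal_size) auto
    moreover have "observation n \<theta> \<epsilon> i = \<theta> i + \<epsilon> i" using i by (simp add: observation_def)
    then have "\<bar>\<theta> i + \<epsilon> i\<bar> < sqrt (2 * L) + 1" using i by simp
    ultimately have "v / 2 \<le> \<bar>\<epsilon> i\<bar>" using v(1) by (simp add: abs_if split: if_splits)
    then show "i \<in> {i \<in> Signals. v / 2 \<le> \<bar>\<epsilon> i\<bar>}" using i by simp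
  qed simp
  also have "\<dots> = (\<Sum>i\<in>Signals. of_bool (v / 2 \<le> \<bar>\<epsilon> i\<bar>))"
    by (rule sum_of_bool_card[symmetric]) simp
  also have "\<dots> = missed \<epsilon>" unfolding missed_def by (intro sum.cong) (auto simp: indicator_def)
  finally show ?thesis .
qed

lemma missed_nonneg: "missed \<epsilon> \<ge> 0"
  unfolding missed_def by (intro sum_nonneg) auto

lemma weight_n: "real s / w1 = 8 * real n / sqrt L" "real s / w2 = real n / (16 * sqrt L)"
  using L8 by (simp_all add: w_def weight_def exp_minus n field_simps)

lemma total_score_split:
  "total_score n (observation n \<theta> \<epsilon>) w = (\<Sum>i\<in>Nulls. score w (\<epsilon> i)) + (\<Sum>i\<in>Signals. score w (observation n \<theta> \<epsilon> i))"
proof -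
  have "total_score n (observation n \<theta> \<epsilon>) w = (\<Sum>i\<in>Nulls \<union> Signals. score w (observation n \<theta> \<epsilon> i))"
    unfolding total_score_def by (intro sum.cong) auto
  also have "\<dots> = (\<Sum>i\<in>Nulls. score w (observation n \<theta> \<epsilon> i)) + (\<Sum>i\<in>Signals. score w (observation n \<theta> \<epsilon> i))"
    by (rule sum.union_disjoint) auto
  also have "(\<Sum>i\<in>Nulls. score w (observation n \<theta> \<epsilon> i)) = (\<Sum>i\<in>Nulls. score w (\<epsilon> i))"
    by (intro sum.cong) (auto simp: observation_def)
  finally show ?thesis .
qed

lemma not_deviation:
  assumes "\<epsilon> \<in> space (noise_law n)" "\<epsilon> \<notin> deviation n h A a"
  shows "(\<Sum>i\<in>A. h (\<epsilon> i)) < real (card A) * (\<integral>x. h x \<partial>std_normal) + a"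
    "real (card A) * (\<integral>x. h x \<partial>std_normal) - a < (\<Sum>i\<in>A. h (\<epsilon> i))"
  using assms by (auto simp: deviation_def abs_less_iff)

lemma good_missed:
  assumes "\<epsilon> \<in> space (noise_law n)" "\<epsilon> \<notin> bad"
  shows "missed \<epsilon> \<le> t * real s / 4"
proof -
  have nb: "\<epsilon> \<notin> bad1" using assms by (simp add: bad_def)
  then have "missed \<epsilon> < real s * measure std_normal {y. v / 2 \<le> \<bar>y\<bar>} + t * real s / 8"
    using not_deviation(1)[OF assms(1) nb[unfolded bad1_def]]
    unfolding missed_def by (simp only: indicator_integral card_signals)
  also have "real s * measure std_normal {y. v / 2 \<le> \<bar>y\<bar>} \<le> real s * (t / 8)"
  proof (intro mult_left_mono)
    have "1 / L \<le> t / 8" using L8 by (simp add: divide_le_eq mult.commute)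
    then show "measure std_normal {y. v / 2 \<le> \<bar>y\<bar>} \<le> t / 8" using v(2) by linarith
  qed simp
  finally show ?thesis by (simp add: mult.commute)
qed

text \<open>In units of r = n / sqrt L: at \<open>w1\<close> the nulls cost at most 2 r, half from
  the mean and half from the deviation, and the signals bring 4 r less r + s / 4 for the missed
  ones, with s < r. At \<open>w2\<close> the nulls give at most - r / 4 + r / 8 and the signals at
  most r / 16. These balances account for the prefactors 1 / 8 and 16.\<close>

lemma good_scores:
  assumes "\<epsilon> \<in> space (noise_law n)" "\<epsilon> \<notin> bad"
  shows "total_score n (observation n \<theta> \<epsilon>) w1 > 0" "total_score n (observation n \<theta> \<epsilon>) w2 < 0"
proof -
  define r where "r = real n / sqrt L"
  have r: "r > real s"
  proof -
    have "L < exp L" using exp_ge_add_one_self[of L] by linarith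
    then have "L * real s < exp L * real s" using s_ge(2) by (intro mult_strict_right_mono)
    moreover have "sqrt L * (sqrt L * real s) = L * real s" using L8 by (simp flip: mult.assoc)
    moreover have "real n = exp L * real s" unfolding n by (rule mult.commute)
    moreover have "sqrt L * (1 * real s) \<le> sqrt L * (sqrt L * real s)"
      using L8 by (intro mult_left_mono mult_right_mono) auto
    ultimately have "sqrt L * (1 * real s) < real n" by linarith
    then have "real s * sqrt L < real n" by (simp only: mult_1_left mult.commute)
    then show ?thesis using L8 by (simp add: r_def less_divide_eq)
  qed
  have "\<epsilon> \<notin> bad2" "\<epsilon> \<notin> bad3" using assms by (auto simp: bad_def)
  have "- r \<le> - (real (card Nulls) / sqrt L)"
    using card_nulls L8 by (simp add: r_def divide_right_mono)
  also have "\<dots> = real (card Nulls) * (- 1 / sqrt L)" by simp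
  also have "\<dots> \<le> real (card Nulls) * (\<integral>x. score w1 x \<partial>std_normal)"
    by (intro mult_left_mono mean) auto
  finally have null1: "- 2 * r < (\<Sum>i\<in>Nulls. score w1 (\<epsilon> i))"
    using not_deviation(2)[OF assms(1) \<open>\<epsilon> \<notin> bad2\<close>[unfolded bad2_def]] by (simp add: r_def)
  have "real (card Nulls) * (\<integral>x. score w2 x \<partial>std_normal) \<le> real (card Nulls) * (- 1 / (2 * sqrt L))"
    by (intro mult_left_mono mean) auto
  also have "\<dots> = - (real (card Nulls) / (2 * sqrt L))" by simp
  also have "\<dots> \<le> - (real n / 2 / (2 * sqrt L))"
    using card_nulls L8 by (simp only: neg_le_iff_le) (intro divide_right_mono, auto)
  also have "\<dots> = - r / 4" by (simp add: r_def)
  finally have null2: "(\<Sum>i\<in>Nulls. score w2 (\<epsilon> i)) < - r / 8"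
    using not_deviation(1)[OF assms(1) \<open>\<epsilon> \<notin> bad3\<close>[unfolded bad3_def]] by (simp add: r_def)
  let ?m = "real (card {i \<in> {1..n}. \<theta> i \<noteq> 0 \<and> \<bar>observation n \<theta> \<epsilon> i\<bar> < sqrt (2 * L) + 1})"
  define c where "c = 1 / (2 * w1)"
  have c: "c > 0" "real s * c = 4 * r" using w weight_n(1) by (simp_all add: c_def r_def)
  have "(\<Sum>i\<in>Signals. c - (c + 1) * of_bool (\<bar>observation n \<theta> \<epsilon> i\<bar> < sqrt (2 * L) + 1))
    \<le> (\<Sum>i\<in>Signals. score w1 (observation n \<theta> \<epsilon> i))"
  proof (intro sum_mono)
    fix i
    show "c - (c + 1) * of_bool (\<bar>observation n \<theta> \<epsilon> i\<bar> < sqrt (2 * L) + 1) \<le> score w1 (observation n \<theta> \<epsilon> i)"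
    proof (cases "\<bar>observation n \<theta> \<epsilon> i\<bar> < sqrt (2 * L) + 1")
      case True
      then show ?thesis using score_lower[OF w_le_1(1,2)] by simp
    next
      case False
      then have "2 \<le> w1 * rho (observation n \<theta> \<epsilon> i)" using rho_large[of "observation n \<theta> \<epsilon> i"] L8 by simp
      then show ?thesis using False score_large[OF w(1) w_le_1(2)] by (simp add: c_def)
    qed
  qed
  moreover have "(\<Sum>i\<in>Signals. c - (c + 1) * of_bool (\<bar>observation n \<theta> \<epsilon> i\<bar> < sqrt (2 * L) + 1)) = real s * c - (c + 1) * ?m"
  proof -
    have "{i \<in> Signals. \<bar>observation n \<theta> \<epsilon> i\<bar> < sqrt (2 * L) + 1} = {i \<in> {1..n}. \<theta> i \<noteq> 0 \<and> \<bar>observation n \<theta> \<epsilon> i\<bar> < sqrt (2 * L) + 1}"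
      by auto
    moreover have "(\<Sum>i\<in>Signals. of_bool (\<bar>observation n \<theta> \<epsilon> i\<bar> < sqrt (2 * L) + 1) :: real)
        = real (card {i \<in> Signals. \<bar>observation n \<theta> \<epsilon> i\<bar> < sqrt (2 * L) + 1})"
      by (rule sum_of_bool_card) simp
    ultimately show ?thesis
      unfolding sum_subtractf sum_distrib_left[symmetric] using card_signals by simp
  qed
  moreover have "(c + 1) * ?m \<le> (c + 1) * (real s / 4)"
  proof (intro mult_left_mono)
    have "t * real s \<le> 1 * real s" using t by (intro mult_right_mono) auto
    then show "?m \<le> real s / 4" using signal_missed[of \<epsilon>] good_missed[OF assms] by linarith
  qed (use c in simp)
  moreover have "(c + 1) * (real s / 4) = r + real s / 4" using c by (simp add: algebra_simps)
  ultimately have "(\<Sum>i\<in>Signals. score w1 (observation n \<theta> \<epsilon> i)) \<ge> 3 * r - real s / 4" using c by linarith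
  then show "total_score n (observation n \<theta> \<epsilon>) w1 > 0"
    using null1 r s_ge(2) unfolding total_score_split by linarith
  have "(\<Sum>i\<in>Signals. score w2 (observation n \<theta> \<epsilon> i)) \<le> (\<Sum>i\<in>Signals. 1 / w2)"
    by (intro sum_mono score_upper w w_le_1)
  also have "\<dots> = r / 16" using card_signals weight_n(2) by (simp add: r_def)
  finally show "total_score n (observation n \<theta> \<epsilon>) w2 < 0"
    using null2 r s_ge(2) unfolding total_score_split by linarith
qed

lemma good:
  assumes "\<epsilon> \<in> space (noise_law n)" "\<epsilon> \<notin> bad" "inj_on (\<lambda>i. \<bar>observation n \<theta> \<epsilon> i\<bar>) {1..n}"
  shows "good_data n t (observation n \<theta> \<epsilon>) \<theta> s w1 w2 x1 x2 (sqrt (2 * L) + 1) (1 / L) (missed \<epsilon>) (\<kappa> + 1)"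
proof
  have nb: "\<epsilon> \<notin> bad4" "\<epsilon> \<notin> bad5" "\<epsilon> \<notin> bad6" using assms by (auto simp: bad_def)
  \<comment> \<open>The trial weight has to lie in the interval of maximisation; n *
    \<open>w1\<close> equals s sqrt L / 8.\<close>
  show "1 / real n \<le> w1"
  proof -
    have "8 * 1 \<le> real s * sqrt L" using s_ge L8 by (intro mult_mono) auto
    moreover have "real n * w1 = (real n * exp (- L)) * sqrt L / 8" by (simp add: w_def weight_def)
    ultimately have "1 \<le> real n * w1" unfolding n_exp(1) by simp
    then show ?thesis using n_exp(2) by (simp add: divide_le_eq mult.commute)
  qed
  show "w1 \<le> w2" using L8 by (simp add: w_def weight_def)
  show "ell_value w1 y \<le> 1 / L" if "sqrt (2 * L) + 1 \<le> \<bar>y\<bar>" for y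
  proof -
    have "ell_value w1 y \<le> 1 / (w1 * rho y)" by (rule ell_value_le[OF w(1) w_le_1(2)])
    also have "0 < rho y" using rho_ge_half[of y] by linarith
    then have "1 / (w1 * rho y) \<le> 1 / L"
      using rho_large[OF that] L8(2) w(1) by (intro divide_left_mono mult_pos_pos) auto
    finally show ?thesis .
  qed
  have "1 / L \<le> t / 8" using L8 by (simp add: divide_le_eq mult.commute)
  then show "1 / L \<le> t / 4" using t by linarith
  have V1: "real (card Nulls) * measure std_normal {y. x1 < \<bar>y\<bar>} - real s
      < real (card {i \<in> {1..n}. \<theta> i = 0 \<and> x1 < \<bar>observation n \<theta> \<epsilon> i\<bar>})"
    "real (card {i \<in> {1..n}. \<theta> i = 0 \<and> x1 < \<bar>observation n \<theta> \<epsilon> i\<bar>})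
      < real (card Nulls) * measure std_normal {y. x1 < \<bar>y\<bar>} + real s"
    using not_deviation[OF assms(1) nb(1)[unfolded bad4_def]]
    unfolding indicator_integral null_counts by simp_all
  \<comment> \<open>The mean count is at least 4 s / (1 - t), and the deviation s is at most s / (1
    - t).\<close>
  have "4 * real s / (1 - t) - real s \<ge> 3 * real s / (1 - t)"
  proof -
    have "real s * 1 \<le> real s * (1 / (1 - t))" using t by (intro mult_left_mono) auto
    then have "real s \<le> real s / (1 - t)" by simp
    moreover have "4 * real s / (1 - t) = 3 * real s / (1 - t) + real s / (1 - t)"
      by (simp flip: add_divide_distrib)
    ultimately show ?thesis by linarith
  qed
  then show "3 * real s / (1 - t) \<le> real (card {i \<in> {1..n}. \<theta> i = 0 \<and> x1 < \<bar>observation n \<theta> \<epsilon> i\<bar>})"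
    using V1 null_count by linarith
  show "real (card {i \<in> {1..n}. \<theta> i = 0 \<and> x1 < \<bar>observation n \<theta> \<epsilon> i\<bar>}) \<le> (\<kappa> + 1) * real s"
    using V1 null_count(2) by (simp add: distrib_right)
  have "real (card {i \<in> {1..n}. \<theta> i = 0 \<and> x2 \<le> \<bar>observation n \<theta> \<epsilon> i\<bar>})
      < real (card Nulls) * measure std_normal {y. x2 \<le> \<bar>y\<bar>} + t * real s / 8"
    using not_deviation(1)[OF assms(1) nb(2)[unfolded bad5_def]]
    unfolding indicator_integral null_counts by simp
  then show "real (card {i \<in> {1..n}. \<theta> i = 0 \<and> x2 \<le> \<bar>observation n \<theta> \<epsilon> i\<bar>}) \<le> t * real s / 4"
    using null_count(3) by linarith
  have "(\<Sum>i | i \<in> {1..n} \<and> \<theta> i = 0 \<and> x1 < \<bar>observation n \<theta> \<epsilon> i\<bar>. slab_prob w2 (observation n \<theta> \<epsilon> i))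
    < real (card Nulls) * (\<integral>y. indicator {y. x1 < \<bar>y\<bar>} y * slab_prob w2 y \<partial>std_normal) + real s / 2"
    using not_deviation(1)[OF assms(1) nb(3)[unfolded bad6_def]] unfolding null_excess .
  moreover have "193 * (real s * (ln L / L)) \<le> real s / 2"
    using mult_left_mono[OF L', of "real s"] by simp
  ultimately show "(\<Sum>i | i \<in> {1..n} \<and> \<theta> i = 0 \<and> x1 < \<bar>observation n \<theta> \<epsilon> i\<bar>. slab_prob w2 (observation n \<theta> \<epsilon> i)) \<le> real s"
    using excess_mean(1) by linarith
qed (use t s w n_exp(2) L8 x2 assms(3) card_signals signal_missed good_missed[OF assms(1,2)] good_scores[OF assms(1,2)] in auto)

lemma good_excess2:
  assumes "\<epsilon> \<in> space (noise_law n)" "\<epsilon> \<notin> bad"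
  shows "excess2 \<epsilon> \<ge> real s * (ln L / L) / 8192"
proof -
  have "\<epsilon> \<notin> bad7" using assms by (auto simp: bad_def)
  moreover have "q / 8192 \<le> b" if "a - q / 8192 < b" "q / 4096 \<le> a" for a b q :: real
    using that by linarith
  ultimately show ?thesis
    unfolding excess2_def bad7_def using not_deviation(2)[OF assms(1)] excess_mean(2) by blast
qed

section \<open>Integration of the pointwise bounds\<close>

lemma AE_inj: "AE \<epsilon> in noise_law n. inj_on (\<lambda>i. \<bar>observation n \<theta> \<epsilon> i\<bar>) {1..n}"
proof -
  have "AE \<epsilon> in noise_law n. \<forall>i\<in>{1..n}. \<forall>j\<in>{1..n}. i \<noteq> j \<longrightarrow> \<bar>\<theta> i + \<epsilon> i\<bar> \<noteq> \<bar>\<theta> j + \<epsilon> j\<bar>"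
  proof (intro AE_finite_allI finite_atLeastAtMost)
    fix i j assume ij: "i \<in> {1..n}" "j \<in> {1..n}"
    show "AE \<epsilon> in noise_law n. i \<noteq> j \<longrightarrow> \<bar>\<theta> i + \<epsilon> i\<bar> \<noteq> \<bar>\<theta> j + \<epsilon> j\<bar>"
      using noise_no_ties[OF ij] by (cases "i = j") auto
  qed
  then show ?thesis by eventually_elim (auto simp: inj_on_def observation_def)
qed

lemma missed_integral: "integrable (noise_law n) missed" "(\<integral>\<epsilon>. missed \<epsilon> \<partial>noise_law n) \<le> real s / L"
proof -
  note * = noise_sum_integral[OF indicator_measurable(1) indicator_bounded subsets(2), of "v / 2"]
  show "integrable (noise_law n) missed" using *(1) unfolding missed_def[abs_def] .
  have "(\<integral>\<epsilon>. missed \<epsilon> \<partial>noise_law n) = real s * measure std_normal {y. v / 2 \<le> \<bar>y\<bar>}"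
    using *(2) unfolding missed_def indicator_integral card_signals .
  also have "\<dots> \<le> real s * (1 / L)" by (intro mult_left_mono v) auto
  finally show "(\<integral>\<epsilon>. missed \<epsilon> \<partial>noise_law n) \<le> real s / L" by simp
qed

lemma excess1_integral: "integrable (noise_law n) excess1" "(\<integral>\<epsilon>. excess1 \<epsilon> \<partial>noise_law n) \<le> 193 * (real s * (ln L / L))"
proof -
  note * = noise_sum_integral[OF indicator_measurable(4) slab_bounded(2) subsets(1), of x1]
  show "integrable (noise_law n) excess1" using *(1) unfolding excess1_def[abs_def] .
  show "(\<integral>\<epsilon>. excess1 \<epsilon> \<partial>noise_law n) \<le> 193 * (real s * (ln L / L))"
    using *(2) excess_mean(1) unfolding excess1_def by simp
qed

lemma excess1_nonneg: "excess1 \<epsilon> \<ge> 0"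
  unfolding excess1_def using slab_prob_nonneg[OF w_le_1(3,4)] by (intro sum_nonneg mult_nonneg_nonneg) auto

text \<open>On the exceptional event the bound is trivial, since the proportion is at most 1; the
  price is its probability after integration.\<close>

lemma FDP_upper_noise:
  "AE \<epsilon> in noise_law n. FDP n (cl_procedure t n (observation n \<theta> \<epsilon>)) \<theta> \<le> t + 2 * excess1 \<epsilon> / real s + indicator bad \<epsilon>"
  using AE_inj AE_space
proof eventually_elim
  case (elim \<epsilon>)
  show ?case
  proof (cases "\<epsilon> \<in> bad")
    case True
    have "0 \<le> t + 2 * excess1 \<epsilon> / real s" using excess1_nonneg t by (intro add_nonneg_nonneg) auto
    then show ?thesis using True FDP_bounds(2)[of n "cl_procedure t n (observation n \<theta> \<epsilon>)" \<theta>] by simp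
  next
    case False
    note data = good[OF elim(2) False elim(1)]
    show ?thesis using good_data.FDP_upper[OF data] False unfolding excess1_def null_excess by simp
  qed
qed

lemma FNP_upper_noise:
  "AE \<epsilon> in noise_law n. FNP n (cl_procedure t n (observation n \<theta> \<epsilon>)) \<theta> \<le> missed \<epsilon> / real s + indicator bad \<epsilon>"
  using AE_inj AE_space
proof eventually_elim
  case (elim \<epsilon>)
  show ?case
  proof (cases "\<epsilon> \<in> bad")
    case True
    have "0 \<le> missed \<epsilon> / real s" using missed_nonneg by (intro divide_nonneg_nonneg) auto
    then show ?thesis using True FNP_bounds(2)[of n "cl_procedure t n (observation n \<theta> \<epsilon>)" \<theta>] by simp
  next
    case False
    note data = good[OF elim(2) False elim(1)]
    show ?thesis using good_data.FNP_le[OF data] False by simp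
  qed
qed

definition "c0 = 1 / (8192 * (\<kappa> + 2))"

lemma ln_L_ratio: "0 \<le> ln L / L" "ln L / L \<le> 1" "1 / L \<le> ln L / L"
proof -
  show "0 \<le> ln L / L" "1 / L \<le> ln L / L" using L L8 by (auto intro: divide_right_mono)
  have "ln L \<le> L" using ln_le_minus_one[of L] L8 by linarith
  then show "ln L / L \<le> 1" using L8 by simp
qed

lemma c0: "0 < c0" "c0 \<le> 1"
  using \<kappa> by (auto simp: c0_def divide_le_eq)

text \<open>The coefficient 2 of the indicator makes the left side nonpositive on the exceptional
  event, because t < 1 and \<open>c0 * (ln L / L)\<close> is at most 1.\<close>

lemma FDP_lower_noise:
  "AE \<epsilon> in noise_law n. t + c0 * (ln L / L) - 2 * (missed \<epsilon> + real s / L + 1) / real s - 2 * indicator bad \<epsilon>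
    \<le> FDP n (cl_procedure t n (observation n \<theta> \<epsilon>)) \<theta>"
  using AE_inj AE_space
proof eventually_elim
  case (elim \<epsilon>)
  show ?case
  proof (cases "\<epsilon> \<in> bad")
    case True
    have "c0 * (ln L / L) \<le> 1 * 1" using c0 ln_L_ratio by (intro mult_mono) auto
    moreover have "0 \<le> 2 * (missed \<epsilon> + real s / L + 1) / real s"
      using missed_nonneg[of \<epsilon>] L8 by (intro divide_nonneg_nonneg) auto
    ultimately show ?thesis
      using True t FDP_bounds(1)[of n "cl_procedure t n (observation n \<theta> \<epsilon>)" \<theta>] by simp
  next
    case False
    note data = good[OF elim(2) False elim(1)]
    have "c0 * (ln L / L) = real s * (ln L / L) / 8192 / ((\<kappa> + 1 + 1) * real s)"
      using s_ge(2) by (simp add: c0_def)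
    also have "\<dots> \<le> excess2 \<epsilon> / ((\<kappa> + 1 + 1) * real s)"
      using good_excess2[OF elim(2) False] \<kappa> by (intro divide_right_mono) auto
    finally show ?thesis using good_data.FDP_lower[OF data] False unfolding excess2_def null_excess by simp
  qed
qed

theorem regime_bounds:
  "FDR n (cl_procedure t n) \<theta> - t \<le> (386 + C) * (ln L / L)"
  "FNR n (cl_procedure t n) \<theta> \<le> (1 + C) * inverse L"
  "1 / (16384 * (\<kappa> + 2)) * (ln L / L) \<le> FDR n (cl_procedure t n) \<theta> - t"
proof -
  interpret N: prob_space "noise_law n" by (rule prob_space_noise_law)
  have t0: "0 \<le> t" using t by simp
  note n1 = n_exp(2)
  have C0: "C > 0" unfolding C using t \<kappa> by (intro add_pos_pos divide_pos_pos) auto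
  have ind: "integrable (noise_law n) (indicator bad :: _ \<Rightarrow> real)"
    "(\<integral>\<epsilon>. indicator bad \<epsilon> \<partial>noise_law n) \<le> C / L"
    using bad_sets prob_bad by (auto simp: N.emeasure_eq_measure)
  have FDPm: "(\<lambda>\<epsilon>. FDP n (cl_procedure t n (observation n \<theta> \<epsilon>)) \<theta>) \<in> borel_measurable (noise_law n)"
    using measurable_compose[OF observation_measurable FDP_measurable[OF n1 t0]] .
  have FNPm: "(\<lambda>\<epsilon>. FNP n (cl_procedure t n (observation n \<theta> \<epsilon>)) \<theta>) \<in> borel_measurable (noise_law n)"
    using measurable_compose[OF observation_measurable FNP_measurable[OF n1 t0]] .
  have FDPi: "integrable (noise_law n) (\<lambda>\<epsilon>. FDP n (cl_procedure t n (observation n \<theta> \<epsilon>)) \<theta>)"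
    using FDP_bounds by (intro N.integrable_const_bound[of _ 1] FDPm) auto
  have FNPi: "integrable (noise_law n) (\<lambda>\<epsilon>. FNP n (cl_procedure t n (observation n \<theta> \<epsilon>)) \<theta>)"
    using FNP_bounds by (intro N.integrable_const_bound[of _ 1] FNPm) auto

  have "FDR n (cl_procedure t n) \<theta> \<le> (\<integral>\<epsilon>. t + 2 * excess1 \<epsilon> / real s + indicator bad \<epsilon> \<partial>noise_law n)"
    unfolding FDR_eq[OF n1 t0] using excess1_integral ind FDPi FDP_upper_noise
    by (intro integral_mono_AE) auto
  also have "\<dots> = t + 2 * (\<integral>\<epsilon>. excess1 \<epsilon> \<partial>noise_law n) / real s + (\<integral>\<epsilon>. indicator bad \<epsilon> \<partial>noise_law n)"
    using excess1_integral ind by (simp add: N.prob_space)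
  also have "\<dots> \<le> t + 2 * (193 * (real s * (ln L / L))) / real s + C * (ln L / L)"
  proof (intro add_mono order_refl divide_right_mono mult_left_mono excess1_integral)
    have "C * (1 / L) \<le> C * (ln L / L)" using ln_L_ratio C0 by (intro mult_left_mono) auto
    then show "(\<integral>\<epsilon>. indicator bad \<epsilon> \<partial>noise_law n) \<le> C * (ln L / L)" using ind(2) by simp
  qed auto
  also have "\<dots> = t + (386 + C) * (ln L / L)" using s_ge(2) L8(2) by (simp add: field_simps)
  finally show "FDR n (cl_procedure t n) \<theta> - t \<le> (386 + C) * (ln L / L)" by simp

  have "FNR n (cl_procedure t n) \<theta> \<le> (\<integral>\<epsilon>. missed \<epsilon> / real s + indicator bad \<epsilon> \<partial>noise_law n)"
    unfolding FNR_eq[OF n1 t0] using missed_integral ind FNPi FNP_upper_noise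
    by (intro integral_mono_AE) auto
  also have "\<dots> = (\<integral>\<epsilon>. missed \<epsilon> \<partial>noise_law n) / real s + (\<integral>\<epsilon>. indicator bad \<epsilon> \<partial>noise_law n)"
    using missed_integral ind by simp
  also have "\<dots> \<le> (real s / L) / real s + C / L"
    by (intro add_mono divide_right_mono missed_integral ind) auto
  also have "\<dots> = (1 + C) * inverse L" using s_ge(2) L8(2) by (simp add: field_simps)
  finally show "FNR n (cl_procedure t n) \<theta> \<le> (1 + C) * inverse L" .

  \<comment> \<open>The losses add up to (2 C + 6) / L: missed signals, detected signals and the
    lost summand each cost 2 / L, and the exceptional event 2 C / L. The assumed lower bound on ln L
    makes this at most half of the main term.\<close>
  have "c0 / 2 * (ln L / L) \<le> c0 * (ln L / L) - (4 * C + 12) / 2 / L"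
  proof -
    have eq: "8192 * (\<kappa> + 2) * (4 * C + 12) * c0 = 4 * C + 12" using \<kappa> by (simp add: c0_def)
    have "8192 * (\<kappa> + 2) * (4 * C + 12) * c0 \<le> ln L * c0" using L(3) c0 by (intro mult_right_mono) auto
    then have "4 * C + 12 \<le> c0 * ln L" unfolding eq by (simp only: mult.commute)
    then have "(4 * C + 12) / 2 / L \<le> c0 * ln L / 2 / L" using L8 by (intro divide_right_mono) auto
    then show ?thesis by simp
  qed
  also have "(4 * C + 12) / 2 / L = 2 * (C / L) + 6 * (1 / L)" using L8 by (simp add: field_simps)
  also have "c0 * (ln L / L) - (2 * (C / L) + 6 * (1 / L))
    \<le> c0 * (ln L / L) - 2 * ((real s / L) / real s + 1 / L + 1 / real s) - 2 * (C / L)"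
    using s_ge by simp
  also have "\<dots> \<le> c0 * (ln L / L) - 2 * ((\<integral>\<epsilon>. missed \<epsilon> \<partial>noise_law n) / real s + 1 / L + 1 / real s)
      - 2 * (\<integral>\<epsilon>. indicator bad \<epsilon> \<partial>noise_law n)"
    by (intro diff_mono order_refl mult_left_mono add_mono divide_right_mono missed_integral ind) auto
  also have "\<dots> = (\<integral>\<epsilon>. t + c0 * (ln L / L) - 2 * (missed \<epsilon> + real s / L + 1) / real s - 2 * indicator bad \<epsilon> \<partial>noise_law n) - t"
    using missed_integral ind s_ge(2) by (simp add: N.prob_space add_divide_distrib)
  also have "\<dots> \<le> FDR n (cl_procedure t n) \<theta> - t"
    unfolding FDR_eq[OF n1 t0] using missed_integral ind FDPi FDP_lower_noise
    by (intro diff_right_mono integral_mono_AE) auto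
  also have "c0 / 2 = 1 / (16384 * (\<kappa> + 2))" by (simp add: c0_def)
  finally show "1 / (16384 * (\<kappa> + 2)) * (ln L / L) \<le> FDR n (cl_procedure t n) \<theta> - t" .
qed

end

text \<open>Only L has to be large; n, s, v and the signal are quantified afterwards, which is the
  source of uniformity. \<open>\<kappa>\<close> is chosen so that the constant of
  \<open>tail_point_lower\<close> turns it into 8 / (1 - t), and t / 8 limits the mean number of
  nulls beyond the second threshold to t s / 8.\<close>

lemma regime_eventually:
  fixes t \<kappa> C :: real
  assumes t: "0 < t" "t < 1"
    and \<kappa>: "\<kappa> = 8 / ((exp (- 3 / 2) / (2 * sqrt pi)) * (1 - t))"
    and C: "C = 64 / t\<^sup>2 + 80 + 1088 + \<kappa> + 8 / t + 2 + 8192\<^sup>2"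
  shows "\<forall>\<^sub>F L in at_top. \<forall>n s v \<theta>. s \<ge> 1 \<and> real s \<ge> L ^ 3 \<and> real n = real s * exp L \<and>
    v \<ge> 3 * sqrt (ln L) \<and> \<theta> \<in> signal_class n s v \<longrightarrow>
    regime t L \<kappa> v n s \<theta> (weight (1 / 8) L) (weight 16 L) (tail_point \<kappa> L) (tail_point (t / 8) L) C"
proof -
  have c: "exp (- 3 / 2) / (2 * sqrt pi) > 0" by simp
  have \<kappa>0: "\<kappa> > 0" unfolding \<kappa> using t c by (intro divide_pos_pos mult_pos_pos) auto
  have \<kappa>1: "exp (- 3 / 2) / (2 * sqrt pi) * \<kappa> = 8 / (1 - t)" unfolding \<kappa> using c t by simp
  have e: "(0 :: real) < 1 / 8" "(0 :: real) < 16" by simp_all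
  have t8: "t / 8 > 0" using t by simp
  have ln_large: "\<forall>\<^sub>F L in at_top. ln L \<ge> B" for B :: real
    using ln_at_top by (simp add: filterlim_at_top)
  have "((\<lambda>L::real. ln L / L) \<longlongrightarrow> 0) at_top" by real_asymp
  then have "\<forall>\<^sub>F L::real in at_top. ln L / L < 1 / 386" by (rule order_tendstoD) simp
  then have "\<forall>\<^sub>F L::real in at_top. 193 * (ln L / L) \<le> 1 / 2" by (rule eventually_mono) linarith
  moreover have "\<forall>\<^sub>F L in at_top. ln L \<ge> max 1 (8192 * (\<kappa> + 2) * (4 * C + 12))" by (rule ln_large)
  moreover note eventually_ge_at_top[of "8 / t"]
    weight_range[OF e(1)] weight_range[OF e(2)] score_mean_lower[OF e(1)] score_mean_upper[OF e(2)]
    score_second_moment[OF e(1)] score_second_moment[OF e(2)]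
    tail_point_lower[OF \<kappa>0] tail_point_upper[OF \<kappa>0] tail_point_upper[OF t8] tail_point_range[OF t8]
    slab_tail_mean_upper[OF \<kappa>0 e(2)] slab_tail_mean_lower[OF t8 e(1)]
    weight_rho_large[OF e(1)] signal_noise_tail
  ultimately show ?thesis
  proof eventually_elim
    case (elim L)
    show ?case
    proof (intro allI impI)
      fix n s :: nat and v :: real and \<theta> :: "nat \<Rightarrow> real"
      assume *: "s \<ge> 1 \<and> real s \<ge> L ^ 3 \<and> real n = real s * exp L \<and> v \<ge> 3 * sqrt (ln L) \<and> \<theta> \<in> signal_class n s v"
      have L0: "L > 0" using elim(3) t by (smt (verit) divide_pos_pos)
      show "regime t L \<kappa> v n s \<theta> (weight (1 / 8) L) (weight 16 L) (tail_point \<kappa> L) (tail_point (t / 8) L) C"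
      proof
        have "(\<integral>x. (score (weight 16 L) x)\<^sup>2 \<partial>std_normal) \<le> (16 + 1 / 16\<^sup>2) * exp L / (L * sqrt L)"
          using elim by simp
        also have "\<dots> \<le> 17 * exp L / (L * sqrt L)"
          using L0 by (intro divide_right_mono mult_right_mono) (auto simp: power2_eq_square)
        finally show "(\<integral>x. (score (weight 16 L) x)\<^sup>2 \<partial>std_normal) \<le> 17 * exp L / (L * sqrt L)" .
        have "(16 + 1 / (1 / 8)\<^sup>2) = (80 :: real)" by (simp add: power2_eq_square)
        then show "(\<integral>x. (score (weight (1 / 8) L) x)\<^sup>2 \<partial>std_normal) \<le> 80 * exp L / (L * sqrt L)"
          using elim(8) by (simp only:)
        show "8 / (1 - t) * exp (- L) \<le> measure std_normal {y. tail_point \<kappa> L < \<bar>y\<bar>}"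
          using elim(10) unfolding \<kappa>1 .
        have "measure std_normal {y. tail_point \<kappa> L < \<bar>y\<bar>} \<le> measure std_normal {y. tail_point \<kappa> L \<le> \<bar>y\<bar>}"
          by (intro std_normal.finite_measure_mono) auto
        also have "\<dots> \<le> \<kappa> * exp (- L)" by (rule elim(11))
        finally show "measure std_normal {y. tail_point \<kappa> L < \<bar>y\<bar>} \<le> \<kappa> * exp (- L)" .
        show "v \<ge> 2" "measure std_normal {y. v / 2 \<le> \<bar>y\<bar>} \<le> 1 / L" using elim(17) * by auto
      qed (use elim * t \<kappa>0 C in \<open>auto\<close>)
    qed
  qed
qed

theorem theorem2:
  fixes t :: real
  assumes "0 < t" and "t < 1"
  shows "\<exists>c>0. \<exists>C>0. \<exists>C'>0. \<forall>(s :: nat \<Rightarrow> nat) (v :: nat \<Rightarrow> real).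
    (\<forall>n\<ge>1. s n > 0) \<and>
    filterlim s at_top sequentially \<and>
    (\<lambda>n. real (s n) / real n) \<longlonglongrightarrow> 0 \<and>
    filterlim v at_top sequentially \<and>
    (\<forall>\<^sub>F n in sequentially. real (s n) \<ge> (ln (real n)) ^ 3) \<and>
    (\<forall>\<^sub>F n in sequentially. v n \<ge> 3 * sqrt (ln (ln (real n / real (s n))))) \<longrightarrow>
    (\<forall>\<^sub>F n in sequentially. \<forall>\<theta> \<in> signal_class n (s n) (v n).
       c * (ln (ln (real n / real (s n))) / ln (real n / real (s n)))
         \<le> FDR n (cl_procedure t n) \<theta> - t \<and>
       FDR n (cl_procedure t n) \<theta> - t
         \<le> C * (ln (ln (real n / real (s n))) / ln (real n / real (s n))) \<and>
       FNR n (cl_procedure t n) \<theta> \<le> C' * inverse (ln (real n / real (s n))))"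
proof -
  define \<kappa> where "\<kappa> = 8 / ((exp (- 3 / 2) / (2 * sqrt pi)) * (1 - t))"
  define C where "C = 64 / t\<^sup>2 + 80 + 1088 + \<kappa> + 8 / t + 2 + 8192\<^sup>2"
  have \<kappa>0: "\<kappa> > 0" unfolding \<kappa>_def using assms by (intro divide_pos_pos mult_pos_pos) auto
  have C0: "C > 0" unfolding C_def using assms \<kappa>0 by (intro add_pos_pos divide_pos_pos) auto
  have main: "\<forall>\<^sub>F n in sequentially. \<forall>\<theta> \<in> signal_class n (s n) (v n).
       1 / (16384 * (\<kappa> + 2)) * (ln (ln (real n / real (s n))) / ln (real n / real (s n)))
         \<le> FDR n (cl_procedure t n) \<theta> - t \<and>
       FDR n (cl_procedure t n) \<theta> - t
         \<le> (386 + C) * (ln (ln (real n / real (s n))) / ln (real n / real (s n))) \<and>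
       FNR n (cl_procedure t n) \<theta> \<le> (1 + C) * inverse (ln (real n / real (s n)))"
    if s: "\<And>n. n \<ge> 1 \<Longrightarrow> s n > 0" "(\<lambda>n. real (s n) / real n) \<longlonglongrightarrow> 0"
      "\<forall>\<^sub>F n in sequentially. real (s n) \<ge> (ln (real n)) ^ 3"
      and v: "\<forall>\<^sub>F n in sequentially. v n \<ge> 3 * sqrt (ln (ln (real n / real (s n))))"
    for s :: "nat \<Rightarrow> nat" and v :: "nat \<Rightarrow> real"
  proof -
    have "\<forall>\<^sub>F n in sequentially. 0 < real (s n) / real n"
      using eventually_ge_at_top[of 1] by eventually_elim (use s(1) in simp)
    then have "filterlim (\<lambda>n. inverse (real (s n) / real n)) at_top sequentially"
      by (rule filterlim_inverse_at_top[OF s(2)])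
    then have lim: "filterlim (\<lambda>n. ln (real n / real (s n))) at_top sequentially"
      using filterlim_compose[OF ln_at_top] by (simp add: inverse_divide)
    \<comment> \<open>Because s n / n tends to 0, L = ln (n / s n) tends to infinity, and composing
      with it turns statements about large L into statements about large n.\<close>
    have reg: "\<forall>\<^sub>F n in sequentially. \<forall>n' s' v' \<theta>. s' \<ge> 1 \<and> real s' \<ge> (ln (real n / real (s n))) ^ 3 \<and>
      real n' = real s' * exp (ln (real n / real (s n))) \<and> v' \<ge> 3 * sqrt (ln (ln (real n / real (s n)))) \<and> \<theta> \<in> signal_class n' s' v' \<longrightarrow>
      regime t (ln (real n / real (s n))) \<kappa> v' n' s' \<theta> (weight (1 / 8) (ln (real n / real (s n)))) (weight 16 (ln (real n / real (s n))))
        (tail_point \<kappa> (ln (real n / real (s n)))) (tail_point (t / 8) (ln (real n / real (s n)))) C"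
      using eventually_compose_filterlim[OF regime_eventually[OF assms \<kappa>_def C_def] lim] .
    have pos: "\<forall>\<^sub>F n in sequentially. 0 \<le> ln (real n / real (s n))"
      using lim by (simp add: filterlim_at_top)
    show ?thesis using reg pos s(3) v eventually_ge_at_top[of 1]
    proof eventually_elim
      case (elim n)
      define L where "L = ln (real n / real (s n))"
      have sn: "s n \<ge> 1" using s(1) elim(5) by (simp add: Suc_le_eq)
      \<comment> \<open>As s n \<ge> 1, L is at most ln n, so the assumed bound (ln n)^3 \<le> s n
        passes to L^3.\<close>
      have "L = ln (real n) - ln (real (s n))" unfolding L_def using sn elim(5) by (simp add: ln_div)
      moreover have "ln (real (s n)) \<ge> 0" using sn by simp
      ultimately have "L ^ 3 \<le> ln (real n) ^ 3" using elim(2) by (intro power_mono) (auto simp: L_def)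
      then have s3: "L ^ 3 \<le> real (s n)" using elim(3) by linarith
      have nL: "real n = real (s n) * exp L" using sn elim(5) by (simp add: L_def)
      show ?case
      proof
        fix \<theta> assume "\<theta> \<in> signal_class n (s n) (v n)"
        then have "regime t L \<kappa> (v n) n (s n) \<theta> (weight (1 / 8) L) (weight 16 L) (tail_point \<kappa> L) (tail_point (t / 8) L) C"
          using elim(1)[rule_format, of "s n" n "v n" \<theta>] sn s3 nL elim(4) unfolding L_def by blast
        from regime.regime_bounds[OF this]
        show "1 / (16384 * (\<kappa> + 2)) * (ln (ln (real n / real (s n))) / ln (real n / real (s n)))
            \<le> FDR n (cl_procedure t n) \<theta> - t \<and>
          FDR n (cl_procedure t n) \<theta> - t
            \<le> (386 + C) * (ln (ln (real n / real (s n))) / ln (real n / real (s n))) \<and>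
          FNR n (cl_procedure t n) \<theta> \<le> (1 + C) * inverse (ln (real n / real (s n)))"
          unfolding L_def by blast
      qed
    qed
  qed
  have "1 / (16384 * (\<kappa> + 2)) > 0" "386 + C > 0" "1 + C > 0" using \<kappa>0 C0 by auto
  with main show ?thesis by blast
qed

end
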